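(* There exists an absolute constant $C>0$ such that the following holds. Let $G=([n],E)\sim {\sf G}(n,\tfrac12,k)$ with a planted clique $K$ of size $k\ge C\sqrt{n}$, and let $T:=2\left(\log^* n-\log^*(k/\sqrt{n})\right)+3$. Then for all large enough $n$ there exists a deterministic algorithm (in the space-bounded model described in the context) that takes as input the adjacency matrix of $G$ and the clique size $k$, outputs exactly the clique $K$ with probability at least $1-O\left(\left(\tfrac1n\right)^{\log k}\right)$ over the randomness of $G$, and uses $O(T\cdot\log n)$ bits of working space. In particular: (1) if $k=C\sqrt{n}$, the space usage is $O(\log^* n\cdot \log n)$ bits; (2) if $k=\omega(\sqrt{n}\,\log^{(\ell)} n)$ for some constant integer $\ell>0$, the space usage is $O(\log n)$ bits.
   Context: ${\sf G}(n,\tfrac12,k)$ (planted clique distribution): on vertex set $[n]=\{1,\dots,n\}$, a set $K\subset[n]$ of size $k$ is chosen uniformly at random among all $\binom nk$ subsets; every pair of distinct vertices in $K$ is joined by an edge, and every other pair of distinct vertices is joined independently with probability $1/2$. All logarithms are base 2. $\log^{(\ell)} n$ denotes the logarithm iterated $\ell$ times, and $\log^* n$ is defined by $\log^* n=0$ if $n\le 1$ and $\log^* n=1+\log^*(\log n)$ if $n>1$. Model of computation: a deterministic $s(n)$-space algorithm receives as read-only input the $n\times n$ adjacency matrix of the graph and the number $k$, each entry stored in its own register with random access; it has $s(n)$ bits of working space; its output is written to a write-only tape that does not count toward the space bound (so outputs larger than $s(n)$ are allowed). Basic arithmetic on $O(\log n)$-bit numbers can be done in $O(\log n)$ bits of space,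 and $n$ can be determined using $O(\log n)$ bits of space. *)

theory Defs
  imports
    "HOL-Probability.Product_PMF"
    "HOL-Library.Ramsey"
    "HOL-Library.Landau_Symbols"
    "HOL-Library.Log_Nat"
begin

section \<open>Iterated logarithm\<close>

lemma log2_le_minus_one:
  fixes x :: real
  assumes "x \<ge> 2"
  shows "log 2 x \<le> x - 1"
proof -
  have l2: "ln (2::real) > 1 / 2"
    using ln2_ge_two_thirds by linarith
  have "ln x = ln (x / 2) + ln 2"
    using assms by (simp add: ln_div)
  also have "\<dots> \<le> (x / 2 - 1) + ln 2"
    using ln_le_minus_one[of "x / 2"] assms by simp
  also have "\<dots> = (x - 2) * (1 / 2) + ln 2"
    by (simp add: field_simps)
  also have "\<dots> \<le> (x - 2) * ln 2 + ln 2"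
    using l2 assms by (intro add_right_mono mult_left_mono) auto
  finally have "ln x \<le> (x - 1) * ln 2"
    by (simp add: algebra_simps)
  then show ?thesis
    by (simp add: log_def field_simps)
qed

function log_star :: "real \<Rightarrow> nat" where
  "log_star x = (if x \<le> 1 then 0 else 1 + log_star (log 2 x))"
  by auto
termination
proof (relation "Wellfounded.measure (\<lambda>x. nat \<lceil>x\<rceil>)")
  fix x :: real
  assume x: "\<not> x \<le> 1"
  have "\<lceil>log 2 x\<rceil> < \<lceil>x\<rceil>"
  proof (cases "x \<ge> 2")
    case True
    then have "log 2 x \<le> x - 1"
      by (rule log2_le_minus_one)
    then have "\<lceil>log 2 x\<rceil> \<le> \<lceil>x - 1\<rceil>"
      by (rule ceiling_mono)
    then show ?thesis
      by simp
  next
    case False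
    with x have "log 2 x \<le> 1"
      by simp
    then have "\<lceil>log 2 x\<rceil> \<le> 1"
      by (simp add: ceiling_le_iff)
    also have "1 < \<lceil>x\<rceil>"
      using x by (simp add: less_ceiling_iff)
    finally show ?thesis .
  qed
  moreover have "0 < \<lceil>x\<rceil>"
    using x by (simp add: less_ceiling_iff)
  ultimately show "(log 2 x, x) \<in> Wellfounded.measure (\<lambda>x. nat \<lceil>x\<rceil>)"
    by simp
qed simp

declare log_star.simps [simp del]

definition rounds :: "nat \<Rightarrow> nat \<Rightarrow> real" where
  "rounds n k = 2 * (real (log_star (real n)) - real (log_star (real k / sqrt (real n)))) + 3"


section \<open>Planted clique distribution\<close>

text \<open>
  A graph on \<open>{1..n}\<close> is given by its edge set \<open>E \<subseteq> nsets {1..n} 2\<close>.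
  The distribution is on pairs \<open>(K, E)\<close> of the planted clique and the resulting graph.
\<close>

definition planted_clique :: "nat \<Rightarrow> nat \<Rightarrow> (nat set \<times> nat set set) pmf" where
  "planted_clique n k =
     do {
       K \<leftarrow> pmf_of_set (nsets {1..n} k);
       b \<leftarrow> Pi_pmf (nsets {1..n} 2 - nsets K 2) False (\<lambda>_. bernoulli_pmf (1 / 2));
       return_pmf (K, nsets K 2 \<union> {e \<in> nsets {1..n} 2 - nsets K 2. b e})
     }"

definition adj_matrix :: "nat \<Rightarrow> nat set set \<Rightarrow> nat \<Rightarrow> nat \<Rightarrow> nat" where
  "adj_matrix n E i j = of_bool (i \<in> {1..n} \<and> j \<in> {1..n} \<and> {i, j} \<in> E)"


section \<open>Space-bounded random access machines\<close>

text \<open>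
  Programs work on registers that hold natural numbers, with direct and indirect addressing.
  The input, consisting of \<open>n\<close>, the matrix \<open>A\<close> and \<open>k\<close>, is read-only: single matrix
  entries are fetched by \<open>Entry\<close>.  The output is write-only and not charged.  Every
  intermediate result is stored in a register, so that it is charged.
\<close>

type_synonym mem = "nat \<Rightarrow> nat"

datatype loc = Reg nat | Ind nat

datatype expr =
    Const nat
  | Load loc
  | Add loc loc
  | Sub loc loc
  | Mul loc loc
  | Div loc loc
  | Mod loc loc
  | InputDim
  | InputSize
  | Entry loc loc

datatype prog =
    Skip
  | Assign loc expr
  | Output loc
  | Seq prog prog
  | Cond loc prog prog
  | While loc prog

fun addr :: "mem \<Rightarrow> loc \<Rightarrow> nat" where
  "addr m (Reg a) = a"
| "addr m (Ind a) = m a"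

definition fetch :: "mem \<Rightarrow> loc \<Rightarrow> nat" where
  "fetch m l = m (addr m l)"

fun expr_val :: "nat \<Rightarrow> (nat \<Rightarrow> nat \<Rightarrow> nat) \<Rightarrow> nat \<Rightarrow> mem \<Rightarrow> expr \<Rightarrow> nat" where
  "expr_val n A k m (Const c) = c"
| "expr_val n A k m (Load l) = fetch m l"
| "expr_val n A k m (Add l l') = fetch m l + fetch m l'"
| "expr_val n A k m (Sub l l') = fetch m l - fetch m l'"
| "expr_val n A k m (Mul l l') = fetch m l * fetch m l'"
| "expr_val n A k m (Div l l') = fetch m l div fetch m l'"
| "expr_val n A k m (Mod l l') = fetch m l mod fetch m l'"
| "expr_val n A k m InputDim = n"
| "expr_val n A k m InputSize = k"
| "expr_val n A k m (Entry l l') = A (fetch m l) (fetch m l')"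

text \<open>
  A nonzero register is charged the number of binary digits of its content and of its address;
  registers containing 0 are free.  The set of nonzero registers is finite in every reachable
  memory (lemma \<open>exec_finite\<close> below), so the sum never degenerates.
\<close>

definition mem_bits :: "mem \<Rightarrow> nat" where
  "mem_bits m = (\<Sum>a | m a \<noteq> 0. floorlog 2 a + floorlog 2 (m a))"

text \<open>
  \<open>exec n A k s P m m' w\<close>: started in memory \<open>m\<close>, program \<open>P\<close> terminates in
  memory \<open>m'\<close> having written \<open>w\<close>, and every assignment on the way leaves the memory
  within \<open>s\<close> bits.  A run that diverges or exceeds \<open>s\<close> bits has no derivation.
\<close>

inductive exec ::
  "nat \<Rightarrow> (nat \<Rightarrow> nat \<Rightarrow> nat) \<Rightarrow> nat \<Rightarrow> nat \<Rightarrow> prog \<Rightarrow> mem \<Rightarrow> mem \<Rightarrow> nat list \<Rightarrow> bool"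
  for n :: nat and A :: "nat \<Rightarrow> nat \<Rightarrow> nat" and k :: nat and s :: nat
where
  exec_Skip: "exec n A k s Skip m m []"
| exec_Assign: "m' = m(addr m l := expr_val n A k m e) \<Longrightarrow> mem_bits m' \<le> s \<Longrightarrow>
    exec n A k s (Assign l e) m m' []"
| exec_Output: "exec n A k s (Output l) m m [fetch m l]"
| exec_Seq: "exec n A k s P m m' w \<Longrightarrow> exec n A k s Q m' m'' w' \<Longrightarrow>
    exec n A k s (Seq P Q) m m'' (w @ w')"
| exec_CondT: "fetch m l \<noteq> 0 \<Longrightarrow> exec n A k s P m m' w \<Longrightarrow>
    exec n A k s (Cond l P Q) m m' w"
| exec_CondF: "fetch m l = 0 \<Longrightarrow> exec n A k s Q m m' w \<Longrightarrow>
    exec n A k s (Cond l P Q) m m' w"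
| exec_WhileF: "fetch m l = 0 \<Longrightarrow> exec n A k s (While l P) m m []"
| exec_WhileT: "fetch m l \<noteq> 0 \<Longrightarrow> exec n A k s P m m' w \<Longrightarrow>
    exec n A k s (While l P) m' m'' w' \<Longrightarrow>
    exec n A k s (While l P) m m'' (w @ w')"

inductive_cases exec_SkipE: "exec n A k s Skip m m' w"
inductive_cases exec_AssignE: "exec n A k s (Assign l e) m m' w"
inductive_cases exec_OutputE: "exec n A k s (Output l) m m' w"
inductive_cases exec_SeqE: "exec n A k s (Seq P Q) m m' w"
inductive_cases exec_CondE: "exec n A k s (Cond l P Q) m m' w"
inductive_cases exec_WhileE: "exec n A k s (While l P) m m' w"

lemma exec_finite:
  "exec n A k s P m m' w \<Longrightarrow> finite {a. m a \<noteq> 0} \<Longrightarrow> finite {a. m' a \<noteq> 0}"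
proof (induction rule: exec.induct)
  case (exec_Assign m' m l e)
  have "{a. m' a \<noteq> 0} \<subseteq> insert (addr m l) {a. m a \<noteq> 0}"
    using exec_Assign.hyps by auto
  then show ?case
    using exec_Assign.prems by (meson finite.insertI finite_subset)
qed auto

lemma exec_mono:
  "exec n A k s P m m' w \<Longrightarrow> s \<le> s' \<Longrightarrow> exec n A k s' P m m' w"
  by (induction rule: exec.induct) (auto intro: exec.intros)

lemma exec_deterministic:
  "exec n A k s P m m1 w1 \<Longrightarrow> exec n A k s P m m2 w2 \<Longrightarrow> m1 = m2 \<and> w1 = w2"
proof (induction arbitrary: m2 w2 rule: exec.induct)
  case exec_Skip
  then show ?case by (auto elim: exec_SkipE)
next
  case exec_Assign
  then show ?case by (auto elim: exec_AssignE)
next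
  case exec_Output
  then show ?case by (auto elim: exec_OutputE)
next
  case (exec_Seq P m m' w Q m'' w')
  from exec_Seq.prems obtain q u v where
    "exec n A k s P m q u" "exec n A k s Q q m2 v" "w2 = u @ v"
    by (rule exec_SeqE)
  with exec_Seq.IH show ?case by metis
next
  case (exec_CondT m l P m' w Q)
  from exec_CondT.prems exec_CondT.hyps(1) have "exec n A k s P m m2 w2"
    by (auto elim: exec_CondE)
  then show ?case by (rule exec_CondT.IH)
next
  case (exec_CondF m l Q m' w P)
  from exec_CondF.prems exec_CondF.hyps(1) have "exec n A k s Q m m2 w2"
    by (auto elim: exec_CondE)
  then show ?case by (rule exec_CondF.IH)
next
  case (exec_WhileF m l P)
  from exec_WhileF.prems show ?case
    by (rule exec_WhileE) (use exec_WhileF.hyps in simp_all)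
next
  case (exec_WhileT m l P m' w m'' w')
  from exec_WhileT.prems obtain q u v where
    "exec n A k s P m q u" "exec n A k s (While l P) q m2 v" "w2 = u @ v"
    by (rule exec_WhileE) (use exec_WhileT.hyps(1) in auto)
  with exec_WhileT.IH show ?case by metis
qed

definition outputs :: "prog \<Rightarrow> nat \<Rightarrow> nat set set \<Rightarrow> nat \<Rightarrow> nat \<Rightarrow> nat list \<Rightarrow> bool" where
  "outputs P n E k s w \<longleftrightarrow> (\<exists>m'. exec n (adj_matrix n E) k s P (\<lambda>_. 0) m' w)"

definition runs_in_space :: "prog \<Rightarrow> nat \<Rightarrow> nat \<Rightarrow> nat \<Rightarrow> bool" where
  "runs_in_space P n k s \<longleftrightarrow> (\<forall>E \<subseteq> nsets {1..n} 2. \<exists>w. outputs P n E k s w)"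

definition recovery_prob :: "prog \<Rightarrow> nat \<Rightarrow> nat \<Rightarrow> nat \<Rightarrow> real" where
  "recovery_prob P n k s =
     measure_pmf.prob (planted_clique n k)
       {(K, E). \<exists>w. outputs P n E k s w \<and> distinct w \<and> set w = K}"

end

theory Submission
  imports Defs
    "HOL-Library.Discrete_Functions"
    "HOL-Real_Asymp.Real_Asymp"
begin

text \<open>
  Split the vertices into dyadic blocks, the \<open>j\<close>-th being \<open>(n / 2\<^sup>j\<^sup>+\<^sup>1, n / 2\<^sup>j]\<close>.  All of block \<open>0\<close>
  survives, and a vertex of block \<open>j + 1\<close> survives if the number of its neighbours among the
  survivors of block \<open>j\<close> exceeds the number of its non-neighbours there by \<open>k / (64 * 2\<^sup>j)\<close>.  The
  edges between two consecutive blocks are independent of all that happened before, so one step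
  keeps at least half of the clique vertices of a block while the density of the other survivors
  drops exponentially in the previous squared signal-to-noise ratio.  This ratio thus grows like
  a tower, and after \<open>log\<^sup>* n - log\<^sup>* (k / sqrt n) + O(1)\<close> blocks the survivors are exactly the
  clique vertices of the block; comparing every vertex with them recovers the clique.
  Recomputing survivors recursively takes a stack with two registers per block.
\<close>

section \<open>Uniformly random subsets\<close>

text \<open>Storing a survivor set would take linear space, so membership is recomputed whenever it
  is asked for: depth costs time, but space only through the stack. Given the survivors of one
  block, the verdicts on the next block depend on pairwise disjoint sets of fresh pairs, so
  exponential Markov bounds apply to the number of errors. Block j is guaranteed k / 2^(j+4) clique
  vertices, a quarter of a lower bound for its mean share, and the threshold is a quarter of that
  again. Half of the guaranteed part may therefore be lost, and errors of both kinds are still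
  deviations by at least the threshold. With r = k / sqrt n and about n / (4^j * rate) survivors
  outside the clique, the exponent of an error is of order r^2 * rate / 2^16. The assumption r \<ge>
  2^20 makes this at least 16 * r * rate, so the next rate can be exponential in the present one;
  the iterated integer logarithms of n, read backwards, are such a schedule. Halving the blocks
  costs a factor 4^L in the exponents. As 2^L \<le> 8 log n, this is only O((log n)^2), which sqrt n
  absorbs.\<close>

definition subset_mean :: "'a set \<Rightarrow> ('a set \<Rightarrow> real) \<Rightarrow> real" where
  "subset_mean D F = (\<Sum>X\<in>Pow D. F X) / 2 ^ card D"

text \<open>A uniformly random subset is a family of independent fair coins, one for each element of
  \<open>D\<close>. Finite averages keep measure theory out until the planted distribution is
  unfolded.\<close>

definition subset_prob :: "'a set \<Rightarrow> ('a set \<Rightarrow> bool) \<Rightarrow> real" where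
  "subset_prob D Q = subset_mean D (\<lambda>X. of_bool (Q X))"

lemma sum_Pow_union:
  fixes F :: "'a set \<Rightarrow> real"
  assumes "finite A" "finite B" "A \<inter> B = {}"
  shows "(\<Sum>X\<in>Pow (A \<union> B). F X) = (\<Sum>X\<in>Pow A. \<Sum>Y\<in>Pow B. F (X \<union> Y))"
proof -
  have "(\<Sum>X\<in>Pow A. \<Sum>Y\<in>Pow B. F (X \<union> Y)) = (\<Sum>(X, Y)\<in>Pow A \<times> Pow B. F (X \<union> Y))"
    by (simp add: sum.cartesian_product)
  also have "\<dots> = (\<Sum>X\<in>Pow (A \<union> B). F X)"
    by (rule sum.reindex_bij_witness[where i = "\<lambda>X. (X \<inter> A, X \<inter> B)" and j = "\<lambda>(X, Y). X \<union> Y"])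
       (use assms(3) in auto)
  finally show ?thesis by simp
qed

lemma subset_mean_union:
  assumes "finite A" "finite B" "A \<inter> B = {}"
  shows "subset_mean (A \<union> B) F = subset_mean A (\<lambda>X. subset_mean B (\<lambda>Y. F (X \<union> Y)))"
  using assms unfolding subset_mean_def
  by (simp add: sum_Pow_union card_Un_disjoint power_add sum_divide_distrib mult.commute)

lemma subset_mean_const [simp]: "finite D \<Longrightarrow> subset_mean D (\<lambda>_. c) = c"
  by (simp add: subset_mean_def card_Pow)

lemma subset_mean_mono:
  assumes "\<And>X. X \<subseteq> D \<Longrightarrow> F X \<le> G X"
  shows "subset_mean D F \<le> subset_mean D G"
  unfolding subset_mean_def using assms by (intro divide_right_mono sum_mono) auto

lemma subset_mean_cong:
  assumes "\<And>X. X \<subseteq> D \<Longrightarrow> F X = G X"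
  shows "subset_mean D F = subset_mean D G"
  unfolding subset_mean_def using assms by (intro arg_cong2[of _ _ _ _ "(/)"] sum.cong) auto

lemma subset_mean_cmult: "subset_mean D (\<lambda>X. c * F X) = c * subset_mean D F"
  by (simp add: subset_mean_def sum_distrib_left)

lemma subset_mean_multc: "subset_mean D (\<lambda>X. F X * c) = subset_mean D F * c"
  by (simp add: subset_mean_def sum_distrib_right)

lemma subset_mean_add: "subset_mean D (\<lambda>X. F X + G X) = subset_mean D F + subset_mean D G"
  by (simp add: subset_mean_def sum.distrib add_divide_distrib)

lemma subset_mean_nonneg: "(\<And>X. X \<subseteq> D \<Longrightarrow> 0 \<le> F X) \<Longrightarrow> 0 \<le> subset_mean D F"
  unfolding subset_mean_def by (intro divide_nonneg_nonneg sum_nonneg) auto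

lemma subset_prob_nonneg: "0 \<le> subset_prob D Q"
  unfolding subset_prob_def by (rule subset_mean_nonneg) simp

lemma subset_prob_mono:
  assumes "\<And>X. X \<subseteq> D \<Longrightarrow> Q X \<Longrightarrow> Q' X"
  shows "subset_prob D Q \<le> subset_prob D Q'"
  unfolding subset_prob_def using assms by (intro subset_mean_mono) auto

lemma subset_prob_False [simp]: "finite D \<Longrightarrow> subset_prob D (\<lambda>_. False) = 0"
  by (simp add: subset_prob_def)

lemma subset_prob_disj: "subset_prob D (\<lambda>X. Q X \<or> Q' X) \<le> subset_prob D Q + subset_prob D Q'"
  unfolding subset_prob_def subset_mean_add[symmetric] by (intro subset_mean_mono) auto

lemma subset_prob_Bex:
  fixes p :: real
  assumes "finite I" "finite D" "\<And>i. i \<in> I \<Longrightarrow> subset_prob D (Q i) \<le> p"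
  shows "subset_prob D (\<lambda>X. \<exists>i\<in>I. Q i X) \<le> card I * p"
  using assms(1,3)
proof (induction I rule: finite_induct)
  case empty
  then show ?case using assms(2) by simp
next
  case (insert i I)
  have "subset_prob D (\<lambda>X. \<exists>i\<in>insert i I. Q i X) \<le> subset_prob D (Q i) + subset_prob D (\<lambda>X. \<exists>i\<in>I. Q i X)"
    using subset_prob_disj[of D "Q i"] by simp
  also have "\<dots> \<le> p + card I * p"
    using insert by (intro add_mono) auto
  finally show ?case using insert by (simp add: algebra_simps)
qed

lemma subset_prob_markov:
  assumes "\<And>X. X \<subseteq> D \<Longrightarrow> 0 \<le> F X" "\<And>X. X \<subseteq> D \<Longrightarrow> Q X \<Longrightarrow> c \<le> F X" "0 < c"
  shows "subset_prob D Q \<le> subset_mean D F / c"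
proof -
  have "subset_prob D Q \<le> subset_mean D (\<lambda>X. F X * (1 / c))"
    unfolding subset_prob_def using assms by (intro subset_mean_mono) auto
  then show ?thesis
    by (subst (asm) subset_mean_multc) simp
qed

text \<open>Conditioning on the coins in \<open>A\<close>. In the application they settle the
  survivors of a block, while \<open>B\<close> holds the pairs not yet looked at.\<close>

lemma subset_prob_condition:
  assumes "finite A" "finite B" "A \<inter> B = {}"
    and "\<And>X. X \<subseteq> A \<Longrightarrow> subset_prob B (\<lambda>Y. Q (X \<union> Y)) \<le> p"
  shows "subset_prob (A \<union> B) Q \<le> p"
proof -
  have "subset_prob (A \<union> B) Q = subset_mean A (\<lambda>X. subset_prob B (\<lambda>Y. Q (X \<union> Y)))"
    unfolding subset_prob_def using assms by (simp add: subset_mean_union)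
  also have "\<dots> \<le> subset_mean A (\<lambda>_. p)"
    using assms by (intro subset_mean_mono) auto
  finally show ?thesis using assms by simp
qed

lemma subset_mean_restrict:
  assumes "finite D" "B \<subseteq> D"
  shows "subset_mean D (\<lambda>X. f (X \<inter> B)) = subset_mean B f"
proof -
  have "finite B" "finite (D - B)" "D = B \<union> (D - B)"
    using assms by (auto intro: finite_subset)
  moreover have "subset_mean (B \<union> (D - B)) (\<lambda>X. f (X \<inter> B)) = subset_mean B (\<lambda>X. subset_mean (D - B) (\<lambda>Y. f ((X \<union> Y) \<inter> B)))"
    using \<open>finite B\<close> \<open>finite (D - B)\<close> by (intro subset_mean_union) auto
  moreover have "\<dots> = subset_mean B (\<lambda>X. subset_mean (D - B) (\<lambda>Y. f X))"
  proof (intro subset_mean_cong)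
    fix X Y assume "X \<subseteq> B" "Y \<subseteq> D - B"
    then have "(X \<union> Y) \<inter> B = X" by auto
    then show "f ((X \<union> Y) \<inter> B) = f X" by simp
  qed
  ultimately show ?thesis by simp
qed

text \<open>Functions that look at disjoint sets of coins are independent: the induction splits off
  the coins of one index and leaves \<open>D - B v\<close> to the others.\<close>

lemma subset_mean_prod_indep:
  assumes "finite W" "finite D" "disjoint_family_on B W" "\<And>v. v \<in> W \<Longrightarrow> B v \<subseteq> D"
  shows "subset_mean D (\<lambda>X. \<Prod>v\<in>W. f v (X \<inter> B v)) = (\<Prod>v\<in>W. subset_mean (B v) (f v))"
  using assms
proof (induction W arbitrary: D rule: finite_induct)
  case empty
  then show ?case by simp
next
  case (insert v W)
  let ?D = "D - B v"
  have B: "B v \<subseteq> D" "finite (B v)" "finite ?D" "D = B v \<union> ?D"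
    using insert.prems by (auto intro: finite_subset)
  have dis: "B w \<inter> B v = {}" "B w \<subseteq> D" if "w \<in> W" for w
    using insert.prems insert.hyps that unfolding disjoint_family_on_def by auto
  have "subset_mean D (\<lambda>X. \<Prod>w\<in>insert v W. f w (X \<inter> B w))
      = subset_mean (B v) (\<lambda>X. subset_mean ?D (\<lambda>Y. \<Prod>w\<in>insert v W. f w ((X \<union> Y) \<inter> B w)))"
    using B by (subst B(4), subst subset_mean_union) auto
  also have "\<dots> = subset_mean (B v) (\<lambda>X. subset_mean ?D (\<lambda>Y. f v X * (\<Prod>w\<in>W. f w (Y \<inter> B w))))"
  proof (intro subset_mean_cong)
    fix X Y assume XY: "X \<subseteq> B v" "Y \<subseteq> D - B v"
    have "(X \<union> Y) \<inter> B v = X" "w \<in> W \<Longrightarrow> (X \<union> Y) \<inter> B w = Y \<inter> B w" for w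
      using XY dis[of w] by auto
    then show "(\<Prod>w\<in>insert v W. f w ((X \<union> Y) \<inter> B w)) = f v X * (\<Prod>w\<in>W. f w (Y \<inter> B w))"
      using insert.hyps by (simp cong: prod.cong)
  qed
  also have "\<dots> = subset_mean (B v) (f v) * subset_mean ?D (\<lambda>Y. \<Prod>w\<in>W. f w (Y \<inter> B w))"
    by (simp add: subset_mean_cmult subset_mean_multc)
  also have "subset_mean ?D (\<lambda>Y. \<Prod>w\<in>W. f w (Y \<inter> B w)) = (\<Prod>w\<in>W. subset_mean (B w) (f w))"
    using insert.prems B(3) dis by (intro insert.IH) (fastforce simp: disjoint_family_on_def)+
  finally show ?case using insert.hyps by simp
qed

text \<open>Exponential Markov inequality with parameter 1. The indicator of an event of probability
  at most p has exponential moment at most 1 + (e - 1) p \<le> exp (2 p), because e \<le> 3.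
  Allowing twice the mean makes the error term independent of \<open>card W\<close>.\<close>

lemma subset_prob_count_tail:
  fixes p t :: real
  assumes "finite W" "finite D" "disjoint_family_on B W" "\<And>v. v \<in> W \<Longrightarrow> B v \<subseteq> D"
    and p: "\<And>v. v \<in> W \<Longrightarrow> subset_prob (B v) (Q v) \<le> p"
  shows "subset_prob D (\<lambda>X. 2 * p * card W + t \<le> card {v \<in> W. Q v (X \<inter> B v)}) \<le> exp (- t)"
proof -
  let ?F = "\<lambda>X. \<Prod>v\<in>W. exp (of_bool (Q v (X \<inter> B v)) :: real)"
  have F: "?F X = exp (card {v \<in> W. Q v (X \<inter> B v)})" for X
  proof -
    have "(\<Sum>v\<in>W. of_bool (Q v (X \<inter> B v)) :: real) = card {v \<in> W. Q v (X \<inter> B v)}"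
      using assms(1) by (simp add: of_bool_def flip: sum.inter_filter)
    then show ?thesis using assms(1) by (simp flip: exp_sum)
  qed
  have e3: "exp 1 \<le> (3::real)"
    using exp_bound[of 1] by simp
  have one: "subset_mean (B v) (\<lambda>X. exp (of_bool (Q v X))) \<le> exp (2 * p)" if "v \<in> W" for v
  proof -
    have fin: "finite (B v)" using assms that by (meson finite_subset)
    have "subset_mean (B v) (\<lambda>X. exp (of_bool (Q v X))) \<le> subset_mean (B v) (\<lambda>X. 1 + 2 * of_bool (Q v X))"
      using e3 by (intro subset_mean_mono) auto
    also have "\<dots> = 1 + 2 * subset_prob (B v) (Q v)"
      using fin by (simp add: subset_mean_add subset_mean_cmult subset_prob_def)
    also have "\<dots> \<le> 1 + 2 * p" using p[OF that] by simp
    also have "\<dots> \<le> exp (2 * p)" by (rule exp_ge_add_one_self)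
    finally show ?thesis .
  qed
  have "subset_prob D (\<lambda>X. 2 * p * card W + t \<le> card {v \<in> W. Q v (X \<inter> B v)})
      \<le> subset_mean D ?F / exp (2 * p * card W + t)"
    unfolding F by (rule subset_prob_markov) auto
  also have "subset_mean D ?F = (\<Prod>v\<in>W. subset_mean (B v) (\<lambda>X. exp (of_bool (Q v X))))"
    using assms by (intro subset_mean_prod_indep) auto
  also have "\<dots> \<le> (\<Prod>v\<in>W. exp (2 * p))"
    using one by (intro prod_mono) (auto intro: subset_mean_nonneg)
  also have "\<dots> = exp (2 * p * card W)"
    by (simp flip: exp_of_nat_mult add: mult_ac)
  finally show ?thesis
    by (simp add: divide_right_mono exp_add exp_minus field_simps)
qed

section \<open>Chernoff bound for a sum of independent signs\<close>

definition sign_sum :: "'a set \<Rightarrow> 'a set \<Rightarrow> real" where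
  "sign_sum B X = (\<Sum>e\<in>B. if e \<in> X then 1 else -1)"

lemma subset_prob_sign_sum_tail:
  fixes M \<tau> \<sigma> :: real
  assumes "finite B" "card B \<le> M" "0 < M" "0 \<le> \<tau>" "\<tau> \<le> 2 * M" "\<bar>\<sigma>\<bar> = 1"
  shows "subset_prob B (\<lambda>X. \<tau> \<le> \<sigma> * sign_sum B X) \<le> exp (- (\<tau>\<^sup>2 / (4 * M)))"
proof -
  \<comment> \<open>The minimiser of \<open>M * s ^ 2 - s * \<tau>\<close>. The assumption
    \<open>\<tau> \<le> 2 * M\<close> puts it into [0, 1], where exp s \<le> 1 + s + s^2.\<close>
  define s where "s = \<tau> / (2 * M)"
  have s: "0 \<le> s" "s \<le> 1" using assms by (auto simp: s_def)
  let ?f = "\<lambda>e X. exp (s * (\<sigma> * (if e \<in> X then 1 else -1)))"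
  have one: "subset_mean {e} (?f e) \<le> exp (s\<^sup>2)" for e
  proof -
    have "subset_mean {e} (?f e) = (exp s + exp (- s)) / 2"
      using assms(6) by (auto simp: subset_mean_def Pow_insert abs_if split: if_splits)
    also have "\<dots> \<le> 1 + s\<^sup>2"
    proof -
      have a: "exp s \<le> 1 + s + s\<^sup>2" using s by (intro exp_bound)
      \<comment> \<open>The matching bound for exp (- s): the candidate times exp s is at least 1 +
        s^3, hence at least 1.\<close>
      have "(1 - s + s\<^sup>2) * exp s \<ge> (1 - s + s\<^sup>2) * (1 + s)"
        using s by (intro mult_left_mono exp_ge_add_one_self) auto
      also have "(1 - s + s\<^sup>2) * (1 + s) = 1 + s ^ 3"
        by (simp add: algebra_simps power2_eq_square power3_eq_cube)
      finally have "1 \<le> (1 - s + s\<^sup>2) * exp s" 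
        using s by (smt (verit) zero_le_power)
      then have "exp (- s) \<le> 1 - s + s\<^sup>2"
        by (simp add: exp_minus field_simps)
      with a show ?thesis by simp
    qed
    also have "\<dots> \<le> exp (s\<^sup>2)" by (rule exp_ge_add_one_self)
    finally show ?thesis .
  qed
  have F: "exp (s * (\<sigma> * sign_sum B X)) = (\<Prod>e\<in>B. ?f e (X \<inter> {e}))" for X
    using assms(1) by (simp add: sign_sum_def sum_distrib_left exp_sum)
  have "subset_prob B (\<lambda>X. \<tau> \<le> \<sigma> * sign_sum B X)
     \<le> subset_mean B (\<lambda>X. exp (s * (\<sigma> * sign_sum B X))) / exp (s * \<tau>)"
    using s by (intro subset_prob_markov) (auto intro: mult_left_mono)
  also have "subset_mean B (\<lambda>X. exp (s * (\<sigma> * sign_sum B X))) = (\<Prod>e\<in>B. subset_mean {e} (?f e))"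
    unfolding F using assms by (subst subset_mean_prod_indep) (auto simp: disjoint_family_on_def)
  also have "\<dots> \<le> (\<Prod>e\<in>B. exp (s\<^sup>2))"
    using one by (intro prod_mono) (auto intro: subset_mean_nonneg)
  also have "\<dots> = exp (card B * s\<^sup>2)"
    by (simp flip: exp_of_nat_mult)
  also have "\<dots> \<le> exp (M * s\<^sup>2)"
    using assms by (simp add: mult_right_mono)
  finally have "subset_prob B (\<lambda>X. \<tau> \<le> \<sigma> * sign_sum B X) \<le> exp (M * s\<^sup>2) / exp (s * \<tau>)"
    by (simp add: divide_right_mono)
  also have "\<dots> = exp (M * s\<^sup>2 - s * \<tau>)"
    by (simp add: exp_diff)
  also have "M * s\<^sup>2 - s * \<tau> = - (\<tau>\<^sup>2 / (4 * M))"
    using assms(3) by (simp add: s_def field_simps power2_eq_square)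
  finally show ?thesis .
qed

section \<open>Intersection of a uniformly random \<open>k\<close>-subset with a fixed set\<close>

text \<open>The binomial distribution with parameter k / n is largest at k, and its n + 1 values sum
  to 1. This is the price of replacing a uniform \<open>k\<close>-subset by independent
  sampling.\<close>

lemma binomial_mode:
  fixes n k :: nat and p :: real
  assumes "k \<le> n" "0 < n"
  defines "p \<equiv> real k / real n"
  shows "1 \<le> (n + 1) * ((n choose k) * p ^ k * (1 - p) ^ (n - k))"
proof -
  define t where "t j = (n choose j) * p ^ j * (1 - p) ^ (n - j)" for j
  have p: "0 \<le> p" "p \<le> 1" using assms by (auto simp: p_def)
  have step: "(n - j) * p * (t j) = (real j + 1) * (1 - p) * t (Suc j)" if "j < n" for j
  proof -
    have "(n - j) * (n choose j) = Suc j * (n choose Suc j)"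
      using binomial_absorb_comp[of n j] binomial_absorption[of j n] that
      by (metis Suc_diff_1 assms(2) binomial_absorption  mult.commute)
    then have e: "real (n - j) * real (n choose j) = (real j + 1) * real (n choose Suc j)"
      by (metis of_nat_Suc of_nat_mult add.commute)
    have n: "n - j = Suc (n - Suc j)" using that by simp
    have "(n - j) * p * t j = (real (n - j) * real (n choose j)) * p ^ Suc j * (1 - p) ^ (n - j)"
      by (simp add: t_def)
    also have "\<dots> = (real j + 1) * real (n choose Suc j) * p ^ Suc j * (1 - p) ^ Suc (n - Suc j)"
      using e n by metis
    also have "\<dots> = (real j + 1) * (1 - p) * t (Suc j)"
      by (simp add: t_def)
    finally show ?thesis .
  qed
  have t0: "0 \<le> t j" for j using p by (simp add: t_def)
  have up: "t j \<le> t (Suc j)" if "j < k" for j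
  proof -
    have jn: "j < n" using that assms by simp
    have "(real j + 1) * (1 - p) \<le> (n - j) * p"
    proof -
      have "(real j + 1) * (real n - real k) \<le> real (n - j) * real k"
      proof -
        have "(real j + 1) * real n \<le> real k * real n + real k" using that
          by (smt (verit) Suc_leI mult_right_mono of_nat_0_le_iff of_nat_Suc of_nat_le_iff)
        then show ?thesis using jn by (simp add: of_nat_diff algebra_simps)
      qed
      then have "((real j + 1) * (real n - real k)) / n \<le> (real (n - j) * real k) / n"
        by (intro divide_right_mono) auto
      then show ?thesis using assms(2) by (simp add: p_def field_simps)
    qed
    then have "(real j + 1) * (1 - p) * t j \<le> (n - j) * p * t j"
      by (intro mult_right_mono t0)
    with step[OF jn] have le: "(real j + 1) * (1 - p) * t j \<le> (real j + 1) * (1 - p) * t (Suc j)" by linarith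
    show ?thesis
    \<comment> \<open>For \<open>k = n\<close> the factor \<open>1 - p\<close> cannot be cancelled,
      but then \<open>t j\<close> vanishes for \<open>j < n\<close>.\<close>
    proof (cases "p = 1")
      case True
      then have "t j = 0" using jn by (simp add: t_def)
      then show ?thesis using t0 by simp
    next
      case False
      then have "0 < (real j + 1) * (1 - p)" using p by simp
      with le show ?thesis by (metis mult_le_cancel_left_pos)
    qed
  qed
  have down: "t (Suc j) \<le> t j" if "k \<le> j" "j < n" for j
  proof -
    have "(n - j) * p \<le> (real j + 1) * (1 - p)"
    proof -
      have "real (n - j) * real k \<le> (real j + 1) * (real n - real k)"
      proof -
        have "real k * real n + real k \<le> real j * real n + real n"
          using that by (intro add_mono mult_right_mono) auto
        then show ?thesis using that by (simp add: of_nat_diff algebra_simps)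
      qed
      then have "(real (n - j) * real k) / n \<le> ((real j + 1) * (real n - real k)) / n"
        by (intro divide_right_mono) auto
      then show ?thesis using assms(2) by (simp add: p_def field_simps)
    qed
    then have "(n - j) * p * t j \<le> (real j + 1) * (1 - p) * t j"
      by (intro mult_right_mono t0)
    with step[OF that(2)] have le: "(real j + 1) * (1 - p) * t (Suc j) \<le> (real j + 1) * (1 - p) * t j" by linarith
    have "p < 1" using that assms(2) by (simp add: p_def)
    then have "0 < (real j + 1) * (1 - p)" by simp
    with le show ?thesis by (metis mult_le_cancel_left_pos)
  qed
  have "t j \<le> t k" if "j \<le> n" for j
  proof (cases "j \<le> k")
    case True
    then show ?thesis by (induction rule: inc_induct) (auto intro: order_trans up)
  next
    case False
    then have "k \<le> j" by simp
    then show ?thesis using that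
      by (induction rule: dec_induct) (auto intro: order_trans[OF down])
  qed
  then have "(\<Sum>j\<le>n. t j) \<le> (\<Sum>j\<le>n. t k)"
    by (intro sum_mono) auto
  moreover have "(\<Sum>j\<le>n. t j) = (p + (1 - p)) ^ n"
    unfolding binomial_ring t_def by simp
  ultimately show ?thesis by (simp add: t_def)
qed

text \<open>A uniform \<open>k\<close>-subset is a binomial subset conditioned on its size, which
  costs a factor n + 1 by \<open>binomial_mode\<close>. For the binomial subset, the lower tail
  follows from the mean of 2^(-|X \<inter> V|), which is at most exp (- 2 q), where q is a quarter
  of the expected intersection.\<close>

lemma card_nsets_small_intersection:
  fixes n k :: nat
  assumes "k \<le> n" "0 < n" "V \<subseteq> {1..n}"
  shows "card {K \<in> nsets {1..n} k. card (K \<inter> V) \<le> real k * card V / (4 * n)}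
    \<le> (n choose k) * ((n + 1) * exp (- (real k * card V / (4 * n))))"
proof -
  define p where "p = real k / real n"
  define q where "q = p * card V / 4"
  have p: "0 \<le> p" "p \<le> 1" using assms by (auto simp: p_def)
  have fV: "finite V" using assms(3) by (rule finite_subset) simp
  let ?bad = "{K \<in> nsets {1..n} k. card (K \<inter> V) \<le> q}"
  \<comment> \<open>Binomial weight of \<open>X\<close> times 2^(-|X \<inter> V|). On the bad sets
    the second factor is at least exp (- q), and the total weight factorises over the
    vertices.\<close>
  let ?w = "\<lambda>X. (\<Prod>i\<in>X. if i \<in> V then p / 2 else p) * (\<Prod>i\<in>{1..n} - X. 1 - p)"
  have fin: "finite (nsets {1..n} k)" by (simp add: finite_imp_finite_nsets)
  have w: "?w K \<ge> p ^ k * (1 - p) ^ (n - k) * exp (- q)" if "K \<in> ?bad" for K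
  proof -
    have K: "K \<subseteq> {1..n}" "finite K" "card K = k" "card (K \<inter> V) \<le> q"
      using that by (auto simp: nsets_def)
    have "(\<Prod>i\<in>K. if i \<in> V then p / 2 else p) = (\<Prod>i\<in>K. p * (if i \<in> V then 1 / 2 else 1))"
      by (intro prod.cong) auto
    also have "\<dots> = p ^ k * (1 / 2) ^ card (K \<inter> V)"
      using K by (simp add: prod.distrib prod.If_cases Int_def)
    finally have eq: "?w K = p ^ k * (1 - p) ^ (n - k) * (1 / 2) ^ card (K \<inter> V)"
      using K by (simp add: card_Diff_subset)
    have "exp (- q) \<le> exp (- real (card (K \<inter> V)))" using K(4) by simp
    also have "\<dots> = exp (- 1) ^ card (K \<inter> V)" by (simp flip: exp_of_nat_mult)
    also have "\<dots> \<le> (1 / 2) ^ card (K \<inter> V)"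
    proof (intro power_mono)
      have "2 \<le> exp (1::real)" using exp_ge_add_one_self[of 1] by simp
      then show "exp (- 1) \<le> (1 / 2 :: real)" by (simp add: exp_minus field_simps)
    qed auto
    finally show ?thesis unfolding eq using p by (intro mult_left_mono) auto
  qed
  have "card ?bad * (p ^ k * (1 - p) ^ (n - k) * exp (- q)) \<le> (\<Sum>K\<in>?bad. ?w K)"
    using w by (subst sum_constant[symmetric]) (rule sum_mono)
  also have "\<dots> \<le> (\<Sum>X\<in>Pow {1..n}. ?w X)"
    using p by (intro sum_mono2) (auto simp: nsets_def intro!: mult_nonneg_nonneg prod_nonneg)
  also have "\<dots> = (\<Prod>i\<in>{1..n}. (if i \<in> V then p / 2 else p) + (1 - p))"
    by (rule prod_add[symmetric]) simp
  also have "\<dots> = (\<Prod>i\<in>{1..n}. if i \<in> V then 1 - p / 2 else 1)"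
    by (intro prod.cong) auto
  also have "\<dots> = (1 - p / 2) ^ card V"
    using assms(3) by (simp add: prod.If_cases Int_absorb1)
  also have "\<dots> \<le> exp (- (p / 2)) ^ card V"
    using p exp_ge_add_one_self[of "- (p / 2)"] by (intro power_mono) auto
  also have "\<dots> = exp (- 2 * q)"
    by (simp flip: exp_of_nat_mult add: q_def)
  finally have main: "card ?bad * (p ^ k * (1 - p) ^ (n - k)) * exp (- q) \<le> exp (- q) * exp (- q)"
    by (simp flip: exp_add add: mult.assoc)
  then have main: "card ?bad * (p ^ k * (1 - p) ^ (n - k)) \<le> exp (- q)"
    by simp
  have "real (card ?bad) * 1 \<le> card ?bad * ((n + 1) * ((n choose k) * p ^ k * (1 - p) ^ (n - k)))"
    unfolding p_def by (intro mult_left_mono binomial_mode assms) auto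
  also have "\<dots> = (n choose k) * (n + 1) * (card ?bad * (p ^ k * (1 - p) ^ (n - k)))"
    by (simp only: mult_ac of_nat_mult)
  also have "\<dots> \<le> (n choose k) * (n + 1) * exp (- q)"
    by (intro mult_left_mono main) auto
  finally show ?thesis by (simp add: q_def p_def algebra_simps)
qed

section \<open>Nested filtering of vertices\<close>

definition advantage :: "(nat \<Rightarrow> nat \<Rightarrow> nat) \<Rightarrow> nat set \<Rightarrow> nat \<Rightarrow> int" where
  "advantage A U v = (\<Sum>u\<in>U. 2 * int (A v u) - 1)"

definition block :: "nat \<Rightarrow> nat \<Rightarrow> nat set" where
  "block n j = {n div 2 ^ Suc j<..n div 2 ^ j}"

text \<open>The threshold is cleared of its denominator, so that the machine can test it with
  natural numbers only.\<close>

fun level :: "(nat \<Rightarrow> nat \<Rightarrow> nat) \<Rightarrow> nat \<Rightarrow> nat \<Rightarrow> nat \<Rightarrow> nat set" where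
  "level A n k 0 = block n 0"
| "level A n k (Suc j) = {v \<in> block n (Suc j). int k \<le> 64 * 2 ^ j * advantage A (level A n k j) v}"

lemma level_subset_block: "level A n k j \<subseteq> block n j"
  by (cases j) auto

lemma finite_block [simp]: "finite (block n j)"
  by (simp add: block_def)

lemma finite_level [simp]: "finite (level A n k j)"
  by (rule finite_subset[OF level_subset_block]) simp

lemma abs_advantage_le:
  assumes "\<And>u. A v u \<le> 1"
  shows "\<bar>advantage A U v\<bar> \<le> card U"
proof -
  have "\<bar>advantage A U v\<bar> \<le> (\<Sum>u\<in>U. \<bar>2 * int (A v u) - 1\<bar>)"
    unfolding advantage_def by (rule sum_abs)
  also have "\<dots> \<le> (\<Sum>u\<in>U. 1)"
  proof (rule sum_mono)
    fix u show "\<bar>2 * int (A v u) - 1\<bar> \<le> 1" using assms[of u] by linarith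
  qed
  finally show ?thesis by simp
qed

text \<open>The machine has only truncated subtraction and sees the positive part \<open>d\<close>
  of the advantage. As \<open>0 < k\<close>, a negative advantage fails the test anyway.\<close>

lemma test_iff:
  fixes d k j :: nat and x :: int
  assumes "int d = max 0 x" "0 < k"
  shows "k \<le> d * 2 ^ j * 64 \<longleftrightarrow> int k \<le> 64 * 2 ^ j * x"
proof -
  have "k \<le> d * 2 ^ j * 64 \<longleftrightarrow> int k \<le> max 0 x * 2 ^ j * 64"
    using assms(1) by (metis (mono_tags, lifting) of_nat_le_iff of_nat_mult of_nat_numeral of_nat_power)
  also have "\<dots> \<longleftrightarrow> int k \<le> 64 * 2 ^ j * x"
  proof (cases "0 \<le> x")
    case False
    then have "64 * 2 ^ j * x \<le> 0" by (intro mult_nonneg_nonpos) auto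
    then have "\<not> int k \<le> 64 * 2 ^ j * x" using assms(2) by linarith
    then show ?thesis using False assms(2) by simp
  qed (simp add: max_def mult_ac)
  finally show ?thesis .
qed

section \<open>Iterated integer logarithm and depth of the filter\<close>

lemma floor_log_less: "0 < x \<Longrightarrow> floor_log x < x"
  using floor_log_exp2_le[of x] less_exp[of "floor_log x"] by linarith

lemma floor_log_le: "floor_log x \<le> x"
  using floor_log_less[of x] by (cases "x = 0") auto

definition shrunk :: "nat \<Rightarrow> nat \<Rightarrow> nat" where
  "shrunk n i = (floor_log ^^ i) n"

lemma shrunk_0 [simp]: "shrunk n 0 = n"
  and shrunk_Suc: "shrunk n (Suc i) = floor_log (shrunk n i)"
  by (simp_all add: shrunk_def)

lemma shrunk_le: "shrunk n i \<le> n"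
  by (induction i) (auto simp: shrunk_Suc intro: order_trans[OF floor_log_le])

text \<open>The number of rounded logarithms that bring \<open>n\<close> below k / sqrt n. Squaring
  avoids the root, so the machine can compute it exactly and independently of the graph.\<close>

definition cutoff :: "nat \<Rightarrow> nat \<Rightarrow> nat" where
  "cutoff n k = (LEAST i. n * (shrunk n i)\<^sup>2 \<le> k\<^sup>2)"

lemma cutoff_exists: "\<exists>i. n * (shrunk n i)\<^sup>2 \<le> k\<^sup>2"
proof -
  have "shrunk n i \<le> n - i" for i
  proof (induction i)
    case (Suc i)
    then show ?case
      using floor_log_less[of "shrunk n i"] by (cases "shrunk n i = 0") (auto simp: shrunk_Suc)
  qed simp
  from this[of n] show ?thesis by (intro exI[of _ n]) simp
qed

lemma cutoff: "n * (shrunk n (cutoff n k))\<^sup>2 \<le> k\<^sup>2"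
  unfolding cutoff_def by (rule LeastI_ex[OF cutoff_exists])

lemma less_cutoff: "i < cutoff n k \<Longrightarrow> k\<^sup>2 < n * (shrunk n i)\<^sup>2"
  unfolding cutoff_def using not_less_Least not_le by blast

section \<open>Total correctness with space accounting\<close>

text \<open>Uniform bounds on live addresses and contents. They imply the bit bound once and for
  all, so no invariant has to mention \<open>mem_bits\<close>.\<close>

definition small :: "nat \<Rightarrow> nat \<Rightarrow> mem \<Rightarrow> bool" where
  "small B M m \<longleftrightarrow> (\<forall>a. m a \<le> M \<and> (B \<le> a \<longrightarrow> m a = 0))"

definition space :: "nat \<Rightarrow> nat \<Rightarrow> nat" where
  "space B M = B * (floorlog 2 B + floorlog 2 M)"

lemma mem_bits_small:
  assumes "small B M m"
  shows "mem_bits m \<le> space B M"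
proof -
  have sub: "{a. m a \<noteq> 0} \<subseteq> {..<B}"
    using assms unfolding small_def by (metis (mono_tags) lessThan_iff mem_Collect_eq not_le subsetI)
  then have fin: "finite {a. m a \<noteq> 0}" by (rule finite_subset) simp
  have "mem_bits m \<le> (\<Sum>a | m a \<noteq> 0. floorlog 2 B + floorlog 2 M)"
    unfolding mem_bits_def
  proof (intro sum_mono add_mono floorlog_mono)
    fix a assume "a \<in> {a. m a \<noteq> 0}"
    then show "a \<le> B" "m a \<le> M" using sub assms by (auto simp: small_def)
  qed
  also have "\<dots> = card {a. m a \<noteq> 0} * (floorlog 2 B + floorlog 2 M)" by simp
  also have "\<dots> \<le> B * (floorlog 2 B + floorlog 2 M)"
    using card_mono[OF _ sub] by (intro mult_right_mono) auto
  finally show ?thesis by (simp add: space_def)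
qed

lemma small_upd: "small B M m \<Longrightarrow> a < B \<Longrightarrow> x \<le> M \<Longrightarrow> small B M (m(a := x))"
  by (auto simp: small_def)

lemma small_le: "small B M m \<Longrightarrow> m a \<le> M"
  by (simp add: small_def)

locale machine =
  fixes n :: nat and A :: "nat \<Rightarrow> nat \<Rightarrow> nat" and k B M :: nat
begin

text \<open>Termination is included, since a diverging run has no \<open>exec\<close> derivation.
  Smallness is assumed on entry and re-established on exit, so specifications need not carry
  it.\<close>

definition wp :: "prog \<Rightarrow> mem \<Rightarrow> (mem \<Rightarrow> nat list \<Rightarrow> bool) \<Rightarrow> bool" where
  "wp P m R \<longleftrightarrow> (small B M m \<longrightarrow>
     (\<exists>m' w. exec n A k (space B M) P m m' w \<and> small B M m' \<and> R m' w))"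

lemma wp_small: "(small B M m \<Longrightarrow> wp P m R) \<Longrightarrow> wp P m R"
  by (auto simp: wp_def)

lemma wp_conseq: "wp P m R \<Longrightarrow> (\<And>m w. small B M m \<Longrightarrow> R m w \<Longrightarrow> R' m w) \<Longrightarrow> wp P m R'"
  unfolding wp_def by blast

text \<open>Pointwise equality suffices, so a memory reached by one chain of updates can be
  exchanged for the same memory written as another chain.\<close>

lemma wp_start:
  assumes "wp P m R" "\<And>a. m' a = m a" "\<And>m w. R m w \<Longrightarrow> R' m w"
  shows "wp P m' R'"
proof -
  have "m' = m" using assms(2) by (rule ext)
  then show ?thesis using wp_conseq[OF assms(1)] assms(3) by simp
qed

lemma wp_Skip: "R m [] \<Longrightarrow> wp Skip m R"
  by (auto simp: wp_def intro: exec_Skip)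

lemma wp_Assign:
  assumes "addr m l < B" "small B M m \<Longrightarrow> expr_val n A k m e \<le> M"
    "R (m(addr m l := expr_val n A k m e)) []"
  shows "wp (Assign l e) m R"
  unfolding wp_def
proof
  assume "small B M m"
  then have "small B M (m(addr m l := expr_val n A k m e))"
    using assms by (intro small_upd) auto
  then show "\<exists>m' w. exec n A k (space B M) (Assign l e) m m' w \<and> small B M m' \<and> R m' w"
    using assms(3) exec_Assign[OF refl mem_bits_small] by blast
qed

lemma wp_Output: "R m [fetch m l] \<Longrightarrow> wp (Output l) m R"
  by (auto simp: wp_def intro: exec_Output)

lemma wp_Seq:
  assumes "wp P m (\<lambda>m' w. wp Q m' (\<lambda>m'' w'. R m'' (w @ w')))"
  shows "wp (Seq P Q) m R"
  using assms unfolding wp_def by (blast intro: exec_Seq)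

lemma wp_While_exit: "fetch m l = 0 \<Longrightarrow> R m [] \<Longrightarrow> wp (While l P) m R"
  unfolding wp_def by (auto intro: exec_WhileF)

lemma wp_While_unroll:
  assumes "fetch m l \<noteq> 0" "wp P m (\<lambda>m' w. wp (While l P) m' (\<lambda>m'' w'. R m'' (w @ w')))"
  shows "wp (While l P) m R"
  using assms unfolding wp_def by (blast intro: exec_WhileT)

text \<open>The invariant \<open>I\<close> also sees the output \<open>w\<close> written so far,
  which is how the scan tracks the vertices reported.\<close>

lemma wp_While:
  fixes f :: "mem \<Rightarrow> nat"
  assumes I: "I m []"
    and step: "\<And>m w. I m w \<Longrightarrow> fetch m l \<noteq> 0 \<Longrightarrow> wp P m (\<lambda>m' w'. I m' (w @ w') \<and> f m' < f m)"
    and exit: "\<And>m w. I m w \<Longrightarrow> fetch m l = 0 \<Longrightarrow> R m w"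
  shows "wp (While l P) m R"
proof -
  have "wp (While l P) m (\<lambda>m' w'. R m' (w @ w'))" if "I m w" for m w
    using that
  proof (induction "f m" arbitrary: m w rule: less_induct)
    case less
    show ?case
    proof (cases "fetch m l = 0")
      case True
      then show ?thesis using exit[OF less.prems] by (intro wp_While_exit) auto
    next
      case False
      show ?thesis
      proof (rule wp_While_unroll[OF False], rule wp_conseq[OF step[OF less.prems False]])
        fix m' w' assume "I m' (w @ w') \<and> f m' < f m"
        then show "wp (While l P) m' (\<lambda>m'' w''. R m'' (w @ w' @ w''))"
          using less.hyps[of m' "w @ w'"] by simp
      qed
    qed
  qed
  from this[OF I] show ?thesis by simp
qed

end

section \<open>The program\<close>

primrec seqs :: "prog list \<Rightarrow> prog" where
  "seqs [] = Skip"
| "seqs (P # Ps) = Seq P (seqs Ps)"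

text \<open>
  Level \<open>j\<close> owns the registers \<open>20 + 2 * j\<close>, its current candidate, and \<open>21 + 2 * j\<close>, which holds
  \<open>n\<close> plus the advantage of that candidate over the survivors of level \<open>j - 1\<close> seen so far; the
  offset keeps the content a natural number.  Register \<open>3\<close> is the address of the current
  candidate and register \<open>4\<close> is \<open>2\<^sup>j\<close>; registers \<open>11\<close> and \<open>12\<close> hold their values at the top level
  \<open>L\<close>.  Level \<open>L + 1\<close> ranges over all vertices, and its two registers are addressed through \<open>17\<close>
  and \<open>18\<close>.  Registers \<open>1\<close> and \<open>2\<close> are \<open>n\<close> and \<open>k\<close>, registers \<open>0\<close>, \<open>6\<close>, \<open>16\<close>, \<open>15\<close>, \<open>14\<close> are the
  constants \<open>1\<close>, \<open>2\<close>, \<open>3\<close>, \<open>20\<close>, \<open>64\<close>, register \<open>5\<close> is the guard of the running loop, registers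
  \<open>7\<close> and \<open>8\<close> are scratch, and registers \<open>10\<close> and \<open>13\<close> serve to compute \<open>L\<close>.
\<close>

definition contribute :: prog where
  "contribute = seqs [
     Assign (Reg 7) (Add (Reg 3) (Reg 6)),
     Assign (Reg 8) (Entry (Ind 7) (Ind 3)),
     Assign (Reg 7) (Add (Reg 3) (Reg 16)),
     Cond (Reg 8) (Assign (Ind 7) (Add (Ind 7) (Reg 0))) (Assign (Ind 7) (Sub (Ind 7) (Reg 0))),
     Assign (Ind 3) (Sub (Ind 3) (Reg 0))]"

text \<open>The result is inverted: register \<open>8\<close> ends with 0 exactly if the threshold
  is reached, so the first branch of a following \<open>Cond\<close> handles failure.\<close>

definition test_passes :: "loc \<Rightarrow> prog" where
  "test_passes l = seqs [
     Assign (Reg 8) (Sub l (Reg 1)),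
     Assign (Reg 8) (Mul (Reg 8) (Reg 4)),
     Assign (Reg 8) (Mul (Reg 8) (Reg 14)),
     Assign (Reg 8) (Sub (Reg 2) (Reg 8))]"

text \<open>One step of the recursion made iterative. A candidate still inside its block is a call:
  above level 0 its accumulator is reset and the scan of the next lower block starts; on level 0 it
  survives without a test and votes at once. An exhausted block is a return: the candidate one level
  up is now fully scored, is tested, and votes or is skipped. At the top level the return ends the
  loop.\<close>

definition walk_step :: prog where
  "walk_step = seqs [
     Assign (Reg 8) (Mul (Reg 4) (Reg 6)),
     Assign (Reg 8) (Div (Reg 1) (Reg 8)),
     Assign (Reg 8) (Sub (Ind 3) (Reg 8)),
     Cond (Reg 8)
       (seqs [
          Assign (Reg 7) (Sub (Reg 3) (Reg 15)),
          Cond (Reg 7)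
            (seqs [
               Assign (Reg 7) (Add (Reg 3) (Reg 0)),
               Assign (Ind 7) (Load (Reg 1)),
               Assign (Reg 3) (Sub (Reg 3) (Reg 6)),
               Assign (Reg 4) (Div (Reg 4) (Reg 6)),
               Assign (Ind 3) (Div (Reg 1) (Reg 4))])
            contribute])
       (seqs [
          Assign (Reg 7) (Sub (Reg 11) (Reg 3)),
          Cond (Reg 7)
            (seqs [
               Assign (Reg 7) (Add (Reg 3) (Reg 16)),
               test_passes (Ind 7),
               Assign (Reg 3) (Add (Reg 3) (Reg 6)),
               Assign (Reg 4) (Mul (Reg 4) (Reg 6)),
               Cond (Reg 8) (Assign (Ind 3) (Sub (Ind 3) (Reg 0))) contribute])
            (seqs [Assign (Reg 5) (Const 0)])])]"

definition walk :: prog where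
  "walk = While (Reg 5) walk_step"

text \<open>By truncated subtraction the guard is 0 exactly if the current iterated logarithm is at
  most k / sqrt n.\<close>

definition compare_scale :: prog where
  "compare_scale = seqs [
     Assign (Reg 5) (Mul (Reg 10) (Reg 10)),
     Assign (Reg 5) (Mul (Reg 5) (Reg 1)),
     Assign (Reg 8) (Mul (Reg 2) (Reg 2)),
     Assign (Reg 5) (Sub (Reg 5) (Reg 8))]"

definition halve_loop :: prog where
  "halve_loop = While (Reg 5) (seqs [
     Assign (Reg 10) (Div (Reg 10) (Reg 6)),
     Assign (Reg 13) (Add (Reg 13) (Reg 0)),
     Assign (Reg 5) (Sub (Reg 10) (Reg 0))])"

definition depth_loop :: prog where
  "depth_loop = While (Reg 5) (seqs [
     Assign (Reg 13) (Const 0),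
     Assign (Reg 5) (Sub (Reg 10) (Reg 0)),
     halve_loop,
     Assign (Reg 10) (Load (Reg 13)),
     Assign (Reg 11) (Add (Reg 11) (Reg 6)),
     Assign (Reg 12) (Mul (Reg 12) (Reg 6)),
     compare_scale])"

definition scan_loop :: prog where
  "scan_loop = While (Ind 17) (seqs [
     Assign (Reg 3) (Load (Reg 11)),
     Assign (Reg 4) (Load (Reg 12)),
     Assign (Ind 18) (Load (Reg 1)),
     Assign (Ind 3) (Div (Reg 1) (Reg 4)),
     Assign (Reg 5) (Const 1),
     walk,
     test_passes (Ind 18),
     Cond (Reg 8) Skip (Output (Ind 17)),
     Assign (Ind 17) (Sub (Ind 17) (Reg 0))])"

text \<open>The constants \<open>24\<close> and \<open>4\<close> are \<open>20 + 2 * 2\<close> and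
  \<open>2 ^ 2\<close>: the depth is \<open>cutoff n k + 2\<close>, and each iterated logarithm
  taken adds one level.\<close>

definition clique_prog :: prog where
  "clique_prog = seqs [
     Assign (Reg 0) (Const 1),
     Assign (Reg 1) InputDim,
     Assign (Reg 2) InputSize,
     Assign (Reg 6) (Const 2),
     Assign (Reg 14) (Const 64),
     Assign (Reg 15) (Const 20),
     Assign (Reg 16) (Const 3),
     Assign (Reg 10) (Load (Reg 1)),
     Assign (Reg 11) (Const 24),
     Assign (Reg 12) (Const 4),
     compare_scale,
     depth_loop,
     Assign (Reg 17) (Add (Reg 11) (Reg 6)),
     Assign (Reg 18) (Add (Reg 11) (Reg 16)),
     Assign (Ind 17) (Load (Reg 1)),
     scan_loop]"

text \<open>Addresses up to \<open>23 + 2 * L\<close> are in use, those of level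
  \<open>L + 1\<close> included. The content bound covers the cubic product in
  \<open>compare_scale\<close> and the test, where at most 64 * n^2 occurs.\<close>

locale clique_machine = machine n A k "24 + 2 * L" M
  for n A k L M +
  assumes A01: "\<And>u v. A u v \<le> 1"
    and L_le: "2 ^ L \<le> n" and M_ge: "64 * n ^ 3 \<le> M" and k_le: "k \<le> n" and n_ge: "64 \<le> n"
    and k_pos: "0 < k"
begin

lemma bounds:
  "L < n" "64 \<le> M" "24 + 2 * L \<le> M" "2 * n \<le> M" "64 * (n * n) \<le> M" "n * n * n \<le> M" "n * n \<le> M"
proof -
  show L: "L < n" using L_le less_exp[of L] by linarith
  have "n \<le> n * n" "n * n \<le> n * n * n" by auto
  moreover have "64 * (n * n * n) \<le> M" using M_ge by (simp add: power3_eq_cube)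
  ultimately show "64 \<le> M" "24 + 2 * L \<le> M" "2 * n \<le> M" "64 * (n * n) \<le> M" "n * n * n \<le> M" "n * n \<le> M"
    using L n_ge by linarith+
qed

definition static :: "mem \<Rightarrow> bool" where
  "static m \<longleftrightarrow> m 0 = 1 \<and> m 1 = n \<and> m 2 = k \<and> m 6 = 2 \<and> m 14 = 64 \<and> m 15 = 20 \<and> m 16 = 3 \<and>
     m 11 = 20 + 2 * L \<and> m 12 = 2 ^ L \<and> m 17 = 22 + 2 * L \<and> m 18 = 23 + 2 * L"

definition at_level :: "nat \<Rightarrow> mem \<Rightarrow> bool" where
  "at_level j m \<longleftrightarrow> static m \<and> m 3 = 20 + 2 * j \<and> m 4 = 2 ^ j"

abbreviation "vtx j m \<equiv> m (20 + 2 * j :: nat) :: nat"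
abbreviation "acc j m \<equiv> m (21 + 2 * j :: nat) :: nat"

lemma pow_le: "j \<le> L \<Longrightarrow> 2 ^ j \<le> n"
  by (meson L_le one_le_numeral order_trans power_increasing)

section \<open>Rules for straight-line code and the moves of the recursion\<close>

lemma wp_Cons: "wp P m (\<lambda>m' w. wp (seqs Ps) m' (\<lambda>m'' w'. R m'' (w @ w'))) \<Longrightarrow> wp (seqs (P # Ps)) m R"
  by (simp add: wp_Seq)

lemma wp_Nil: "R m [] \<Longrightarrow> wp (seqs []) m R"
  by (simp add: wp_Skip)

lemma wp_Cond_Cons:
  assumes "fetch m l \<noteq> 0 \<Longrightarrow> wp (seqs (P # Ps)) m R" "fetch m l = 0 \<Longrightarrow> wp (seqs (Q # Ps)) m R"
  shows "wp (seqs (Cond l P Q # Ps)) m R"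
  using assms unfolding seqs.simps wp_def by (cases "fetch m l = 0") (fastforce elim!: exec_SeqE intro: exec_Seq exec_CondT exec_CondF)+

lemma wp_Assign_Cons:
  assumes "addr m l < 24 + 2 * L" "small (24 + 2 * L) M m \<Longrightarrow> expr_val n A k m e \<le> M"
    "wp (seqs Ps) (m(addr m l := expr_val n A k m e)) R"
  shows "wp (seqs (Assign l e # Ps)) m R"
  using assms by (intro wp_Cons wp_Assign) auto

lemmas wp_block_Cons = wp_Cons[where P = "seqs Ps" for Ps]

declare seqs.simps [simp del]

lemma wp_assign:
  assumes "addr m l = a" "expr_val n A k m e = x" "a < 24 + 2 * L" "x \<le> M" "wp (seqs Ps) (m(a := x)) R"
  shows "wp (seqs (Assign l e # Ps)) m R"
  using assms by (intro wp_Assign_Cons) auto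

lemma wp_then: "fetch m l \<noteq> 0 \<Longrightarrow> wp (seqs (P # Ps)) m R \<Longrightarrow> wp (seqs (Cond l P Q # Ps)) m R"
  and wp_else: "fetch m l = 0 \<Longrightarrow> wp (seqs (Q # Ps)) m R \<Longrightarrow> wp (seqs (Cond l P Q # Ps)) m R"
  by (auto intro: wp_Cond_Cons)

text \<open>Candidates live at even and accumulators at odd addresses; this separates them when a
  register is read after an update.\<close>

lemma parity_neq [simp]: "2 * (i::nat) \<noteq> 3 + 2 * j"
  by presburger

text \<open>The lower bound on the accumulator makes truncated subtraction exact, and the upper
  bound keeps its content within \<open>M\<close>.\<close>

lemma wp_contribute:
  assumes at: "at_level j m" "j \<le> L"
    and a: "0 < acc (Suc j) m" "acc (Suc j) m < 2 * n"
    and R: "\<And>m'. at_level j m' \<Longrightarrow> vtx j m' = vtx j m - 1 \<Longrightarrow>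
       int (acc (Suc j) m') = int (acc (Suc j) m) + (2 * int (A (vtx (Suc j) m) (vtx j m)) - 1) \<Longrightarrow>
       (\<And>i. i > j \<Longrightarrow> vtx i m' = vtx i m) \<Longrightarrow> (\<And>i. i > Suc j \<Longrightarrow> acc i m' = acc i m) \<Longrightarrow>
       m' 5 = m 5 \<Longrightarrow> R m' []"
  shows "wp contribute m R"
proof (rule wp_small)
  assume sm: "small (24 + 2 * L) M m"
  note st = at(1)[unfolded at_level_def static_def, simplified]
  have A: "A (vtx (Suc j) m) (vtx j m) = 0 \<or> A (vtx (Suc j) m) (vtx j m) = 1"
    using A01[of "vtx (Suc j) m" "vtx j m"] by linarith
  have vM: "m (20 + 2 * j) \<le> M" "A (m (22 + 2 * j)) (m (20 + 2 * j)) \<le> M"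
    using small_le[OF sm] A01[of "m (22 + 2 * j)" "m (20 + 2 * j)"] bounds(2) by auto
  show "wp contribute m R"
    unfolding contribute_def
    apply (insert at(2) a vM bounds A)
    apply (rule wp_assign, simp add: fetch_def st, simp add: fetch_def st, simp, simp add: fetch_def st)+
    apply (erule disjE)
     apply (rule wp_else, simp add: fetch_def st)
     apply (rule wp_assign, simp add: fetch_def st, simp add: fetch_def st, simp, simp add: fetch_def st)+
     apply (rule wp_Nil, rule R; simp add: st at_level_def static_def)
    apply (rule wp_then, simp add: fetch_def st)
    apply (rule wp_assign, simp add: fetch_def st, simp add: fetch_def st, simp, simp add: fetch_def st)+
    apply (rule wp_Nil, rule R; simp add: st at_level_def static_def)
    done
qed

text \<open>The frame conditions speak only of candidates above \<open>j\<close> and accumulators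
  above \<open>Suc j\<close>, because the scan of the lower blocks overwrites everything
  else.\<close>

lemma wp_walk_step_descend:
  assumes at: "at_level (Suc j) m" "Suc j \<le> L" and v: "n div 2 ^ Suc (Suc j) < vtx (Suc j) m"
    and R: "\<And>m'. at_level j m' \<Longrightarrow> vtx j m' = n div 2 ^ j \<Longrightarrow> acc (Suc j) m' = n \<Longrightarrow>
       (\<And>i. i > j \<Longrightarrow> vtx i m' = vtx i m) \<Longrightarrow> (\<And>i. i > Suc j \<Longrightarrow> acc i m' = acc i m) \<Longrightarrow>
       m' 5 = m 5 \<Longrightarrow> R m' []"
  shows "wp walk_step m R"
proof (rule wp_small)
  assume sm: "small (24 + 2 * L) M m"
  define pw lo hi :: nat where "pw = 2 ^ Suc j" and "lo = n div (pw * 2)" and "hi = n div 2 ^ j"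
  have pw: "pw div 2 = 2 ^ j" "pw * 2 \<le> M" "n div (pw * 2) = lo" "n div 2 ^ j = hi"
    using pow_le[OF at(2)] bounds by (auto simp: pw_def lo_def hi_def)
  have bd: "pw \<le> M" "2 ^ j \<le> M" "lo \<le> M" "hi \<le> M" "n \<le> M"
    using pw div_le_dividend[of n "pw * 2"] div_le_dividend[of n "2 ^ j"] bounds(4) by linarith+
  have vM: "m (22 + 2 * j) - lo \<le> M"
    using small_le[OF sm, of "22 + 2 * j"] by linarith
  have v': "lo < m (22 + 2 * j)"
    using v by (simp add: lo_def pw_def mult.commute)
  note st = at(1)[unfolded at_level_def static_def, folded pw_def, simplified]
  show "wp walk_step m R"
    unfolding walk_step_def
    apply (insert bd v' vM at(2) bounds pw(2))
    apply (rule wp_assign, simp add: fetch_def st pw, simp add: fetch_def st pw, simp, simp add: fetch_def st pw)+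
    apply (rule wp_then, simp add: fetch_def st)
    apply (rule wp_block_Cons)
    apply (rule wp_assign, simp add: fetch_def st pw, simp add: fetch_def st pw, simp, simp add: fetch_def st pw)+
    apply (rule wp_then, simp add: fetch_def st)
    apply (rule wp_block_Cons)
    apply (rule wp_assign, simp add: fetch_def st pw, simp add: fetch_def st pw, simp, simp add: fetch_def st pw)+
    apply (rule wp_Nil)+
    apply (simp, rule R; simp add: st pw at_level_def static_def)
    done
qed

lemma wp_walk_step_member:
  assumes at: "at_level 0 m" and v: "n div 2 < vtx 0 m"
    and a: "0 < acc 1 m" "acc 1 m < 2 * n"
    and R: "\<And>m'. at_level 0 m' \<Longrightarrow> vtx 0 m' = vtx 0 m - 1 \<Longrightarrow>
       int (acc 1 m') = int (acc 1 m) + (2 * int (A (vtx 1 m) (vtx 0 m)) - 1) \<Longrightarrow>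
       (\<And>i. i > 0 \<Longrightarrow> vtx i m' = vtx i m) \<Longrightarrow> (\<And>i. i > 1 \<Longrightarrow> acc i m' = acc i m) \<Longrightarrow>
       m' 5 = m 5 \<Longrightarrow> R m' []"
  shows "wp walk_step m R"
proof (rule wp_small)
  assume sm: "small (24 + 2 * L) M m"
  define lo where "lo = n div 2"
  have bd: "lo \<le> M" using div_le_dividend[of n 2] bounds(4) unfolding lo_def by linarith
  have vM: "m 20 - lo \<le> M" "lo < m 20"
    using small_le[OF sm, of 20] v by (auto simp: lo_def)
  note st = at(1)[unfolded at_level_def static_def, simplified]
  let ?m = "m(8 := m 20 - lo, 7 := 0)"
  have con: "wp contribute ?m R"
  proof (rule wp_contribute[where j = 0])
    show "at_level 0 ?m" using at by (simp add: at_level_def static_def)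
  next
    fix m'
    assume "at_level 0 m'" "vtx 0 m' = vtx 0 ?m - 1"
      "int (acc (Suc 0) m') = int (acc (Suc 0) ?m) + (2 * int (A (vtx (Suc 0) ?m) (vtx 0 ?m)) - 1)"
      "\<And>i. 0 < i \<Longrightarrow> vtx i m' = vtx i ?m" "\<And>i. Suc 0 < i \<Longrightarrow> acc i m' = acc i ?m" "m' 5 = ?m 5"
    then show "R m' []" by (intro R) auto
  qed (use a in auto)
  show ?thesis
    unfolding walk_step_def
    apply (insert bd vM bounds)
    apply (rule wp_assign, simp add: fetch_def st lo_def[symmetric], simp add: fetch_def st lo_def[symmetric], simp, simp add: fetch_def st lo_def[symmetric])+
    apply (rule wp_then, simp add: fetch_def st)
    apply (rule wp_block_Cons)
    apply (rule wp_assign, simp add: fetch_def st, simp add: fetch_def st, simp, simp add: fetch_def st)+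
    apply (rule wp_else, simp add: fetch_def st)
    apply (rule wp_Cons, rule wp_start[OF con]; simp add: wp_Nil)
    done
qed

lemma wp_test_passes:
  assumes m: "m 1 = n" "m 2 = k" "m 4 \<le> n" "m 14 = 64" and l: "fetch m l \<le> 2 * n"
    and R: "R (m(8 := k - (fetch m l - n) * m 4 * 64)) []"
  shows "wp (test_passes l) m R"
proof -
  have le: "(fetch m l - n) * m 4 \<le> n * n" using m l by (intro mult_mono) auto
  then have b: "(fetch m l - n) * m 4 \<le> M" "(fetch m l - n) * m 4 * 64 \<le> M" "fetch m l - n \<le> M"
    using bounds l by linarith+
  show ?thesis
    unfolding test_passes_def
    apply (insert b[unfolded fetch_def] k_le bounds)
    apply (rule wp_assign, simp add: fetch_def m m(1)[simplified], simp add: fetch_def m m(1)[simplified], simp, simp add: fetch_def m m(1)[simplified])+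
    apply (rule wp_Nil)
    using R apply (simp add: fetch_def m m(1)[simplified])
    done
qed

text \<open>The return from a call. The outcome is stated through the accumulator alone; that it
  holds \<open>n\<close> plus an advantage, and hence decides membership in \<open>level\<close>, is
  known to the caller.\<close>

lemma wp_walk_step_ascend:
  assumes at: "at_level j m" "j < L" and v: "vtx j m \<le> n div 2 ^ Suc j"
    and a: "acc (Suc j) m \<le> 2 * n" "0 < acc (Suc (Suc j)) m" "acc (Suc (Suc j)) m < 2 * n"
    and R: "\<And>m'. at_level (Suc j) m' \<Longrightarrow> vtx (Suc j) m' = vtx (Suc j) m - 1 \<Longrightarrow>
       int (acc (Suc (Suc j)) m') = int (acc (Suc (Suc j)) m)
         + (if k \<le> (acc (Suc j) m - n) * 2 ^ j * 64
            then 2 * int (A (vtx (Suc (Suc j)) m) (vtx (Suc j) m)) - 1 else 0) \<Longrightarrow>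
       (\<And>i. i > Suc j \<Longrightarrow> vtx i m' = vtx i m) \<Longrightarrow> (\<And>i. i > Suc (Suc j) \<Longrightarrow> acc i m' = acc i m) \<Longrightarrow>
       m' 5 = m 5 \<Longrightarrow> R m' []"
  shows "wp walk_step m R"
proof (rule wp_small)
  assume sm: "small (24 + 2 * L) M m"
  define pw lo r :: nat where "pw = 2 ^ j" and "lo = n div (pw * 2)" and "r = k - (acc (Suc j) m - n) * pw * 64"
  have pw: "pw * 2 = 2 ^ Suc j" "pw * 2 \<le> M" "pw \<le> n"
    using pow_le[of j] pow_le[of "Suc j"] bounds at by (auto simp: pw_def lo_def)
  have bd: "lo \<le> M"
    using div_le_dividend[of n "pw * 2"] bounds(4) unfolding lo_def by linarith
  have v': "vtx j m - lo = 0"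
    using v by (simp add: lo_def pw_def mult.commute)
  note st = at(1)[unfolded at_level_def static_def, folded pw_def, simplified]
  have r': "k - (m (23 + 2 * j) - n) * pw * 64 = r" by (simp add: r_def)
  let ?m2 = "m(8 := r, 7 := 23 + 2 * j, 3 := 22 + 2 * j, 4 := pw * 2)"
  have at2: "at_level (Suc j) ?m2"
    using at pw by (simp add: at_level_def static_def)
  have con: "wp contribute ?m2 R" if "r = 0"
  proof (rule wp_contribute[OF at2])
    fix m' 
    assume "at_level (Suc j) m'" "vtx (Suc j) m' = vtx (Suc j) ?m2 - 1"
      "int (acc (Suc (Suc j)) m') = int (acc (Suc (Suc j)) ?m2)
          + (2 * int (A (vtx (Suc (Suc j)) ?m2) (vtx (Suc j) ?m2)) - 1)"
      "\<And>i. Suc j < i \<Longrightarrow> vtx i m' = vtx i ?m2" "\<And>i. Suc (Suc j) < i \<Longrightarrow> acc i m' = acc i ?m2" "m' 5 = ?m2 5"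
    then show "R m' []" using that by (intro R) (auto simp: r_def pw_def)
  qed (use a at in auto)
  have skip: "wp (Assign (Ind 3) (Sub (Ind 3) (Reg 0))) ?m2 R" if "r \<noteq> 0"
  proof (rule wp_Assign)
    have "k \<le> (acc (Suc j) m - n) * 2 ^ j * 64 \<longleftrightarrow> False"
      using that by (simp add: r_def pw_def)
    then show "R (?m2(addr ?m2 (Ind 3) := expr_val n A k ?m2 (Sub (Ind 3) (Reg 0)))) []"
      using at2 by (intro R) (auto simp: fetch_def at_level_def static_def)
  qed (use at small_le[OF sm, of "22 + 2 * j"] in \<open>auto simp: fetch_def at_level_def static_def\<close>)
  have branch: "wp (seqs [Cond (Reg 8) (Assign (Ind 3) (Sub (Ind 3) (Reg 0))) contribute]) ?m2 R"
  proof ((rule wp_Cond_Cons; rule wp_Cons), goal_cases)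
    case 1
    then have "r \<noteq> 0" by (simp add: fetch_def)
    from skip[OF this] show ?case by (rule wp_conseq) (simp add: wp_Nil)
  next
    case 2
    then have "r = 0" by (simp add: fetch_def)
    from con[OF this] show ?case by (rule wp_conseq) (simp add: wp_Nil)
  qed
  have tail: "wp (seqs [
               test_passes (Ind 7),
               Assign (Reg 3) (Add (Reg 3) (Reg 6)),
               Assign (Reg 4) (Mul (Reg 4) (Reg 6)),
               Cond (Reg 8) (Assign (Ind 3) (Sub (Ind 3) (Reg 0))) contribute]) (m(8 := 0, 7 := 23 + 2 * j)) R"
  proof (rule wp_Cons, rule wp_test_passes, goal_cases)
    case 6
    show ?case
      apply (insert pw(2,3) bounds at(2))
      apply (rule wp_assign, simp add: fetch_def st, simp add: fetch_def st, simp, simp add: fetch_def st)+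
      apply (rule wp_start[OF branch]; simp add: fetch_def st r')
      done
  qed (use pw a in \<open>auto simp: fetch_def st\<close>)
  have eq: "(m(8 := x1, 8 := x2, 8 := 0, 7 := x3, 7 := 23 + 2 * j)) a = (m(8 := 0, 7 := 23 + 2 * j)) a" for a x1 x2 x3
    by simp
  show "wp walk_step m R"
    unfolding walk_step_def
    apply (insert bd v' pw(2,3) bounds at(2))
    apply (rule wp_assign, simp add: fetch_def st lo_def[symmetric], simp add: fetch_def st lo_def[symmetric], simp, simp add: fetch_def st lo_def[symmetric])+
    apply (rule wp_else, simp add: fetch_def st)
    apply (rule wp_block_Cons)
    apply (rule wp_assign, simp add: fetch_def st, simp add: fetch_def st, simp, simp add: fetch_def st)+
    apply (rule wp_then, simp add: fetch_def st)
    apply (rule wp_block_Cons)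
    apply (rule wp_assign, simp add: fetch_def st, simp add: fetch_def st, simp, simp add: fetch_def st)
    apply (rule wp_start[OF tail], rule eq)
    apply ((rule wp_Nil)+)
    apply simp
    done
qed

lemma wp_walk_step_stop:
  assumes at: "at_level L m" and v: "vtx L m \<le> n div 2 ^ Suc L"
    and R: "\<And>m'. at_level L m' \<Longrightarrow> vtx L m' = vtx L m \<Longrightarrow> acc (Suc L) m' = acc (Suc L) m \<Longrightarrow>
       vtx (Suc L) m' = vtx (Suc L) m \<Longrightarrow> m' 5 = 0 \<Longrightarrow> R m' []"
  shows "wp walk_step m R"
proof -
  define pw lo :: nat where "pw = 2 ^ L" and "lo = n div (pw * 2)"
  have pw: "pw * 2 \<le> M" using pow_le[of L] bounds by (simp add: pw_def)
  have bd: "lo \<le> M"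
    using div_le_dividend[of n "pw * 2"] bounds(4) unfolding lo_def by linarith
  have v': "vtx L m - lo = 0"
    using v by (simp add: lo_def pw_def mult.commute)
  note st = at(1)[unfolded at_level_def static_def, folded pw_def, simplified]
  show ?thesis
    unfolding walk_step_def
    apply (insert bd v' pw bounds)
    apply (rule wp_assign, simp add: fetch_def st lo_def[symmetric], simp add: fetch_def st lo_def[symmetric], simp, simp add: fetch_def st lo_def[symmetric])+
    apply (rule wp_else, simp add: fetch_def st)
    apply (rule wp_block_Cons)
    apply (rule wp_assign, simp add: fetch_def st, simp add: fetch_def st, simp, simp add: fetch_def st)+
    apply (rule wp_else, simp add: fetch_def st)
    apply (rule wp_block_Cons)
    apply (rule wp_assign, simp add: fetch_def st, simp add: fetch_def st, simp, simp add: fetch_def st)+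
    apply (rule wp_Nil)+
    apply (simp, rule R; simp add: st pw_def[symmetric] at_level_def static_def)
    done
qed

text \<open>
  The claim is in continuation style, so that it composes along the unfolding of the loop.
\<close>

lemma wp_walk:
  assumes "j \<le> L" "at_level j m" "m 5 = 1" "vtx j m = n div 2 ^ Suc j + d" "vtx j m \<le> n div 2 ^ j"
    and "d < acc (Suc j) m" "acc (Suc j) m + d \<le> 2 * n"
    and "\<And>m'. at_level j m' \<Longrightarrow> m' 5 = 1 \<Longrightarrow> vtx j m' = n div 2 ^ Suc j \<Longrightarrow>
       int (acc (Suc j) m') = int (acc (Suc j) m)
         + advantage A (level A n k j \<inter> {n div 2 ^ Suc j<..vtx j m}) (vtx (Suc j) m) \<Longrightarrow>
       (\<And>i. i > j \<Longrightarrow> vtx i m' = vtx i m) \<Longrightarrow> (\<And>i. i > Suc j \<Longrightarrow> acc i m' = acc i m) \<Longrightarrow>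
       wp walk m' R"
  shows "wp walk m R"
  using assms
\<comment> \<open>Outer induction on the level, inner induction on the number \<open>d\<close> of
  candidates of that level still to be visited. \<open>R\<close> has to vary because the scan of a
  lower block continues with the rest of the scan above it.\<close>
proof (induction j arbitrary: d m R)
  case 0
  then show ?case
  proof (induction d arbitrary: m)
    case 0
    show ?case
      by (rule "0.prems"(8)) (use "0.prems" in \<open>auto simp: advantage_def\<close>)
  next
    case (Suc d)
    show ?case
      unfolding walk_def
    proof (rule wp_While_unroll, goal_cases)
      case 1
      show ?case using Suc.prems by (simp add: fetch_def)
    next
      case 2
      show ?case
      proof (rule wp_walk_step_member, goal_cases)
        case (5 m')
        let ?v = "vtx 0 m"
        have mem: "?v \<in> block n 0" "{n div 2 ^ Suc 0<..?v} = insert ?v {n div 2 ^ Suc 0<..vtx 0 m'}"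
          using Suc.prems 5 by (auto simp: block_def)
        have A: "A (vtx 1 m) ?v \<le> 1" by (rule A01)
        have "wp walk m' R"
        proof (rule Suc.IH)
          fix m'' 
          assume m'': "at_level 0 m''" "m'' 5 = 1" "vtx 0 m'' = n div 2 ^ Suc 0"
            "int (acc (Suc 0) m'') = int (acc (Suc 0) m')
              + advantage A (level A n k 0 \<inter> {n div 2 ^ Suc 0<..vtx 0 m'}) (vtx (Suc 0) m')"
            "\<And>i. i > 0 \<Longrightarrow> vtx i m'' = vtx i m'" "\<And>i. i > Suc 0 \<Longrightarrow> acc i m'' = acc i m'"
          show "wp walk m'' R"
          proof (rule Suc.prems(8))
            have "advantage A (level A n k 0 \<inter> {n div 2 ^ Suc 0<..?v}) (vtx (Suc 0) m)
                = (2 * int (A (vtx 1 m) ?v) - 1)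
                + advantage A (level A n k 0 \<inter> {n div 2 ^ Suc 0<..vtx 0 m'}) (vtx (Suc 0) m)"
              using mem Suc.prems(4) 5(2) unfolding mem(2) by (simp add: advantage_def)
            then show "int (acc (Suc 0) m'') = int (acc (Suc 0) m)
              + advantage A (level A n k 0 \<inter> {n div 2 ^ Suc 0<..?v}) (vtx (Suc 0) m)"
              using m''(4) 5(3) 5(4)[of 1] by simp
          qed (use m'' 5 in auto)
        qed (use Suc.prems 5 A in \<open>auto\<close>)
        then show ?case by (simp add: walk_def)
      qed (use Suc.prems in auto)
    qed
  qed
next
  case (Suc j)
  note outer_IH = Suc.IH
  from Suc.prems show ?case
  proof (induction d arbitrary: m)
    case 0
    show ?case
      by (rule "0.prems"(8)) (use "0.prems" in \<open>auto simp: advantage_def\<close>)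
  next
    case (Suc d)
    let ?v = "vtx (Suc j) m"
    let ?lo = "n div 2 ^ Suc (Suc j)"
    show ?case
      unfolding walk_def
    proof (rule wp_While_unroll, goal_cases)
      case 1
      show ?case using Suc.prems by (simp add: fetch_def)
    next
      case 2
      show ?case
      proof (rule wp_walk_step_descend[where j = j], goal_cases)
        case (4 m1)
        have jL: "j \<le> L" "j < L" using Suc.prems(1) by auto
        have hi: "n div 2 ^ Suc j \<le> n div 2 ^ j"
          by (intro div_le_mono2) auto
        have hn: "n div 2 ^ j \<le> n" by simp
        \<comment> \<open>An accumulator starts at \<open>n\<close> and receives at most one vote
          per vertex of a block. The block has fewer than \<open>n\<close> vertices, since its lower
          end is positive, so the accumulator stays positive.\<close>
        have dd: "n div 2 ^ j - n div 2 ^ Suc j < n" "n + (n div 2 ^ j - n div 2 ^ Suc j) \<le> 2 * n"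
        proof -
          have "0 < n div 2 ^ Suc j" using pow_le[OF Suc.prems(1)] by (simp add: div_greater_zero_iff)
          then show "n div 2 ^ j - n div 2 ^ Suc j < n" using hn hi by linarith
        qed (use hn in linarith)
        have mem: "?v \<in> block n (Suc j)" "{?lo<..?v} = insert ?v {?lo<..?v - 1}"
          using Suc.prems by (auto simp: block_def)
        have "wp walk m1 R"
        \<comment> \<open>The complete scan of block \<open>j\<close> for the fixed candidate
          \<open>?v\<close>. Its continuation is the return step, after which the inner induction
          hypothesis takes over at \<open>?v - 1\<close>.\<close>
        proof (rule outer_IH[of m1 "n div 2 ^ j - n div 2 ^ Suc j" R], goal_cases)
          case (8 m2)
          have full: "level A n k j \<inter> {n div 2 ^ Suc j<..n div 2 ^ j} = level A n k j"
            using level_subset_block[of A n k j] by (auto simp: block_def)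
          have acc2: "int (acc (Suc j) m2) = int n + advantage A (level A n k j) ?v"
            using 8(4) 4(2,3) 4(4)[of "Suc j"] full by simp
          have adv: "advantage A (level A n k j) ?v \<le> int n"
          proof -
            have "card (level A n k j) \<le> card (block n j)"
              by (intro card_mono level_subset_block) simp
            also have "\<dots> \<le> n" using hn unfolding block_def card_greaterThanAtMost by linarith
            finally show ?thesis
              using abs_advantage_le[of A ?v "level A n k j"] A01 by fastforce
          qed
          have pass: "k \<le> (acc (Suc j) m2 - n) * 2 ^ j * 64 \<longleftrightarrow> ?v \<in> level A n k (Suc j)"
          proof -
            have "int (acc (Suc j) m2 - n) = max 0 (advantage A (level A n k j) ?v)"
              using acc2 by linarith
            from test_iff[OF this k_pos] show ?thesis using mem by simp
          qed
          have acc22: "acc (Suc (Suc j)) m2 = acc (Suc (Suc j)) m"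
            using 8(6)[of "Suc (Suc j)"] 4(5)[of "Suc (Suc j)"] by simp
          show ?case
            unfolding walk_def
          proof (rule wp_While_unroll, goal_cases)
            case 1
            show ?case using 8 by (simp add: fetch_def)
          next
            case 2
            show ?case
            proof (rule wp_walk_step_ascend[where j = j], goal_cases)
              case (7 m3)
              have A: "A (vtx (Suc (Suc j)) m) ?v \<le> 1" by (rule A01)
              have same: "vtx (Suc j) m2 = ?v" "vtx (Suc (Suc j)) m2 = vtx (Suc (Suc j)) m"
                "acc (Suc (Suc j)) m2 = acc (Suc (Suc j)) m"
                using 8(5)[of "Suc j"] 8(5)[of "Suc (Suc j)"] 4(4)[of "Suc j"] 4(4)[of "Suc (Suc j)"]
                  8(6)[of "Suc (Suc j)"] 4(5)[of "Suc (Suc j)"] by simp_all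
              have acc3: "int (acc (Suc (Suc j)) m3) = int (acc (Suc (Suc j)) m)
                + (if ?v \<in> level A n k (Suc j) then 2 * int (A (vtx (Suc (Suc j)) m) ?v) - 1 else 0)"
                using 7(3) unfolding pass same by simp
              have v3: "vtx (Suc j) m3 = ?v - 1" using 7(2) same by simp
              have frame: "vtx i m3 = vtx i m" if "i > Suc j" for i
                using 7(4)[OF that] 8(5)[of i] 4(4)[of i] that by simp
              have frame': "acc i m3 = acc i m" if "i > Suc (Suc j)" for i
                using 7(5)[OF that] 8(6)[of i] 4(5)[of i] that by simp
              have accb: "acc (Suc (Suc j)) m3 \<le> Suc (acc (Suc (Suc j)) m)"
                "acc (Suc (Suc j)) m \<le> Suc (acc (Suc (Suc j)) m3)"
                using acc3 A by (auto split: if_splits)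
              have "wp walk m3 R"
              proof (rule Suc.IH, goal_cases)
                case (8 m4)
                show ?case
                proof (rule Suc.prems(8), goal_cases)
                  case 4
                  have "level A n k (Suc j) \<inter> {?lo<..?v} =
                     (if ?v \<in> level A n k (Suc j) then insert ?v (level A n k (Suc j) \<inter> {?lo<..?v - 1})
                      else level A n k (Suc j) \<inter> {?lo<..?v - 1})"
                    unfolding mem(2) by auto
                  moreover have "?v \<notin> {?lo<..?v - 1}" using Suc.prems(4) by auto
                  ultimately have "advantage A (level A n k (Suc j) \<inter> {?lo<..?v}) u =
                     (if ?v \<in> level A n k (Suc j) then 2 * int (A u ?v) - 1 else 0)
                     + advantage A (level A n k (Suc j) \<inter> {?lo<..?v - 1}) u" for u
                    by (simp add: advantage_def del: level.simps)
                  then show ?case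
                    using 8(4) acc3 v3 frame[of "Suc (Suc j)"] by (simp del: level.simps)
                qed (use 8(1,2,3,5,6) frame frame' in \<open>simp_all del: level.simps\<close>)
              qed (use Suc.prems(1,4,5,6,7) 7(1,6) 8(2) v3 accb in \<open>simp_all\<close>)
              then show ?case by (simp add: walk_def)
            qed (use Suc.prems(6,7) 8(1,3) acc22 jL adv acc2 in auto)
          qed
        qed (use 4(1,2,3,6) Suc.prems(3) hi dd jL in simp_all)
        then show ?case by (simp add: walk_def)
      qed (use Suc.prems in auto)
    qed
  qed
qed

section \<open>Computing the depth\<close>

lemma wp_halve_loop:
  assumes m: "m 0 = 1" "m 6 = 2" "m 5 = m 10 - 1" "m 10 \<le> n" "m 13 + floor_log (m 10) \<le> n"
    and R: "\<And>m'. m' 13 = m 13 + floor_log (m 10) \<Longrightarrow> (\<And>a. a \<notin> {5, 10, 13} \<Longrightarrow> m' a = m a) \<Longrightarrow> R m' []"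
  shows "wp halve_loop m R"
  unfolding halve_loop_def
\<comment> \<open>Halving lowers \<open>floor_log\<close> by one, so register \<open>13\<close> plus
  the logarithm of register \<open>10\<close> is invariant. The loop ends at 0 or 1, where
  \<open>floor_log\<close> is 0.\<close>
proof (rule wp_While[where f = "\<lambda>m. m 10" and I = "\<lambda>m' w. w = [] \<and> (\<forall>a. a \<notin> {5, 10, 13} \<longrightarrow> m' a = m a) \<and>
    m' 5 = m' 10 - 1 \<and> m' 10 \<le> n \<and> m' 13 + floor_log (m' 10) = m 13 + floor_log (m 10)"], goal_cases)
  case (2 m' w)
  then have m': "m' (Suc 0 - Suc 0) = 1" "m' 6 = 2" "m' 5 = m' 10 - 1" "m' 10 \<le> n" "2 \<le> m' 10"
    and inv: "m' 13 + floor_log (m' 10) = m 13 + floor_log (m 10)" "w = []" and eq: "\<And>a. a \<notin> {5, 10, 13} \<Longrightarrow> m' a = m a"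
    using m by (auto simp: fetch_def)
  have fl: "floor_log (m' 10) = Suc (floor_log (m' 10 div 2))"
    using m'(5) by (rule floor_log_rec)
  then have bd: "Suc (m' 13) \<le> n" "n \<le> M" using inv m(5) bounds by linarith+
  note st = m'(1)[simplified] m'(2)
  show ?case
    apply (insert m' bd bounds)
    apply (rule wp_assign, simp add: fetch_def st, simp add: fetch_def st, simp, simp add: fetch_def st)+
    apply (rule wp_Nil)
    using inv fl m'(5) eq by (simp del: floor_log_half)
next
  case (3 m' w)
  then have "m' 10 \<le> 1" by (simp add: fetch_def)
  then have "m' 10 = 0 \<or> m' 10 = 1" by linarith
  then have "floor_log (m' 10) = 0" by auto
  then show ?case using 3 by (auto intro!: R)
qed (use m in auto)

definition scaling :: "nat \<Rightarrow> mem \<Rightarrow> bool" where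
  "scaling i m \<longleftrightarrow> m 0 = 1 \<and> m 1 = n \<and> m 2 = k \<and> m 6 = 2 \<and> m 14 = 64 \<and> m 15 = 20 \<and> m 16 = 3 \<and>
     m 10 = shrunk n i \<and> m 11 = 24 + 2 * i \<and> m 12 = 4 * 2 ^ i"

lemma wp_compare_scale:
  assumes m: "scaling i m" and R: "\<And>m'. scaling i m' \<Longrightarrow> m' 5 = n * (shrunk n i)\<^sup>2 - k\<^sup>2 \<Longrightarrow> R m' []"
  shows "wp compare_scale m R"
proof -
  define x where "x = shrunk n i"
  have x: "x \<le> n" using shrunk_le by (simp add: x_def)
  then have sq: "x * x \<le> n * n" "k * k \<le> n * n" using k_le by (auto intro: mult_mono)
  moreover have "x * x * n \<le> n * n * n" using sq(1) by (rule mult_le_mono1)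
  ultimately have bd: "x * x \<le> M" "k * k \<le> M" "x * x * n \<le> M" using bounds by linarith+
  note st = m[unfolded scaling_def, folded x_def, simplified]
  show ?thesis
    unfolding compare_scale_def
    apply (insert bd bounds)
    apply (rule wp_assign, simp add: fetch_def st, simp add: fetch_def st, simp, simp add: fetch_def st)+
    apply (rule wp_Nil, rule R)
    apply (simp_all add: scaling_def st x_def[symmetric] power2_eq_square mult_ac)
    done
qed

text \<open>The loop stops at the first index whose test holds, which is \<open>cutoff n k\<close>
  by minimality. Register \<open>10\<close> is the variant, as \<open>floor_log\<close> is strictly
  below its positive argument.\<close>

lemma wp_depth_loop:
  assumes L: "L = cutoff n k + 2" and m: "scaling 0 m" "m 5 = n * (shrunk n 0)\<^sup>2 - k\<^sup>2"
    and R: "\<And>m'. scaling (cutoff n k) m' \<Longrightarrow> R m' []"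
  shows "wp depth_loop m R"
  unfolding depth_loop_def
proof (rule wp_While[where f = "\<lambda>m. m 10" and I = "\<lambda>m w. w = [] \<and> (\<exists>i\<le>cutoff n k. scaling i m \<and>
    m 5 = n * (shrunk n i)\<^sup>2 - k\<^sup>2)"], goal_cases)
  case (2 m w)
  then obtain i where i: "i \<le> cutoff n k" "scaling i m" "m 5 = n * (shrunk n i)\<^sup>2 - k\<^sup>2" "w = []" by auto
  have pos: "k\<^sup>2 < n * (shrunk n i)\<^sup>2" using 2 i by (auto simp: fetch_def)
  then have iL: "i < cutoff n k" using i(1) cutoff[of n k] by (metis le_neq_implies_less not_le)
  define x where "x = shrunk n i"
  have x: "0 < x" "x \<le> n" using pos shrunk_le by (auto simp: x_def intro!: gr0I)
  note fx = floor_log_less[OF x(1)]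
  note st = i(2)[unfolded scaling_def, folded x_def, simplified]
  have iL': "Suc i + 2 \<le> L" using iL L by simp
  have pw: "4 * 2 ^ i * 2 \<le> n"
    using pow_le[OF iL'] by (simp add: numeral_eq_Suc)
  have bd: "x - 1 \<le> M" "floor_log x \<le> M" "26 + 2 * i \<le> M" "4 * 2 ^ i * 2 \<le> M"
    using x fx bounds pw iL' by linarith+
  have next_step: "wp compare_scale m1 (\<lambda>m' w'. wp (seqs []) m'
      (\<lambda>m'' w''. (w' @ w'' = [] \<and> (\<exists>i\<le>cutoff n k. scaling i m'' \<and> m'' 5 = n * (shrunk n i)\<^sup>2 - k\<^sup>2)) \<and> m'' 10 < x))"
    if m1: "scaling (Suc i) m1" for m1
  proof (rule wp_compare_scale[OF m1], rule wp_Nil)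
    fix m' assume "scaling (Suc i) m'" "m' 5 = n * (shrunk n (Suc i))\<^sup>2 - k\<^sup>2"
    then show "([] @ [] = [] \<and> (\<exists>i\<le>cutoff n k. scaling i m' \<and> m' 5 = n * (shrunk n i)\<^sup>2 - k\<^sup>2)) \<and> m' 10 < x"
      using iL fx by (auto simp: scaling_def shrunk_Suc x_def intro!: exI[of _ "Suc i"])
  qed
  have after: "wp (seqs [
     Assign (Reg 10) (Load (Reg 13)),
     Assign (Reg 11) (Add (Reg 11) (Reg 6)),
     Assign (Reg 12) (Mul (Reg 12) (Reg 6)),
     compare_scale]) m' (\<lambda>m'' w'. (w' = [] \<and> (\<exists>i\<le>cutoff n k. scaling i m'' \<and>
         m'' 5 = n * (shrunk n i)\<^sup>2 - k\<^sup>2)) \<and> m'' 10 < x)"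
    if m': "m' 13 = floor_log x" "\<And>a. a \<notin> {5, 10, 13} \<Longrightarrow> m' a = m a" for m'
  proof -
    have st': "m' 0 = 1" "m' 1 = n" "m' 2 = k" "m' 6 = 2" "m' 14 = 64" "m' 15 = 20" "m' 16 = 3"
      "m' 11 = 24 + 2 * i" "m' 12 = 4 * 2 ^ i"
      using m'(2) st by simp_all
    note st' = st' [simplified]
    show ?thesis
      apply (insert bd bounds)
      apply (rule wp_assign, simp add: fetch_def st' m'(1), simp add: fetch_def st' m'(1), simp, simp add: fetch_def st' m'(1))+
      apply (rule wp_Cons)
      apply (rule wp_conseq)
       apply (rule next_step)
       apply (simp add: scaling_def st' m'(1) shrunk_Suc x_def)
      apply simp
      done
  qed
  show ?case
    apply (insert bd bounds)
    apply (rule wp_assign, simp add: fetch_def st, simp add: fetch_def st, simp, simp add: fetch_def st)+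
    apply (rule wp_Cons)
    apply (rule wp_halve_loop)
         apply (simp add: st)
        apply (simp add: st)
       apply (simp add: st)
      apply (simp add: st x(2))
     apply (use fx x(2) in \<open>simp add: st\<close>)
    subgoal premises prems for m'
      using after[of m'] prems(12,13) by (simp add: st i(4))
    done
next
  case (3 m w)
  then obtain i where i: "i \<le> cutoff n k" "scaling i m" "n * (shrunk n i)\<^sup>2 \<le> k\<^sup>2" "w = []"
    by (auto simp: fetch_def)
  then have "i = cutoff n k" using less_cutoff[of i n k] by (metis le_neq_implies_less not_le)
  then show ?case using i R by simp
qed (use m in auto)

section \<open>The scan over all vertices\<close>

definition accepted :: "nat \<Rightarrow> bool" where
  "accepted u \<longleftrightarrow> int k \<le> 64 * 2 ^ L * advantage A (level A n k L) u"

lemma wp_scan_loop: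
  assumes m: "static m" "vtx (Suc L) m = n"
    and R: "\<And>m' w. distinct w \<Longrightarrow> set w = {u \<in> {1..n}. accepted u} \<Longrightarrow> R m' w"
  shows "wp scan_loop m R"
  unfolding scan_loop_def
proof (rule wp_While[where f = "vtx (Suc L)" and I = "\<lambda>m w. static m \<and> vtx (Suc L) m \<le> n \<and>
    distinct w \<and> set w = {u \<in> {vtx (Suc L) m<..n}. accepted u}"], goal_cases)
  case (2 m w)
  define v where "v = vtx (Suc L) m"
  have v: "0 < v" "v \<le> n" "m (22 + 2 * L) = v" and I: "static m" "distinct w" "set w = {u \<in> {v<..n}. accepted u}"
    using 2 by (auto simp: v_def fetch_def static_def)
  note st = I(1)[unfolded static_def, simplified]
  define hi lo where "hi = n div 2 ^ L" and "lo = n div 2 ^ Suc L"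
  have h: "lo \<le> hi" "hi \<le> n" "2 ^ L \<le> M" "0 < hi"
    using L_le bounds by (auto simp: hi_def lo_def div_greater_zero_iff intro: div_le_mono2)
  have lohi: "hi - lo < n"
  proof (cases "L = 0")
    case True
    then show ?thesis using n_ge by (simp add: hi_def lo_def)
  next
    case False
    then have "hi \<le> n div 2" unfolding hi_def by (intro div_le_mono2) (auto simp: self_le_power)
    then show ?thesis using n_ge by linarith
  qed
  have bd: "hi \<le> M" "n \<le> M" "v - 1 \<le> M" "v \<le> M" using h v bounds by linarith+
  define final where "final = [test_passes (Ind 18), Cond (Reg 8) Skip (Output (Ind 17)),
     Assign (Ind 17) (Sub (Ind 17) (Reg 0))]"
  define Q where "Q = (\<lambda>m' w'. (static m' \<and> vtx (Suc L) m' \<le> n \<and> distinct (w @ w') \<and>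
    set (w @ w') = {u \<in> {vtx (Suc L) m'<..n}. accepted u}) \<and> vtx (Suc L) m' < v)"
  let ?m = "m(3 := 20 + 2 * L, 4 := 2 ^ L, 23 + 2 * L := n, 20 + 2 * L := hi, 5 := 1)"
  have walk: "wp walk ?m (\<lambda>m' w'. wp (seqs final) m' (\<lambda>m'' w''. Q m'' (w' @ w'')))"
  proof (rule wp_walk[where j = L and d = "hi - lo"], goal_cases)
    case (8 m1)
    have full: "level A n k L \<inter> {lo<..hi} = level A n k L"
      using level_subset_block[of A n k L] by (auto simp: block_def hi_def lo_def)
    have acc1: "int (acc (Suc L) m1) = int n + advantage A (level A n k L) v"
      using 8(4) v(3) by (simp add: full lo_def[symmetric, simplified])
    have v1: "vtx (Suc L) m1 = v" using 8(5)[of "Suc L"] v(3) by simp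
    have adv: "advantage A (level A n k L) v \<le> int n"
    proof -
      have "card (level A n k L) \<le> card (block n L)"
        by (intro card_mono level_subset_block) simp
      also have "\<dots> \<le> n" using h unfolding block_def card_greaterThanAtMost hi_def[symmetric] by linarith
      finally show ?thesis
        using abs_advantage_le[of A v "level A n k L"] A01 by fastforce
    qed
    define r where "r = k - (acc (Suc L) m1 - n) * 2 ^ L * 64"
    have "int (acc (Suc L) m1 - n) = max 0 (advantage A (level A n k L) v)"
      using acc1 by linarith
    from test_iff[OF this k_pos] have pass: "r = 0 \<longleftrightarrow> accepted v"
      unfolding r_def diff_is_0_eq accepted_def .
    show ?case
      unfolding walk_def
    proof (rule wp_While_unroll, goal_cases)
      case 1
      show ?case using 8 by (simp add: fetch_def)
    next
      case 2
      show ?case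
      proof (rule wp_walk_step_stop, goal_cases)
        case (3 m2)
        have m2: "static m2" "m2 3 = 20 + 2 * L" "m2 4 = 2 ^ L" "m2 (23 + 2 * L) = acc (Suc L) m1" "m2 (22 + 2 * L) = v"
          using 3 v1 by (auto simp: at_level_def)
        note st2 = m2(1)[unfolded static_def, simplified] m2(2-)
        have r: "k - (m2 (23 + 2 * L) - n) * 2 ^ L * 64 = r"
          using m2(4) by (simp add: r_def)
        let ?m3 = "m2(8 := r)"
        let ?m4 = "m2(8 := r, 22 + 2 * L := v - 1)"
        have ins: "{v - 1<..n} = insert v {v<..n}" using v(1,2) by auto
        have stat: "static ?m4" using m2(1) by (simp add: static_def)
        have v4: "vtx (Suc L) ?m4 = v - 1" by simp
        have "v - 1 \<le> n" "v - 1 < v" using v(1,2) by auto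
        then have Qi: "Q ?m4 w' \<longleftrightarrow> distinct (w @ w') \<and> set (w @ w') = {u \<in> insert v {v<..n}. accepted u}" for w'
          unfolding Q_def v4 ins using stat by blast
        have Q0: "Q ?m4 []" if "r \<noteq> 0"
          unfolding Qi using that I(2,3) pass by auto
        have Q1: "Q ?m4 [v]" if "r = 0"
          unfolding Qi using that I(2,3) pass by auto
        have last: "wp (seqs [Assign (Ind 17) (Sub (Ind 17) (Reg 0))]) ?m3 (\<lambda>m' w'. Q m' (u @ w'))"
          if "Q ?m4 u" for u
          apply (insert bd bounds)
          apply (rule wp_assign, simp add: fetch_def st2, simp add: fetch_def st2, simp, simp add: fetch_def st2)+
          apply (rule wp_Nil)
          apply (use that in \<open>simp add: fetch_def\<close>)
          done
        have cond: "wp (seqs [Cond (Reg 8) Skip (Output (Ind 17)), Assign (Ind 17) (Sub (Ind 17) (Reg 0))]) ?m3 Q"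
        proof (rule wp_Cond_Cons)
          assume "fetch ?m3 (Reg 8) \<noteq> 0"
          then have "r \<noteq> 0" by (simp add: fetch_def)
          from last[OF Q0[OF this]] show "wp (seqs [Skip, Assign (Ind 17) (Sub (Ind 17) (Reg 0))]) ?m3 Q"
            by - (rule wp_Cons, rule wp_Skip, simp)
        next
          assume "fetch ?m3 (Reg 8) = 0"
          then have "r = 0" by (simp add: fetch_def)
          moreover have "fetch ?m3 (Ind 17) = v" using st2 by (simp add: fetch_def)
          ultimately show "wp (seqs [Output (Ind 17), Assign (Ind 17) (Sub (Ind 17) (Reg 0))]) ?m3 Q"
            using last[OF Q1] by - (rule wp_Cons, rule wp_Output, simp)
        qed
        have "wp (seqs final) m2 Q"
          unfolding final_def
        proof (rule wp_Cons, rule wp_test_passes, goal_cases)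
          case 6
          show ?case
            by (rule wp_start[OF cond]) (use st2 r in \<open>auto simp: fetch_def\<close>)
        next
          case 5
          show ?case using st2 acc1 adv by (simp add: fetch_def)
        qed (use st2 L_le in \<open>auto\<close>)
        then show ?case
          using 3(5) by (intro wp_While_exit) (auto simp: fetch_def)
      qed (use 8 in auto)
    qed
  qed (use I(1) h lohi st in \<open>auto simp: at_level_def static_def hi_def[symmetric] lo_def[symmetric, simplified]\<close>)
  have fin: "seqs [walk, test_passes (Ind 18), Cond (Reg 8) Skip (Output (Ind 17)),
     Assign (Ind 17) (Sub (Ind 17) (Reg 0))] = seqs (walk # final)"
    by (simp add: final_def)
  have "wp (seqs [
     Assign (Reg 3) (Load (Reg 11)),
     Assign (Reg 4) (Load (Reg 12)),
     Assign (Ind 18) (Load (Reg 1)),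
     Assign (Ind 3) (Div (Reg 1) (Reg 4)),
     Assign (Reg 5) (Const 1),
     walk,
     test_passes (Ind 18),
     Cond (Reg 8) Skip (Output (Ind 17)),
     Assign (Ind 17) (Sub (Ind 17) (Reg 0))]) m Q"
    apply (insert bd bounds h)
    apply (rule wp_assign, simp add: fetch_def st, simp add: fetch_def st hi_def[symmetric], simp, simp add: fetch_def st)+
    unfolding fin
    apply (rule wp_Cons)
    apply (rule wp_start[OF walk])
     apply simp
    apply simp
    done
  then show ?case by (simp add: Q_def v_def)
next
  case (3 m w)
  then have "fetch m (Ind 17) = vtx (Suc L) m" by (simp add: fetch_def static_def)
  with 3 show ?case by (intro R) (auto simp: Suc_le_eq)
qed (use m in auto)

lemma wp_clique_prog:
  assumes L: "L = cutoff n k + 2"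
    and R: "\<And>m' w. distinct w \<Longrightarrow> set w = {u \<in> {1..n}. accepted u} \<Longrightarrow> R m' w"
  shows "wp clique_prog (\<lambda>_. 0) R"
proof -
  have bd: "n \<le> M" "k \<le> M" using bounds k_le by linarith+
  have rest: "wp (seqs [
     depth_loop,
     Assign (Reg 17) (Add (Reg 11) (Reg 6)),
     Assign (Reg 18) (Add (Reg 11) (Reg 16)),
     Assign (Ind 17) (Load (Reg 1)),
     scan_loop]) m R" if m: "scaling 0 m" "m 5 = n * (shrunk n 0)\<^sup>2 - k\<^sup>2" for m
  proof (rule wp_Cons, rule wp_depth_loop[OF L m])
    fix m1 assume m1: "scaling (cutoff n k) m1"
    note st = m1[unfolded scaling_def, simplified]
    have c: "cutoff n k \<le> L" "cutoff n k = L - 2" "2 \<le> L" using L by auto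
    show "wp (seqs [Assign (Reg 17) (Add (Reg 11) (Reg 6)), Assign (Reg 18) (Add (Reg 11) (Reg 16)),
     Assign (Ind 17) (Load (Reg 1)), scan_loop]) m1 (\<lambda>m'' w'. R m'' ([] @ w'))"
      apply (insert bd bounds c(1,3) L)
      apply (rule wp_assign, simp add: fetch_def st, simp add: fetch_def st, simp, simp add: fetch_def st)+
      apply (rule wp_Cons)
      apply (rule wp_scan_loop)
        apply (unfold static_def, simp add: st power_add)
       apply simp
      apply (rule wp_Nil)
      apply (use R in simp)
      done
  qed
  show ?thesis
    unfolding clique_prog_def
    apply (insert bd bounds)
    apply (rule wp_assign, simp add: fetch_def, simp add: fetch_def, simp, simp add: fetch_def)+
    apply (rule wp_Cons)
    apply (rule wp_compare_scale[where i = 0])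
     apply (simp add: scaling_def)
    apply (rule wp_conseq[OF rest])
      apply assumption
     apply assumption
    apply simp
    done
qed

end

section \<open>Analysis of one filtering step\<close>

definition edges_to :: "nat \<Rightarrow> nat set \<Rightarrow> nat set set" where
  "edges_to v U = (\<lambda>u. {v, u}) ` U"

lemma card_edges_to: "finite U \<Longrightarrow> card (edges_to v U) \<le> card U"
  unfolding edges_to_def by (rule card_image_le)

lemma le_div_imp_le: "x \<le> n div m \<Longrightarrow> x \<le> (n::nat)"
  using div_le_dividend le_trans by blast

lemma inj_on_edges_to: "inj_on (\<lambda>u. {v, u}) U"
  by (auto simp: inj_on_def doubleton_eq_iff)

lemma sign_sum_Int: "sign_sum B (X \<inter> B) = sign_sum B X"
  unfolding sign_sum_def by (intro sum.cong) auto

text \<open>The clique is fixed here, and the only randomness left is the set of other pairs that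
  are present. A typical \<open>K\<close> satisfies \<open>spread\<close>; the exceptional sets are
  counted separately.\<close>

locale planted_graph =
  fixes n k L :: nat and K :: "nat set"
  assumes K_sub: "K \<subseteq> {1..n}" and card_K: "card K = k" and k_pos: "0 < k"
    and spread: "\<And>j. j \<le> L \<Longrightarrow> real k / 2 ^ (j + 4) \<le> card (K \<inter> block n j)"
begin

definition free_pairs :: "nat set set" where
  "free_pairs = nsets {1..n} 2 - nsets K 2"

definition adj :: "nat set set \<Rightarrow> nat \<Rightarrow> nat \<Rightarrow> nat" where
  "adj X = adj_matrix n (nsets K 2 \<union> X)"

definition survivors :: "nat set set \<Rightarrow> nat \<Rightarrow> nat set" where
  "survivors X j = level (adj X) n k j"

definition upper :: "nat \<Rightarrow> nat set" where
  "upper j = {n div 2 ^ Suc j<..n}"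

text \<open>A quarter of the clique part that \<open>spread\<close> guarantees in block
  \<open>j\<close>. Half of this part is \<open>2 * thr j\<close>, which is what the filter
  maintains.\<close>

definition thr :: "nat \<Rightarrow> real" where
  "thr j = real k / (64 * 2 ^ j)"

definition passes :: "nat \<Rightarrow> nat set \<Rightarrow> nat \<Rightarrow> nat set set \<Rightarrow> bool" where
  "passes j U v X \<longleftrightarrow> thr j \<le> real_of_int (advantage (adj X) U v)"

lemma finite_K: "finite K"
  using K_sub by (rule finite_subset) simp

lemma finite_free_pairs: "finite free_pairs"
  by (simp add: free_pairs_def finite_imp_finite_nsets)

lemma thr_pos: "0 < thr j"
  using k_pos by (simp add: thr_def)

lemma thr_le: "thr j \<le> k"
proof -
  have "real k \<le> real k * (64 * 2 ^ j)"
  proof -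
    have "1 \<le> 64 * (2::real) ^ j" using one_le_power[of "2 :: real" j] by linarith
    then show ?thesis by (simp add: mult_le_cancel_left1)
  qed
  then show ?thesis by (simp add: thr_def divide_le_eq)
qed

lemma passes_iff: "int k \<le> 64 * 2 ^ j * advantage (adj X) U v \<longleftrightarrow> passes j U v X"
proof -
  have "int k \<le> 64 * 2 ^ j * advantage (adj X) U v \<longleftrightarrow> real k \<le> 64 * 2 ^ j * real_of_int (advantage (adj X) U v)"
    by (metis (mono_tags, opaque_lifting) of_int_le_iff of_int_mult of_int_numeral of_int_of_nat_eq of_int_power)
  then show ?thesis by (simp add: passes_def thr_def divide_le_eq mult.commute)
qed

lemma survivors_0: "survivors X 0 = block n 0"
  and survivors_Suc: "survivors X (Suc j) = {v \<in> block n (Suc j). passes j (survivors X j) v X}"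
  by (simp_all add: survivors_def passes_iff)

lemma survivors_subset: "survivors X j \<subseteq> block n j"
  unfolding survivors_def by (rule level_subset_block)

lemma block_subset: "block n j \<subseteq> {1..n}"
  by (auto simp: block_def dest: le_div_imp_le)

lemma block_subset_upper: "block n j \<subseteq> upper j"
  by (auto simp: block_def upper_def dest: le_div_imp_le)

lemma upper_Suc: "upper (Suc j) = upper j \<union> block n (Suc j)"
proof -
  have "n div 2 ^ Suc (Suc j) \<le> n div 2 ^ Suc j" by (intro div_le_mono2) auto
  then show ?thesis unfolding upper_def block_def by (auto dest: le_div_imp_le)
qed

lemma upper_block_disjoint: "upper j \<inter> block n (Suc j) = {}"
  by (auto simp: upper_def block_def)

lemma adj_eq:
  assumes "v \<in> {1..n}" "u \<in> {1..n}"
  shows "adj X v u = of_bool ({v, u} \<in> nsets K 2 \<or> {v, u} \<in> X)"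
  using assms by (simp add: adj_def adj_matrix_def)

text \<open>The survivors of block \<open>j\<close> are determined by pairs inside
  \<open>upper j\<close>. Hence the edges between them and block \<open>Suc j\<close> are still
  unrevealed when they are used.\<close>

lemma survivors_cong:
  assumes "X \<inter> nsets (upper j) 2 = X' \<inter> nsets (upper j) 2"
  shows "survivors X j = survivors X' j"
  using assms
proof (induction j)
  case (Suc j)
  have sub: "nsets (upper j) 2 \<subseteq> nsets (upper (Suc j)) 2"
    by (rule nsets_mono) (simp add: upper_Suc)
  have IH: "survivors X j = survivors X' j"
    by (rule Suc.IH) (use Suc.prems sub in blast)
  have "advantage (adj X) (survivors X j) v = advantage (adj X') (survivors X j) v" if v: "v \<in> block n (Suc j)" for v
    unfolding advantage_def
  proof (intro sum.cong refl)
    fix u assume "u \<in> survivors X j"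
    then have u: "u \<in> block n j" using survivors_subset by blast
    then have "v \<noteq> u" using v upper_block_disjoint[of j] block_subset_upper[of j] by blast
    then have "{v, u} \<in> nsets (upper (Suc j)) 2"
      using u v block_subset_upper[of j] by (auto simp: upper_Suc)
    then have "{v, u} \<in> X \<longleftrightarrow> {v, u} \<in> X'" using Suc.prems by blast
    moreover have "v \<in> {1..n}" "u \<in> {1..n}" using u v block_subset by blast+
    ultimately show "2 * int (adj X v u) - 1 = 2 * int (adj X' v u) - 1" by (simp add: adj_eq)
  qed
  then show ?case by (auto simp: survivors_Suc IH passes_def)
qed (simp add: survivors_0)

section \<open>The advantage as a sum of random signs\<close>

lemma advantage_non_clique:
  assumes "v \<in> {1..n}" "v \<notin> K" "U \<subseteq> {1..n}"
  shows "real_of_int (advantage (adj X) U v) = sign_sum (edges_to v U) X"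
proof -
  have "real_of_int (2 * int (adj X v u) - 1) = (if {v, u} \<in> X then 1 else -1)" if "u \<in> U" for u
  proof -
    have "{v, u} \<notin> nsets K 2" using assms(2) by (simp add: nsets_def)
    moreover have "u \<in> {1..n}" using that assms(3) by blast
    ultimately show ?thesis using adj_eq[OF assms(1), of u X] by simp
  qed
  then have "real_of_int (advantage (adj X) U v) = (\<Sum>u\<in>U. if {v, u} \<in> X then 1 else -1)"
    unfolding advantage_def of_int_sum by (intro sum.cong) auto
  then show ?thesis
    unfolding sign_sum_def edges_to_def by (simp add: sum.reindex[OF inj_on_edges_to])
qed

text \<open>Edges inside the clique are certain and give the drift
  \<open>card (U \<inter> K)\<close>; the remaining signs are fair.\<close>

lemma advantage_clique:
  assumes "v \<in> K" "v \<notin> U" "U \<subseteq> {1..n}"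
  shows "real_of_int (advantage (adj X) U v) = card (U \<inter> K) + sign_sum (edges_to v (U - K)) X"
proof -
  have fin: "finite U" using assms(3) by (rule finite_subset) simp
  have v: "v \<in> {1..n}" using assms(1) K_sub by blast
  have 1: "real_of_int (2 * int (adj X v u) - 1) = 1" if "u \<in> U \<inter> K" for u
  proof -
    have "{v, u} \<in> nsets K 2" using that assms by auto
    then show ?thesis using adj_eq[OF v, of u X] that assms(3) by auto
  qed
  have 2: "real_of_int (2 * int (adj X v u) - 1) = (if {v, u} \<in> X then 1 else -1)" if "u \<in> U - K" for u
  proof -
    have "{v, u} \<notin> nsets K 2" using that by auto
    then show ?thesis using adj_eq[OF v, of u X] that assms(3) by auto
  qed
  have "real_of_int (advantage (adj X) U v)
     = (\<Sum>u\<in>U \<inter> K. real_of_int (2 * int (adj X v u) - 1)) + (\<Sum>u\<in>U - K. real_of_int (2 * int (adj X v u) - 1))"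
    unfolding advantage_def of_int_sum using fin
    by (metis (no_types, lifting) Int_Diff_Un Int_Diff_disjoint finite_Diff finite_Int sum.union_disjoint)
  also have "\<dots> = card (U \<inter> K) + (\<Sum>u\<in>U - K. if {v, u} \<in> X then 1 else (-1 :: real))"
    using 1 2 by simp
  finally show ?thesis
    unfolding sign_sum_def edges_to_def by (simp add: sum.reindex[OF inj_on_edges_to])
qed

text \<open>Clique vertices rejected and other vertices accepted obey the same tail bound, so the
  two errors are treated as one.\<close>

definition misjudged :: "nat \<Rightarrow> nat set \<Rightarrow> nat \<Rightarrow> nat set set \<Rightarrow> bool" where
  "misjudged j U v X \<longleftrightarrow> (passes j U v X \<longleftrightarrow> v \<notin> K)"

definition random_edges :: "nat \<Rightarrow> nat set \<Rightarrow> nat set set" where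
  "random_edges v U = edges_to v (if v \<in> K then U - K else U)"

lemma misjudged_Int:
  assumes "v \<in> {1..n}" "v \<notin> U" "U \<subseteq> {1..n}"
  shows "misjudged j U v (X \<inter> random_edges v U) \<longleftrightarrow> misjudged j U v X"
  using assms advantage_clique[of v U] advantage_non_clique[of v U]
  by (cases "v \<in> K") (auto simp: misjudged_def passes_def random_edges_def sign_sum_Int)

text \<open>Outside the clique the mean is 0 and the sum has to rise by \<open>thr j\<close>;
  inside, the drift is at least \<open>2 * thr j\<close> and the sum has to fall by
  \<open>thr j\<close>. The bound \<open>k \<le> M\<close> brings the threshold into the range of
  the Chernoff bound.\<close>

lemma prob_misjudged:
  fixes M :: real
  assumes v: "v \<in> {1..n}" "v \<notin> U" and U: "U \<subseteq> {1..n}" and a: "2 * thr j \<le> card (U \<inter> K)"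
    and M: "card U \<le> M" "k \<le> M"
  shows "subset_prob (random_edges v U) (misjudged j U v) \<le> exp (- ((thr j)\<^sup>2 / (4 * M)))"
proof -
  have fin: "finite U" using U by (rule finite_subset) simp
  have finr: "finite (random_edges v U)" using fin by (simp add: random_edges_def edges_to_def)
  have "card (random_edges v U) \<le> card U"
    unfolding random_edges_def using fin card_edges_to[of "U - K" v] card_edges_to[of U v] card_Diff_subset_Int[of U K]
    by (auto intro: order_trans[OF card_edges_to] card_mono)
  then have cardr: "card (random_edges v U) \<le> M" using M(1) by linarith
  have M0: "0 < M" "thr j \<le> 2 * M" using M thr_le[of j] k_pos by linarith+
  have mono: "subset_prob (random_edges v U) (misjudged j U v)
      \<le> subset_prob (random_edges v U) (\<lambda>X. thr j \<le> (if v \<in> K then -1 else 1) * sign_sum (random_edges v U) X)"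
  proof (rule subset_prob_mono)
    fix X assume "misjudged j U v X"
    then show "thr j \<le> (if v \<in> K then -1 else 1) * sign_sum (random_edges v U) X"
      using v U a advantage_clique[of v U X] advantage_non_clique[of v U X]
      by (auto simp: misjudged_def passes_def random_edges_def)
  qed
  also have "\<dots> \<le> exp (- ((thr j)\<^sup>2 / (4 * M)))"
    using finr cardr M0 thr_pos[of j] by (intro subset_prob_sign_sum_tail) auto
  finally show ?thesis .
qed

lemma random_edges_subset:
  assumes "v \<in> {1..n}" "v \<notin> U" "U \<subseteq> {1..n}"
  shows "random_edges v U \<subseteq> free_pairs"
  using assms by (auto simp: random_edges_def edges_to_def free_pairs_def split: if_splits)

lemma fresh_edges:
  assumes "v \<in> block n (Suc j)" "U \<subseteq> block n j"
  shows "v \<in> {1..n}" "v \<notin> U" "U \<subseteq> {1..n}" "random_edges v U \<subseteq> free_pairs - nsets (upper j) 2"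
proof -
  have d: "v \<notin> upper j" using assms(1) upper_block_disjoint by blast
  show v: "v \<in> {1..n}" "v \<notin> U" "U \<subseteq> {1..n}"
    using assms block_subset block_subset_upper[of j] d by blast+
  have "random_edges v U \<inter> nsets (upper j) 2 = {}"
    using d by (auto simp: random_edges_def edges_to_def)
  then show "random_edges v U \<subseteq> free_pairs - nsets (upper j) 2"
    using random_edges_subset[OF v] by blast
qed

lemma disjoint_random_edges:
  assumes "U \<subseteq> block n j"
  shows "disjoint_family_on (\<lambda>v. random_edges v U) (block n (Suc j))"
  unfolding disjoint_family_on_def
proof (intro ballI impI)
  fix v w assume vw: "v \<in> block n (Suc j)" "w \<in> block n (Suc j)" "v \<noteq> w"
  then have "v \<notin> U" "w \<notin> U" using fresh_edges(2) assms by blast+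
  then show "random_edges v U \<inter> random_edges w U = {}"
    using vw by (auto simp: random_edges_def edges_to_def doubleton_eq_iff split: if_splits)
qed

text \<open>Revealing the pairs inside \<open>upper j\<close> fixes the survivors \<open>U\<close>;
  the verdicts on the next block then depend on the remaining pairs only. So it suffices to bound
  the errors for each fixed \<open>U\<close> that satisfies \<open>G\<close>.\<close>

lemma prob_step:
  assumes step: "\<And>U. U \<subseteq> block n j \<Longrightarrow> G U \<Longrightarrow>
      subset_prob (free_pairs - nsets (upper j) 2) (\<lambda>Y. B {v \<in> block n (Suc j). misjudged j U v Y}) \<le> p"
    and p: "0 \<le> p"
  shows "subset_prob free_pairs (\<lambda>X. G (survivors X j) \<and>
    B {v \<in> block n (Suc j). misjudged j (survivors X j) v X}) \<le> p"
proof -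
  let ?D1 = "free_pairs \<inter> nsets (upper j) 2" and ?D2 = "free_pairs - nsets (upper j) 2"
  have D: "free_pairs = ?D1 \<union> ?D2" by blast
  have "subset_prob (?D1 \<union> ?D2) (\<lambda>X. G (survivors X j) \<and>
    B {v \<in> block n (Suc j). misjudged j (survivors X j) v X}) \<le> p"
  proof (rule subset_prob_condition)
    fix X assume X: "X \<subseteq> ?D1"
    let ?U = "survivors X j"
    have U: "?U \<subseteq> block n j" by (rule survivors_subset)
    have eq: "survivors (X \<union> Y) j = ?U" if "Y \<subseteq> ?D2" for Y
      by (rule survivors_cong) (use that in blast)
    have mis: "misjudged j ?U v (X \<union> Y) \<longleftrightarrow> misjudged j ?U v Y" if "Y \<subseteq> ?D2" "v \<in> block n (Suc j)" for Y v
    proof -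
      note f = fresh_edges[OF that(2) U]
      have "(X \<union> Y) \<inter> random_edges v ?U = Y \<inter> random_edges v ?U" using f(4) X by blast
      then show ?thesis using misjudged_Int[OF f(1-3)] by metis
    qed
    show "subset_prob ?D2 (\<lambda>Y. G (survivors (X \<union> Y) j) \<and>
      B {v \<in> block n (Suc j). misjudged j (survivors (X \<union> Y) j) v (X \<union> Y)}) \<le> p"
    proof (cases "G ?U")
      case True
      have "subset_prob ?D2 (\<lambda>Y. G (survivors (X \<union> Y) j) \<and>
          B {v \<in> block n (Suc j). misjudged j (survivors (X \<union> Y) j) v (X \<union> Y)})
        \<le> subset_prob ?D2 (\<lambda>Y. B {v \<in> block n (Suc j). misjudged j ?U v Y})"
      proof (rule subset_prob_mono)
        fix Y assume Y: "Y \<subseteq> ?D2" "G (survivors (X \<union> Y) j) \<and>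
          B {v \<in> block n (Suc j). misjudged j (survivors (X \<union> Y) j) v (X \<union> Y)}"
        have "{v \<in> block n (Suc j). misjudged j (survivors (X \<union> Y) j) v (X \<union> Y)} = {v \<in> block n (Suc j). misjudged j ?U v Y}"
          using eq[OF Y(1)] mis[OF Y(1)] by auto
        then show "B {v \<in> block n (Suc j). misjudged j ?U v Y}" using Y(2) by simp
      qed
      also have "\<dots> \<le> p" by (rule step[OF U True])
      finally show ?thesis .
    next
      case False
      have "subset_prob ?D2 (\<lambda>Y. G (survivors (X \<union> Y) j) \<and>
          B {v \<in> block n (Suc j). misjudged j (survivors (X \<union> Y) j) v (X \<union> Y)}) \<le> subset_prob ?D2 (\<lambda>_. False)"
        by (rule subset_prob_mono) (use eq False in auto)
      then show ?thesis using p finite_free_pairs by simp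
    qed
  qed (use finite_free_pairs in auto)
  then show ?thesis using D by simp
qed

section \<open>Induction along the levels\<close>

definition tail_prob :: "(nat \<Rightarrow> real) \<Rightarrow> nat \<Rightarrow> real" where
  "tail_prob b j = exp (- ((thr j)\<^sup>2 / (4 * (real k + b j))))"

text \<open>The invariant of the filter: enough clique vertices for the next test, and few enough
  others. The budget \<open>b\<close> stays abstract until the schedule is chosen.\<close>

definition good :: "(nat \<Rightarrow> real) \<Rightarrow> nat \<Rightarrow> nat set \<Rightarrow> bool" where
  "good b j U \<longleftrightarrow> 2 * thr j \<le> card (U \<inter> K) \<and> real (card (U - K)) \<le> b j"

lemma prob_misjudged_good:
  assumes "v \<in> block n (Suc j)" "U \<subseteq> block n j" "good b j U"
  shows "subset_prob (random_edges v U) (misjudged j U v) \<le> tail_prob b j"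
  unfolding tail_prob_def
proof (rule prob_misjudged)
  have "finite U" using assms(2) by (rule finite_subset) simp
  then have "card U = card (U \<inter> K) + card (U - K)"
    by (metis Int_Diff_Un Int_Diff_disjoint card_Un_disjoint finite_Diff finite_Int)
  moreover have "card (U \<inter> K) \<le> k"
    using card_mono[OF finite_K, of "U \<inter> K"] card_K by simp
  ultimately show "real (card U) \<le> real k + b j" using assms(3) by (simp add: good_def)
  show "real k \<le> real k + b j" using assms(3) unfolding good_def by (smt (verit) of_nat_0_le_iff)
qed (use assms fresh_edges[OF assms(1,2)] in \<open>auto simp: good_def\<close>)

lemma block_misjudged_count:
  assumes "W \<subseteq> block n (Suc j)" "U \<subseteq> block n j" "good b j U"
  shows "subset_prob (free_pairs - nsets (upper j) 2)
    (\<lambda>Y. 2 * tail_prob b j * card W + t \<le> card {v \<in> W. misjudged j U v Y}) \<le> exp (- t)"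
proof -
  have "subset_prob (free_pairs - nsets (upper j) 2)
    (\<lambda>Y. 2 * tail_prob b j * card W + t \<le> card {v \<in> W. misjudged j U v (Y \<inter> random_edges v U)}) \<le> exp (- t)"
  proof (rule subset_prob_count_tail)
    show "finite W" using assms(1) by (rule finite_subset) simp
    show "disjoint_family_on (\<lambda>v. random_edges v U) W"
      using disjoint_random_edges[OF assms(2)] assms(1) by (rule disjoint_family_on_mono[rotated])
    show "random_edges v U \<subseteq> free_pairs - nsets (upper j) 2" if "v \<in> W" for v
      using that assms(1) by (intro fresh_edges(4)[OF _ assms(2)]) auto
    show "subset_prob (random_edges v U) (misjudged j U v) \<le> tail_prob b j" if "v \<in> W" for v
      using that assms by (intro prob_misjudged_good) auto
  qed (use finite_free_pairs in simp)
  moreover have "{v \<in> W. misjudged j U v (Y \<inter> random_edges v U)} = {v \<in> W. misjudged j U v Y}" for Y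
  proof -
    have "misjudged j U v (Y \<inter> random_edges v U) \<longleftrightarrow> misjudged j U v Y" if "v \<in> W" for v
      using that assms(1) by (intro misjudged_Int fresh_edges(1-3)[OF _ assms(2)]) auto
    then show ?thesis by auto
  qed
  ultimately show ?thesis by simp
qed

text \<open>With error probability at most 1/8, the clique part of the block loses less than a
  quarter of itself plus \<open>H\<close>. As \<open>H\<close> is at most a quarter of the
  guaranteed \<open>k / 2 ^ (j + 5)\<close>, half of the guarantee is left, which is
  \<open>2 * thr (Suc j)\<close>.\<close>

lemma good_step:
  assumes j: "Suc j \<le> L" and p: "tail_prob b j \<le> 1 / 8"
    and H: "H \<le> real k / 2 ^ (j + 7)" and b: "2 * tail_prob b j * n + H \<le> b (Suc j)"
  shows "subset_prob free_pairs (\<lambda>X. good b j (survivors X j) \<and> \<not> good b (Suc j) (survivors X (Suc j)))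
    \<le> 2 * exp (- H)"
proof -
  let ?W = "block n (Suc j)"
  let ?q = "tail_prob b j"
  \<comment> \<open>\<open>V\<close> stands for the misjudged vertices of the block. Split along
    \<open>K\<close>, they are the clique vertices lost and the other vertices kept.\<close>
  let ?B = "\<lambda>V. 2 * ?q * card (?W \<inter> K) + H \<le> card {v \<in> ?W \<inter> K. v \<in> V} \<or>
    2 * ?q * card (?W - K) + H \<le> card {v \<in> ?W - K. v \<in> V}"
  have q0: "0 \<le> ?q" by (simp add: tail_prob_def)
  have "subset_prob free_pairs (\<lambda>X. good b j (survivors X j) \<and> \<not> good b (Suc j) (survivors X (Suc j)))
     \<le> subset_prob free_pairs (\<lambda>X. good b j (survivors X j) \<and>
        ?B {v \<in> ?W. misjudged j (survivors X j) v X})"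
  proof (rule subset_prob_mono)
    fix X assume X: "good b j (survivors X j) \<and> \<not> good b (Suc j) (survivors X (Suc j))"
    let ?V = "{v \<in> ?W. misjudged j (survivors X j) v X}"
    have V1: "{v \<in> ?W \<inter> K. v \<in> ?V} = (?W \<inter> K) - (survivors X (Suc j) \<inter> K)"
      and V2: "{v \<in> ?W - K. v \<in> ?V} = survivors X (Suc j) - K"
      by (auto simp: survivors_Suc misjudged_def)
    have c1: "real (card {v \<in> ?W \<inter> K. v \<in> ?V}) = card (?W \<inter> K) - real (card (survivors X (Suc j) \<inter> K))"
    proof -
      have sub: "survivors X (Suc j) \<inter> K \<subseteq> ?W \<inter> K" using survivors_subset by blast
      have "card (survivors X (Suc j) \<inter> K) \<le> card (?W \<inter> K)"
        by (rule card_mono[OF _ sub]) (use finite_K in simp)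
      moreover have "card ((?W \<inter> K) - (survivors X (Suc j) \<inter> K)) = card (?W \<inter> K) - card (survivors X (Suc j) \<inter> K)"
        by (rule card_Diff_subset[OF _ sub]) (use finite_K in simp)
      ultimately show ?thesis unfolding V1 by linarith
    qed
    have "?B ?V"
    proof (rule ccontr)
      assume nb: "\<not> ?B ?V"
      then have n1: "card (?W \<inter> K) - real (card (survivors X (Suc j) \<inter> K)) < 2 * ?q * card (?W \<inter> K) + H"
        and n2: "card (survivors X (Suc j) - K) < 2 * ?q * card (?W - K) + H"
        using c1 V2 by auto
      have "?q * card (?W \<inter> K) \<le> 1 / 8 * card (?W \<inter> K)" using p by (intro mult_right_mono) auto
      moreover have sp: "real k / 2 ^ (Suc j + 4) \<le> card (?W \<inter> K)"
        using spread[OF j] by (simp add: Int_commute)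
      moreover have "2 * thr (Suc j) = real k / 2 ^ (Suc j + 4) / 2" "real k / 2 ^ (j + 7) = real k / 2 ^ (Suc j + 4) / 4"
        by (simp_all add: thr_def power_add field_simps)
      ultimately have "2 * thr (Suc j) \<le> card (survivors X (Suc j) \<inter> K)"
        using n1 H by linarith
      moreover have "real (card (survivors X (Suc j) - K)) \<le> b (Suc j)"
      proof -
        have "card (?W - K) \<le> card {1..n}" using block_subset by (intro card_mono) auto
        then have "?q * card (?W - K) \<le> ?q * n" using q0 by (intro mult_left_mono) auto
        then show ?thesis using n2 b by linarith
      qed
      ultimately show False using X by (simp add: good_def)
    qed
    then show "good b j (survivors X j) \<and> ?B ?V" using X by blast
  qed
  also have "\<dots> \<le> 2 * exp (- H)"
  proof (rule prob_step)
    fix U assume U: "U \<subseteq> block n j" "good b j U"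
    let ?D = "free_pairs - nsets (upper j) 2"
    have eq: "{v \<in> ?W \<inter> K. v \<in> {v \<in> ?W. misjudged j U v Y}} = {v \<in> ?W \<inter> K. misjudged j U v Y}"
      "{v \<in> ?W - K. v \<in> {v \<in> ?W. misjudged j U v Y}} = {v \<in> ?W - K. misjudged j U v Y}" for Y by auto
    have "subset_prob ?D (\<lambda>Y. ?B {v \<in> ?W. misjudged j U v Y}) \<le>
      subset_prob ?D (\<lambda>Y. 2 * ?q * card (?W \<inter> K) + H \<le> card {v \<in> ?W \<inter> K. misjudged j U v Y})
      + subset_prob ?D (\<lambda>Y. 2 * ?q * card (?W - K) + H \<le> card {v \<in> ?W - K. misjudged j U v Y})"
      unfolding eq by (rule subset_prob_disj)
    also have "\<dots> \<le> exp (- H) + exp (- H)"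
      by (intro add_mono block_misjudged_count U) auto
    finally show "subset_prob ?D (\<lambda>Y. ?B {v \<in> ?W. misjudged j U v Y}) \<le> 2 * exp (- H)" by simp
  qed simp
  finally show ?thesis .
qed

text \<open>A plain union bound over one block, useful once \<open>tail_prob\<close> is far below
  1/n. It makes the last survivor set equal to a set fixed by \<open>K\<close>.\<close>

lemma good_last:
  shows "subset_prob free_pairs (\<lambda>X. good b j (survivors X j) \<and> survivors X (Suc j) \<noteq> K \<inter> block n (Suc j))
    \<le> n * tail_prob b j"
proof -
  let ?W = "block n (Suc j)"
  have "subset_prob free_pairs (\<lambda>X. good b j (survivors X j) \<and> survivors X (Suc j) \<noteq> K \<inter> ?W)
     \<le> subset_prob free_pairs (\<lambda>X. good b j (survivors X j) \<and> {v \<in> ?W. misjudged j (survivors X j) v X} \<noteq> {})"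
    by (rule subset_prob_mono) (auto simp: survivors_Suc misjudged_def)
  also have "\<dots> \<le> n * tail_prob b j"
  proof (rule prob_step)
    fix U assume U: "U \<subseteq> block n j" "good b j U"
    let ?D = "free_pairs - nsets (upper j) 2"
    have "subset_prob ?D (\<lambda>Y. {v \<in> ?W. misjudged j U v Y} \<noteq> {}) = subset_prob ?D (\<lambda>Y. \<exists>v\<in>?W. misjudged j U v Y)"
      by (intro arg_cong[of _ _ "subset_prob ?D"]) auto
    also have "\<dots> \<le> card ?W * tail_prob b j"
    proof (rule subset_prob_Bex)
      fix v assume v: "v \<in> ?W"
      note f = fresh_edges[OF v U(1)]
      have "subset_prob ?D (misjudged j U v) = subset_prob ?D (\<lambda>Y. misjudged j U v (Y \<inter> random_edges v U))"
        using misjudged_Int[OF f(1-3)] by simp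
      also have "\<dots> = subset_prob (random_edges v U) (misjudged j U v)"
        unfolding subset_prob_def using finite_free_pairs f(4) by (intro subset_mean_restrict) auto
      also have "\<dots> \<le> tail_prob b j" by (rule prob_misjudged_good[OF v U])
      finally show "subset_prob ?D (misjudged j U v) \<le> tail_prob b j" .
    qed (use finite_free_pairs in auto)
    also have "\<dots> \<le> n * tail_prob b j"
    proof (intro mult_right_mono)
      show "real (card ?W) \<le> n" using card_mono[OF _ block_subset[of "Suc j"]] by simp
    qed (simp add: tail_prob_def)
    finally show "subset_prob ?D (\<lambda>Y. {v \<in> ?W. misjudged j U v Y} \<noteq> {}) \<le> n * tail_prob b j" .
  qed (simp add: tail_prob_def)
  finally show ?thesis .
qed

text \<open>
  For the last comparison the reference set is the deterministic set \<open>K \<inter> block n L\<close>, so that no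
  independence from the earlier levels is needed.
\<close>

lemma prob_final:
  assumes "real k / 2 ^ (L + 6) + 2 \<le> real k / 2 ^ (L + 4)"
  shows "subset_prob free_pairs (\<lambda>X. {u \<in> {1..n}. passes L (K \<inter> block n L) u X} \<noteq> K)
    \<le> n * exp (- ((thr L)\<^sup>2 / (4 * real k)))"
proof -
  let ?T = "K \<inter> block n L"
  have T: "?T \<subseteq> {1..n}" "finite ?T" using K_sub finite_K by auto
  have spL: "real k / 2 ^ (L + 4) \<le> card ?T" by (rule spread) simp
  have thrL: "thr L = real k / 2 ^ (L + 6)" by (simp add: thr_def power_add)
  have pass_K: "passes L ?T v X" if v: "v \<in> K" for v X
  proof -
    have vn: "v \<in> {1..n}" using v K_sub by blast
    \<comment> \<open>The vertex \<open>v\<close> may itself lie in the reference set, where its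
      zero diagonal entry counts as a non-neighbour. This is the 2 in the assumption.\<close>
    have "(if u = v then -1 else 1) \<le> 2 * int (adj X v u) - 1" if u: "u \<in> ?T" for u
    proof (cases "u = v")
      case False
      then have "{v, u} \<in> nsets K 2" using u v by auto
      moreover have "u \<in> {1..n}" using u T by blast
      ultimately show ?thesis using False adj_eq[OF vn, of u X] by simp
    qed simp
    then have "(\<Sum>u\<in>?T. if u = v then -1 else 1) \<le> advantage (adj X) ?T v"
      unfolding advantage_def by (intro sum_mono) auto
    moreover have "int (card ?T) - 2 \<le> (\<Sum>u\<in>?T. if u = v then -1 else 1)"
    proof -
      have "(\<Sum>u\<in>?T. if u = v then -1 else 1 :: int) = (\<Sum>u\<in>?T. 1 - (if u = v then 2 else 0))"
        by (intro sum.cong) auto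
      also have "\<dots> = int (card ?T) - (if v \<in> ?T then 2 else 0)"
        using T(2) by (simp add: sum_subtractf)
      finally show ?thesis by (simp split: if_splits)
    qed
    ultimately have "real (card ?T) - 2 \<le> advantage (adj X) ?T v" by linarith
    then show ?thesis unfolding passes_def thrL using spL assms by linarith
  qed
  have "subset_prob free_pairs (\<lambda>X. {u \<in> {1..n}. passes L ?T u X} \<noteq> K)
    \<le> subset_prob free_pairs (\<lambda>X. \<exists>v\<in>{1..n} - K. misjudged L ?T v X)"
    by (rule subset_prob_mono) (use pass_K K_sub in \<open>auto simp: misjudged_def\<close>)
  also have "\<dots> \<le> card ({1..n} - K) * exp (- ((thr L)\<^sup>2 / (4 * real k)))"
  proof (rule subset_prob_Bex)
    fix v assume v: "v \<in> {1..n} - K"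
    then have f: "v \<in> {1..n}" "v \<notin> ?T" by auto
    have "subset_prob free_pairs (misjudged L ?T v) = subset_prob free_pairs (\<lambda>Y. misjudged L ?T v (Y \<inter> random_edges v ?T))"
      using misjudged_Int[OF f T(1)] by simp
    also have "\<dots> = subset_prob (random_edges v ?T) (misjudged L ?T v)"
      unfolding subset_prob_def using finite_free_pairs random_edges_subset[OF f T(1)] by (intro subset_mean_restrict) auto
    also have "\<dots> \<le> exp (- ((thr L)\<^sup>2 / (4 * real k)))"
    proof (rule prob_misjudged[OF f T(1)])
      have "2 * thr L = real k / 2 ^ (L + 4) / 2" by (simp add: thrL power_add)
      moreover have "?T \<inter> K = ?T" by blast
      moreover have "0 \<le> real k / 2 ^ (L + 4)" by simp
      ultimately show "2 * thr L \<le> card (?T \<inter> K)" using spL by simp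
      show "real (card ?T) \<le> k" using card_mono[OF finite_K, of ?T] card_K by simp
    qed simp
    finally show "subset_prob free_pairs (misjudged L ?T v) \<le> exp (- ((thr L)\<^sup>2 / (4 * real k)))" .
  qed (use finite_free_pairs in auto)
  also have "\<dots> \<le> n * exp (- ((thr L)\<^sup>2 / (4 * real k)))"
  proof (intro mult_right_mono)
    have "card ({1..n} - K) \<le> card {1..n}" by (rule card_mono) auto
    then show "real (card ({1..n} - K)) \<le> n" by simp
  qed simp
  finally show ?thesis .
qed

text \<open>The failure consists of \<open>l\<close> filtering steps at \<open>2 * exp (- H)\<close>
  each, the exact last step at \<open>2 * n * exp (- H)\<close> and the final comparison at
  \<open>n * exp (- H)\<close>.\<close>

lemma recovery_fails:
  assumes L: "L = Suc l" and b0: "real n \<le> b 0"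
    and p: "\<And>j. j < l \<Longrightarrow> tail_prob b j \<le> 1 / 8"
    and b: "\<And>j. j < l \<Longrightarrow> 2 * tail_prob b j * n + H \<le> b (Suc j)"
    and H: "H \<le> real k / 2 ^ (L + 7)"
    and last: "tail_prob b l \<le> 2 * exp (- H)"
    and final: "H \<le> (thr L)\<^sup>2 / (4 * real k)" "real k / 2 ^ (L + 6) + 2 \<le> real k / 2 ^ (L + 4)"
  shows "subset_prob free_pairs (\<lambda>X. {u \<in> {1..n}. int k \<le> 64 * 2 ^ L * advantage (adj X) (survivors X L) u} \<noteq> K)
    \<le> (2 * l + 3 * n) * exp (- H)"
proof -
  let ?G = "\<lambda>j X. good b j (survivors X j)"
  have G: "subset_prob free_pairs (\<lambda>X. \<not> ?G j X) \<le> 2 * j * exp (- H)" if "j \<le> l" for j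
    using that
  proof (induction j)
    case 0
    have "?G 0 X" for X
    proof -
      have "2 * thr 0 \<le> real k / 2 ^ (0 + 4)" by (simp add: thr_def)
      also have "\<dots> \<le> card (block n 0 \<inter> K)" using spread[of 0] by (simp add: Int_commute)
      finally have "2 * thr 0 \<le> card (block n 0 \<inter> K)" .
      moreover have "card (block n 0 - K) \<le> card {1..n}" using block_subset by (intro card_mono) auto
      ultimately show ?thesis using b0 by (simp add: good_def survivors_0)
    qed
    then show ?case using finite_free_pairs by simp
  next
    case (Suc j)
    have "H \<le> real k / 2 ^ (j + 7)"
    proof -
      have "real k / 2 ^ (L + 7) \<le> real k / 2 ^ (j + 7)"
        using Suc.prems L by (intro divide_left_mono power_increasing) auto
      then show ?thesis using H by linarith
    qed
    then have "subset_prob free_pairs (\<lambda>X. ?G j X \<and> \<not> ?G (Suc j) X) \<le> 2 * exp (- H)"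
      using Suc.prems L by (intro good_step p b) auto
    moreover have "subset_prob free_pairs (\<lambda>X. \<not> ?G (Suc j) X) \<le>
      subset_prob free_pairs (\<lambda>X. \<not> ?G j X \<or> (?G j X \<and> \<not> ?G (Suc j) X))"
      by (rule subset_prob_mono) auto
    moreover note subset_prob_disj[of free_pairs "\<lambda>X. \<not> ?G j X" "\<lambda>X. ?G j X \<and> \<not> ?G (Suc j) X"]
    moreover have "subset_prob free_pairs (\<lambda>X. \<not> ?G j X) \<le> 2 * j * exp (- H)" using Suc by simp
    ultimately show ?case by (simp add: algebra_simps)
  qed
  let ?S = "\<lambda>X. ?G l X \<and> survivors X L \<noteq> K \<inter> block n L"
  let ?F = "\<lambda>X. {u \<in> {1..n}. passes L (K \<inter> block n L) u X} \<noteq> K"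
  have "subset_prob free_pairs ?S \<le> n * tail_prob b l"
    unfolding L by (rule good_last)
  also have "\<dots> \<le> n * (2 * exp (- H))" using last by (intro mult_left_mono) auto
  finally have S: "subset_prob free_pairs ?S \<le> 2 * n * exp (- H)" by simp
  have "subset_prob free_pairs ?F \<le> n * exp (- ((thr L)\<^sup>2 / (4 * real k)))"
    by (rule prob_final[OF final(2)])
  also have "\<dots> \<le> n * exp (- H)" using final(1) by (intro mult_left_mono) auto
  finally have F: "subset_prob free_pairs ?F \<le> n * exp (- H)" .
  have "subset_prob free_pairs (\<lambda>X. {u \<in> {1..n}. int k \<le> 64 * 2 ^ L * advantage (adj X) (survivors X L) u} \<noteq> K)
    \<le> subset_prob free_pairs (\<lambda>X. \<not> ?G l X \<or> (?S X \<or> ?F X))"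
    unfolding passes_iff by (rule subset_prob_mono) auto
  also have "\<dots> \<le> subset_prob free_pairs (\<lambda>X. \<not> ?G l X) + (subset_prob free_pairs ?S + subset_prob free_pairs ?F)"
    by (intro order_trans[OF subset_prob_disj] add_left_mono subset_prob_disj)
  also have "\<dots> \<le> 2 * l * exp (- H) + (2 * n * exp (- H) + n * exp (- H))"
    using G[of l] S F by linarith
  finally show ?thesis by (simp add: algebra_simps)
qed

end

section \<open>Iterated logarithms and the number of levels\<close>

lemma log_star_mono: "x \<le> y \<Longrightarrow> log_star x \<le> log_star y"
proof (induction x arbitrary: y rule: log_star.induct)
  case (1 x)
  show ?case
  proof (cases "x \<le> 1")
    case True
    then show ?thesis by (simp add: log_star.simps[of x])
  next
    case False
    then have "log_star (log 2 x) \<le> log_star (log 2 y)"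
      using 1 by (intro "1.IH") auto
    then show ?thesis
      using False 1(2) by (simp add: log_star.simps[of x] log_star.simps[of y])
  qed
qed

lemma log_star_le_Suc_log: "log_star x \<le> Suc (log_star (log 2 x))"
  by (subst log_star.simps) simp

text \<open>Bounds the difference of two \<open>log_star\<close> values by \<open>l\<close> as soon
  as the smaller argument is at least the \<open>l\<close>-fold logarithm of the larger.\<close>

lemma log_star_le_funpow: "log_star x \<le> l + log_star ((log 2 ^^ l) x)"
proof (induction l)
  case (Suc l)
  then show ?case using log_star_le_Suc_log[of "(log 2 ^^ l) x"] by simp
qed simp

lemma floor_log_le_log: "0 < x \<Longrightarrow> real (floor_log x) \<le> log 2 (real x)"
proof -
  assume "0 < x"
  then have "2 ^ floor_log x \<le> x" by (rule floor_log_exp2_le)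
  then have "real (2 ^ floor_log x) \<le> real x" by (simp only: of_nat_le_iff)
  then show ?thesis using \<open>0 < x\<close> by (simp add: le_log_iff powr_realpow)
qed

context
  fixes n k :: nat
  assumes n_pos: "0 < n" and k_ge: "2 * sqrt n \<le> k"
begin

abbreviation "ratio \<equiv> real k / sqrt n"

lemma ratio_ge_2: "2 \<le> ratio"
  using n_pos k_ge by (simp add: pos_le_divide_eq)

lemma scaled_le_iff: "n * x\<^sup>2 \<le> k\<^sup>2 \<longleftrightarrow> real x \<le> ratio"
proof -
  have "n * x\<^sup>2 \<le> k\<^sup>2 \<longleftrightarrow> real (n * x\<^sup>2) \<le> real (k\<^sup>2)" by (simp only: of_nat_le_iff)
  also have "\<dots> \<longleftrightarrow> (sqrt n * x)\<^sup>2 \<le> (real k)\<^sup>2" by (simp add: power_mult_distrib)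
  also have "\<dots> \<longleftrightarrow> sqrt n * x \<le> real k" by (intro power_mono_iff) auto
  also have "\<dots> \<longleftrightarrow> real x \<le> ratio" using n_pos by (simp add: pos_le_divide_eq mult.commute)
  finally show ?thesis .
qed

lemma shrunk_cutoff_le: "real (shrunk n (cutoff n k)) \<le> ratio"
  using cutoff[of n k] scaled_le_iff by blast

lemma ratio_less_shrunk: "i < cutoff n k \<Longrightarrow> ratio < real (shrunk n i)"
  using less_cutoff[of i n k] scaled_le_iff by (meson not_le)

text \<open>Before the cutoff all values exceed 2, so each logarithm lowers \<open>log_star\<close>
  by at least one, and rounding down only helps.\<close>

lemma log_star_shrunk: "i < cutoff n k \<Longrightarrow> i + log_star (shrunk n i) \<le> log_star n"
proof (induction i)
  case (Suc i)
  have gt: "2 < real (shrunk n i)" using ratio_less_shrunk[of i] ratio_ge_2 Suc.prems by linarith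
  have "log_star (shrunk n (Suc i)) \<le> log_star (log 2 (shrunk n i))"
    unfolding shrunk_Suc using gt by (intro log_star_mono floor_log_le_log) auto
  moreover have "log_star (shrunk n i) = 1 + log_star (log 2 (shrunk n i))"
    using gt by (subst log_star.simps) simp
  ultimately show ?case using Suc by simp
qed simp

text \<open>The value just before the cutoff still exceeds the ratio, so its \<open>log_star\<close>
  is at least that of the ratio; the step beyond it is the \<open>+ 1\<close>. This links the depth
  to \<open>rounds\<close>.\<close>

lemma cutoff_log_star: "k \<le> n \<Longrightarrow> cutoff n k + log_star ratio \<le> log_star n + 1"
proof (cases "cutoff n k")
  case 0
  assume "k \<le> n"
  have "ratio \<le> n"
  proof -
    have "real k * 1 \<le> real n * sqrt n" using n_pos \<open>k \<le> n\<close> by (intro mult_mono) auto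
    then show ?thesis using n_pos by (simp add: pos_divide_le_eq)
  qed
  then show ?thesis using log_star_mono[of ratio n] 0 by simp
next
  case (Suc r)
  have "log_star ratio \<le> log_star (shrunk n r)"
    using ratio_less_shrunk[of r] Suc by (intro log_star_mono) simp
  then show ?thesis using log_star_shrunk[of r] Suc by simp
qed

text \<open>The iterated logarithms read backwards: a tower-like sequence from at most k / sqrt n up
  to \<open>n\<close>, whose length is exactly the number of steps the machine counts.\<close>

definition growth :: "nat \<Rightarrow> nat" where
  "growth t = shrunk n (cutoff n k - t)"

lemma growth_Suc: "t < cutoff n k \<Longrightarrow> growth t = floor_log (growth (Suc t))"
  unfolding growth_def shrunk_Suc[symmetric] by (simp add: Suc_diff_Suc)

lemma growth_cutoff: "growth (cutoff n k) = n"
  by (simp add: growth_def)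

lemma growth_Suc_gt: "t < cutoff n k \<Longrightarrow> 2 < growth (Suc t)"
  using ratio_less_shrunk[of "cutoff n k - Suc t"] ratio_ge_2 unfolding growth_def by linarith

text \<open>The tower outruns the powers of two. This pays for the factor \<open>4 ^ j\<close> in
  \<open>rate_step\<close> and keeps \<open>2 ^ cutoff n k\<close> logarithmic in
  \<open>n\<close>.\<close>

lemma growth_ge: "0 < cutoff n k \<Longrightarrow> t \<le> cutoff n k \<Longrightarrow> 2 ^ t \<le> growth t"
proof (induction t)
  case 0
  have "floor_log 2 \<le> floor_log (growth (Suc 0))"
    using growth_Suc_gt[of 0] 0 by (intro monoD[OF floor_log_mono]) simp
  then show ?case using growth_Suc[of 0] 0 by (simp add: floor_log_rec)
next
  case (Suc t)
  have "(2::nat) ^ Suc t \<le> 2 ^ (2 ^ t)" by (intro power_increasing) (auto simp: Suc_le_eq)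
  also have "\<dots> \<le> 2 ^ growth t" using Suc by (intro power_increasing) auto
  also have "\<dots> \<le> growth (Suc t)"
    unfolding growth_Suc[OF Suc_le_lessD[OF Suc.prems(2)]]
    using growth_Suc_gt[of t] Suc.prems by (intro floor_log_exp2_le) auto
  finally show ?case .
qed

lemma growth_le: "t < cutoff n k \<Longrightarrow> growth (Suc t) < 2 * 2 ^ growth t"
  unfolding growth_Suc[of t] using growth_Suc_gt[of t] by (intro floor_log_exp2_gt)

lemma cutoff_pos: "k \<le> n \<Longrightarrow> 1 < n \<Longrightarrow> 0 < cutoff n k"
proof (rule ccontr)
  assume "k \<le> n" "1 < n" "\<not> 0 < cutoff n k"
  then have "n * n\<^sup>2 \<le> k\<^sup>2" using cutoff[of n k] by simp
  also have "k\<^sup>2 \<le> n\<^sup>2" using \<open>k \<le> n\<close> by (rule power_mono) simp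
  finally have "n * n\<^sup>2 \<le> 1 * n\<^sup>2" by simp
  then show False using \<open>1 < n\<close> by (simp only: mult_le_cancel2) simp
qed

lemma pow_cutoff_le:
  assumes "k \<le> n" "1 < n"
  shows "2 ^ cutoff n k \<le> 2 * log 2 n"
proof -
  obtain r where r: "cutoff n k = Suc r" using cutoff_pos[OF assms] by (cases "cutoff n k") auto
  have "2 ^ r \<le> growth r" using r by (intro growth_ge) auto
  also have "growth r = floor_log n" using growth_Suc[of r] growth_cutoff r by simp
  finally have "real (2 ^ r) \<le> floor_log n" by (simp only: of_nat_le_iff)
  also have "\<dots> \<le> log 2 n" using n_pos by (rule floor_log_le_log)
  finally show ?thesis by (simp add: r)
qed

end

section \<open>The schedule of the filter\<close>

locale planted_filter = planted_graph n k L K for n k L K +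
  assumes L_eq: "L = cutoff n k + 2" and k_large: "2 ^ 20 * sqrt n \<le> k" and k_le: "k \<le> n" and n_ge: "64 \<le> n"
begin

text \<open>This is (thr L)^2 / (16 k), the exponent at the deepest level when the number of
  survivors is of order \<open>k\<close>. It also serves as the slack \<open>H\<close> of every
  step.\<close>

definition margin :: real where
  "margin = real k / 2 ^ (2 * L + 16)"

text \<open>Level 0 is unfiltered, level \<open>cutoff n k + 1\<close> reaches rate
  \<open>n\<close>, and the test for level \<open>cutoff n k + 2\<close> can then be expected to
  make no error. Hence the two levels beyond the cutoff.\<close>

definition rate :: "nat \<Rightarrow> nat" where
  "rate j = (case j of 0 \<Rightarrow> 1 | Suc i \<Rightarrow> growth n k i)"

text \<open>
  The factor \<open>4\<^sup>j\<close> pays for the clique part of block \<open>j\<close>, which is smaller by a factor \<open>2\<^sup>j\<close> than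
  that of block \<open>0\<close> and enters the exponent of the tail bound squared.
\<close>

definition budget :: "nat \<Rightarrow> real" where
  "budget j = n / (4 ^ j * rate j) + margin + 1"

lemma n_pos: "0 < n" and one_less_n: "1 < n" and k_ge: "2 * sqrt n \<le> k"
proof -
  show "0 < n" "1 < n" using n_ge by auto
  have "2 * sqrt n \<le> 2 ^ 20 * sqrt n" by (intro mult_right_mono) auto
  then show "2 * sqrt n \<le> k" using k_large by linarith
qed

lemmas growth_facts = growth_ge[OF n_pos k_ge cutoff_pos[OF n_pos k_ge k_le one_less_n]]
  growth_le[OF n_pos k_ge] growth_cutoff[OF n_pos k_ge]

lemma ratio_large: "2 ^ 20 \<le> real k / sqrt n"
  using k_large n_pos by (simp add: pos_le_divide_eq)

lemma rate_ge_1: "j \<le> Suc (cutoff n k) \<Longrightarrow> 1 \<le> rate j"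
proof (cases j)
  case (Suc i)
  assume "j \<le> Suc (cutoff n k)"
  then have "2 ^ i \<le> growth n k i" using Suc by (intro growth_facts(1)) simp
  then have "1 \<le> growth n k i" using one_le_power[of "2::nat" i] by linarith
  then show ?thesis using Suc by (simp add: rate_def)
qed (simp add: rate_def)

text \<open>The error bound of one level beats the reduction required at the next. On level 0 the
  next rate is at most the ratio, so 1 + x \<le> exp x suffices; later it is at most 2 * 2^g for the
  present rate g, and 4^i \<le> 4^g bounds the other factor.\<close>

lemma rate_step:
  assumes "j \<le> cutoff n k"
  shows "2 * (4 ^ Suc j * rate (Suc j)) \<le> exp (16 * (real k / sqrt n) * rate j)"
proof (cases j)
  case 0
  have "real (shrunk n (cutoff n k)) \<le> real k / sqrt n"
    by (rule shrunk_cutoff_le[OF n_pos k_ge])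
  then have "2 * (4 ^ Suc j * real (rate (Suc j))) \<le> 1 + 16 * (real k / sqrt n)"
    using ratio_large by (simp add: 0 rate_def growth_def[OF n_pos k_ge])
  also have "\<dots> \<le> exp (16 * (real k / sqrt n))" by (rule exp_ge_add_one_self)
  finally show ?thesis by (simp add: 0 rate_def)
next
  case (Suc i)
  define g where "g = growth n k i"
  have g: "2 ^ i \<le> g" using growth_facts(1)[of i] assms Suc by (simp add: g_def)
  then have g1: "1 \<le> g" using one_le_power[of "2::nat" i] by linarith
  have "(2::nat) ^ i \<le> 2 ^ g" using g less_exp[of g] by linarith
  then have "(2 ^ i)\<^sup>2 \<le> ((2::nat) ^ g)\<^sup>2" by (rule power_mono) simp
  then have i4: "(4::nat) ^ i \<le> 4 ^ g"
    by (simp add: power2_eq_square power_mult_distrib[symmetric])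
  have "growth n k (Suc i) \<le> 2 * 2 ^ g"
    using growth_facts(2)[of i] assms Suc by (simp add: g_def)
  then have "2 * (16 * 4 ^ i * growth n k (Suc i)) \<le> 2 * (16 * 4 ^ g * (2 * 2 ^ g))"
    using i4 by (intro mult_mono) auto
  then have "2 * (4 ^ Suc j * rate (Suc j)) \<le> 2 * (16 * 4 ^ g * (2 * 2 ^ g))"
    by (simp add: Suc rate_def)
  also have "\<dots> = 2 ^ 6 * 2 ^ (3 * g)"
    by (simp add: power_mult power_mult_distrib[symmetric])
  also have "\<dots> \<le> 2 ^ (6 * g) * 2 ^ (3 * g)"
    using g1 by (intro mult_right_mono power_increasing) auto
  also have "\<dots> = (2::nat) ^ (9 * g)" by (simp flip: power_add)
  finally have "real (2 * (4 ^ Suc j * rate (Suc j))) \<le> real (2 ^ (9 * g))" by (simp only: of_nat_le_iff)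
  also have "\<dots> \<le> exp 1 ^ (9 * g)"
    using exp_ge_add_one_self[of 1] by (simp add: power_mono)
  also have "\<dots> = exp (9 * g)" by (simp flip: exp_of_nat_mult)
  also have "\<dots> \<le> exp (16 * (real k / sqrt n) * g)"
  proof -
    have "9 * real g \<le> 16 * (real k / sqrt n) * g" using ratio_large by (intro mult_right_mono) auto
    then show ?thesis by simp
  qed
  finally show ?thesis by (simp add: Suc rate_def g_def)
qed

lemma margin_pos: "0 < margin"
  using k_pos by (simp add: margin_def)

lemma margin_le: "i \<le> 2 * L + 16 \<Longrightarrow> margin \<le> real k / 2 ^ i"
  unfolding margin_def by (intro divide_left_mono power_increasing) auto

text \<open>Two regimes: if the clique dominates the count, the exponent is at least
  \<open>margin\<close>; otherwise the other survivors dominate and the factor \<open>4 ^ j\<close>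
  cancels against the squared threshold.\<close>

lemma tail_prob_budget:
  assumes "j \<le> L"
  shows "tail_prob budget j \<le> exp (- margin) + exp (- (16 * (real k / sqrt n) * rate j))"
proof (cases "real n / (4 ^ j * rate j) \<le> k")
  case True
  have "budget j \<le> 3 * k"
    using True margin_le[of 0] k_pos by (simp add: budget_def)
  moreover have b0: "0 \<le> budget j" using margin_pos by (simp add: budget_def)
  ultimately have "(thr j)\<^sup>2 / (4 * (4 * k)) \<le> (thr j)\<^sup>2 / (4 * (real k + budget j))"
    using k_pos by (intro divide_left_mono mult_pos_pos) auto
  moreover have "(thr j)\<^sup>2 / (4 * (4 * k)) = real k / 2 ^ (2 * j + 16)"
    using k_pos by (simp add: thr_def power_add power_mult power2_eq_square power_mult_distrib[symmetric])
  moreover have "margin \<le> real k / 2 ^ (2 * j + 16)"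
    using assms by (intro margin_le) simp
  ultimately have "tail_prob budget j \<le> exp (- margin)" by (simp add: tail_prob_def)
  then show ?thesis by (smt (verit) exp_ge_zero)
next
  case False
  define D where "D = real n / (4 ^ j * rate j)"
  have D: "k < D" using False by (simp add: D_def)
  then have D0: "0 < D" "0 < rate j" using k_pos by (auto simp: D_def intro: gr0I)
  have "budget j \<le> 3 * D"
    using D margin_le[of 0] k_pos by (simp add: budget_def D_def)
  moreover have b0: "0 \<le> budget j" using margin_pos by (simp add: budget_def)
  ultimately have "(thr j)\<^sup>2 / (4 * (4 * D)) \<le> (thr j)\<^sup>2 / (4 * (real k + budget j))"
    using D k_pos by (intro divide_left_mono mult_pos_pos) auto
  moreover have "(thr j)\<^sup>2 / (4 * (4 * D)) = (real k / sqrt n)\<^sup>2 / 2 ^ 16 * rate j"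
    using n_pos D0 by (simp add: thr_def D_def power2_eq_square power_mult_distrib[symmetric])
  \<comment> \<open>Here \<open>2 ^ 20\<close> is spent: one factor of the squared ratio pays for
    \<open>2 ^ 16\<close> and leaves 16.\<close>
  moreover have "16 * (real k / sqrt n) * rate j \<le> (real k / sqrt n)\<^sup>2 / 2 ^ 16 * rate j"
  proof (intro mult_right_mono)
    have "2 ^ 20 * (real k / sqrt n) \<le> (real k / sqrt n)\<^sup>2"
      unfolding power2_eq_square using ratio_large by (intro mult_right_mono) auto
    then show "16 * (real k / sqrt n) \<le> (real k / sqrt n)\<^sup>2 / 2 ^ 16" by simp
  qed simp
  ultimately have "tail_prob budget j \<le> exp (- (16 * (real k / sqrt n) * rate j))"
    by (simp add: tail_prob_def)
  then show ?thesis by (smt (verit) exp_ge_zero)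
qed

lemma recovery_fails_margin:
  assumes m: "2 * n * exp (- margin) \<le> 1" "2 \<le> margin"
  shows "subset_prob free_pairs (\<lambda>X. {u \<in> {1..n}. int k \<le> 64 * 2 ^ L * advantage (adj X) (survivors X L) u} \<noteq> K)
    \<le> (2 * Suc (cutoff n k) + 3 * n) * exp (- margin)"
proof (rule recovery_fails)
  show "L = Suc (Suc (cutoff n k))" using L_eq by simp
  show "real n \<le> budget 0" using margin_pos by (simp add: budget_def rate_def)
  have e16: "exp (- margin) \<le> 1 / 16"
  proof -
    have "2 * 64 * exp (- margin) \<le> 2 * n * exp (- margin)"
      using n_ge by (intro mult_right_mono) auto
    then show ?thesis using m(1) by linarith
  qed
  fix j assume "j < Suc (cutoff n k)"
  then have j: "j \<le> cutoff n k" "j \<le> L" using L_eq by auto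
  note T = tail_prob_budget[OF j(2)]
  have r1: "1 \<le> rate j" using j by (intro rate_ge_1) simp
  have rr: "1 \<le> rate (Suc j)" using j by (intro rate_ge_1) simp
  define E where "E = exp (16 * (real k / sqrt n) * rate j)"
  have E: "exp (- (16 * (real k / sqrt n) * rate j)) = 1 / E" "0 < E" by (simp_all add: E_def exp_minus field_simps)
  have "16 * 1 * 1 \<le> 16 * (real k / sqrt n) * rate j"
    using ratio_large r1 by (intro mult_mono) auto
  then have "16 \<le> E" unfolding E_def using exp_ge_add_one_self[of "16 * (real k / sqrt n) * rate j"] by linarith
  then have "1 / E \<le> 1 / 16" by (intro divide_left_mono) auto
  then show "tail_prob budget j \<le> 1 / 8" using T e16 E by linarith
  have "1 / E \<le> 1 / (2 * (4 ^ Suc j * rate (Suc j)))"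
    using rate_step[OF j(1)] rr unfolding E_def by (intro divide_left_mono) (auto simp: zero_less_mult_iff)
  then have "2 * n * (1 / E) \<le> 2 * n * (1 / (2 * (4 ^ Suc j * rate (Suc j))))"
    by (intro mult_left_mono) auto
  also have "\<dots> = n / (4 ^ Suc j * rate (Suc j))" using rr by simp
  finally have "2 * n * (1 / E) \<le> n / (4 ^ Suc j * rate (Suc j))" .
  moreover have "2 * n * tail_prob budget j \<le> 2 * n * (exp (- margin) + 1 / E)"
    using T unfolding E by (intro mult_left_mono) auto
  \<comment> \<open>The summands of the budget match the sources of error: the scheduled count, the
    slack \<open>margin\<close>, and 1 for \<open>2 * n * exp (- margin)\<close>.\<close>
  ultimately show "2 * tail_prob budget j * n + margin \<le> budget (Suc j)"
    using m(1) by (simp add: budget_def algebra_simps)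
next
  show "margin \<le> real k / 2 ^ (L + 7)" by (intro margin_le) simp
  \<comment> \<open>On this level the rate is \<open>n\<close>, so the second tail term is
    negligible as well.\<close>
  have "margin \<le> 16 * (real k / sqrt n) * rate (Suc (cutoff n k))"
  proof -
    have "margin \<le> n" using margin_le[of 0] k_le by simp
    also have "real n = 1 * 1 * real n" by simp
    also have "\<dots> \<le> 16 * (real k / sqrt n) * rate (Suc (cutoff n k))"
      using ratio_large by (intro mult_mono) (auto simp: rate_def growth_facts(3))
    finally show ?thesis .
  qed
  then have "exp (- (16 * (real k / sqrt n) * rate (Suc (cutoff n k)))) \<le> exp (- margin)" by simp
  then show "tail_prob budget (Suc (cutoff n k)) \<le> 2 * exp (- margin)"
    using tail_prob_budget[of "Suc (cutoff n k)"] L_eq by linarith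
  have "(thr L)\<^sup>2 / (4 * real k) = real k / 2 ^ (2 * L + 14)"
    using k_pos by (simp add: thr_def power_add power_mult power2_eq_square power_mult_distrib[symmetric])
  then show "margin \<le> (thr L)\<^sup>2 / (4 * real k)" using margin_le[of "2 * L + 14"] by simp
  have "2 \<le> real k / 2 ^ (L + 6)" using margin_le[of "L + 6"] m(2) by linarith
  moreover have "real k / 2 ^ (L + 4) = 4 * (real k / 2 ^ (L + 6))" by (simp add: power_add)
  ultimately show "real k / 2 ^ (L + 6) + 2 \<le> real k / 2 ^ (L + 4)" by linarith
qed

end

section \<open>The output of the program\<close>

definition accepted_set :: "nat \<Rightarrow> nat \<Rightarrow> nat set set \<Rightarrow> nat set" where
  "accepted_set n k E = (let A = adj_matrix n E; L = cutoff n k + 2 in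
     {u \<in> {1..n}. int k \<le> 64 * 2 ^ L * advantage A (level A n k L) u})"

definition program_space :: "nat \<Rightarrow> nat \<Rightarrow> nat" where
  "program_space n k = space (24 + 2 * (cutoff n k + 2)) (64 * n ^ 3)"

lemma clique_prog_outputs:
  assumes "2 ^ (cutoff n k + 2) \<le> n" "k \<le> n" "64 \<le> n" "0 < k"
  shows "\<exists>w. outputs clique_prog n E k (program_space n k) w \<and> distinct w \<and> set w = accepted_set n k E"
proof -
  interpret clique_machine n "adj_matrix n E" k "cutoff n k + 2" "64 * n ^ 3"
    by unfold_locales (simp_all only: adj_matrix_def of_bool_def assms order_refl split: if_split, simp)
  have "wp clique_prog (\<lambda>_. 0) (\<lambda>_ w. distinct w \<and> set w = accepted_set n k E)"
    by (rule wp_clique_prog) (simp_all only: accepted_set_def accepted_def Let_def)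
  moreover have "small (24 + 2 * (cutoff n k + 2)) (64 * n ^ 3) (\<lambda>_. 0)"
    by (simp add: small_def)
  ultimately obtain m' w where "exec n (adj_matrix n E) k (space (24 + 2 * (cutoff n k + 2)) (64 * n ^ 3)) clique_prog (\<lambda>_. 0) m' w"
    "distinct w" "set w = accepted_set n k E"
    unfolding wp_def by blast
  then show ?thesis unfolding outputs_def program_space_def by metis
qed

lemma outputs_mono: "outputs P n E k s w \<Longrightarrow> s \<le> s' \<Longrightarrow> outputs P n E k s' w"
  unfolding outputs_def using exec_mono by blast

lemma runs_in_space_mono: "runs_in_space P n k s \<Longrightarrow> s \<le> s' \<Longrightarrow> runs_in_space P n k s'"
  unfolding runs_in_space_def using outputs_mono by meson

section \<open>Probability of recovery\<close>

text \<open>A fair coin for each free pair is the same as a uniformly random set of free pairs,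
  which makes \<open>subset_prob\<close> applicable.\<close>

lemma planted_clique_alt:
  "planted_clique n k = pmf_of_set (nsets {1..n} k) \<bind> (\<lambda>K.
     map_pmf (\<lambda>X. (K, nsets K 2 \<union> X)) (pmf_of_set (Pow (nsets {1..n} 2 - nsets K 2))))"
  unfolding planted_clique_def
proof (intro bind_pmf_cong refl)
  fix K
  let ?D = "nsets {1..n} 2 - nsets K 2"
  have fin: "finite ?D" by (simp add: finite_imp_finite_nsets)
  show "Pi_pmf ?D False (\<lambda>_. bernoulli_pmf (1 / 2)) \<bind>
       (\<lambda>b. return_pmf (K, nsets K 2 \<union> {e \<in> ?D. b e}))
     = map_pmf (\<lambda>X. (K, nsets K 2 \<union> X)) (pmf_of_set (Pow ?D))"
    unfolding pmf_of_set_Pow_conv_bernoulli[OF fin, of False, symmetric] map_pmf_comp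
    by (simp add: map_pmf_def)
qed

lemma prob_planted_clique:
  assumes "k \<le> n"
  shows "measure_pmf.prob (planted_clique n k) S =
    (\<Sum>K\<in>nsets {1..n} k. subset_prob (nsets {1..n} 2 - nsets K 2) (\<lambda>X. (K, nsets K 2 \<union> X) \<in> S)) / (n choose k)"
proof -
  let ?D = "\<lambda>K. nsets {1..n} 2 - nsets K 2"
  let ?f = "\<lambda>K. map_pmf (\<lambda>X. (K, nsets K 2 \<union> X)) (pmf_of_set (Pow (?D K)))"
  have finD: "finite (?D K)" for K :: "nat set" by (simp add: finite_imp_finite_nsets)
  have card: "card (nsets {1..n} k) = n choose k" by simp
  have fin: "finite (nsets {1..n} k)" by (simp add: finite_imp_finite_nsets)
  have ne: "nsets {1..n} k \<noteq> {}"
    using card assms by (metis card.empty zero_less_binomial less_numeral_extra(3))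
  have inner: "measure_pmf.prob (?f K) S = subset_prob (?D K) (\<lambda>X. (K, nsets K 2 \<union> X) \<in> S)" for K :: "nat set"
  proof -
    have "measure_pmf.prob (?f K) S = card (Pow (?D K) \<inter> (\<lambda>X. (K, nsets K 2 \<union> X)) -` S) / 2 ^ card (?D K)"
      unfolding measure_map_pmf using finD[of K]
      by (subst measure_pmf_of_set) (simp_all add: card_Pow Pow_not_empty)
    also have "real (card (Pow (?D K) \<inter> (\<lambda>X. (K, nsets K 2 \<union> X)) -` S))
       = (\<Sum>X\<in>Pow (?D K). of_bool ((K, nsets K 2 \<union> X) \<in> S))"
      using finD[of K] by (simp add: of_bool_def sum.If_cases vimage_def Int_def)
    finally show ?thesis by (simp add: subset_prob_def subset_mean_def)
  qed
  have "measure_pmf.prob (planted_clique n k) S = measure_pmf.expectation (planted_clique n k) (indicat_real S)"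
    by simp
  also have "\<dots> = (\<Sum>K\<in>nsets {1..n} k. measure_pmf.expectation (?f K) (indicat_real S) /\<^sub>R real (card (nsets {1..n} k)))"
    unfolding planted_clique_alt
    by (rule pmf_expectation_bind_pmf_of_set[OF ne fin]) (use finD in \<open>simp add: set_pmf_of_set Pow_not_empty\<close>)
  also have "\<dots> = (\<Sum>K\<in>nsets {1..n} k. measure_pmf.prob (?f K) S) / (n choose k)"
    by (simp add: card sum_distrib_left divide_inverse mult.commute)
  finally show ?thesis by (simp only: inner)
qed

lemma subset_prob_not:
  assumes "finite D"
  shows "subset_prob D (\<lambda>X. \<not> Q X) = 1 - subset_prob D Q"
proof -
  have "subset_mean D (\<lambda>X. of_bool (\<not> Q X) + of_bool (Q X)) = subset_mean D (\<lambda>_. 1)"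
    by (rule subset_mean_cong) simp
  then show ?thesis using assms by (simp add: subset_mean_add subset_prob_def)
qed

section \<open>Spread of the clique and averaging over its position\<close>

lemma card_block_ge:
  assumes "2 ^ (j + 2) \<le> n"
  shows "real n / 2 ^ (j + 2) \<le> card (block n j)"
proof -
  have le: "n div 2 ^ Suc j \<le> n div 2 ^ j" by (intro div_le_mono2) auto
  have "real n / 2 ^ j - 1 \<le> real (n div 2 ^ j)"
    using floor_divide_of_nat_eq[of n "2 ^ j", where 'a = real] real_of_int_floor_add_one_gt[of "real n / 2 ^ j"] by simp
  moreover have "real (n div 2 ^ Suc j) \<le> real n / 2 ^ Suc j"
    using floor_divide_of_nat_eq[of n "2 ^ Suc j", where 'a = real] of_int_floor_le[of "real n / 2 ^ Suc j"] by simp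
  moreover have "real (2 ^ (j + 2)) \<le> real n" using assms by (simp only: of_nat_le_iff)
  then have "1 \<le> real n / 2 ^ (j + 2)" by (simp add: le_divide_eq)
  moreover have "real n / 2 ^ j = 4 * (real n / 2 ^ (j + 2))" "real n / 2 ^ Suc j = 2 * (real n / 2 ^ (j + 2))"
    by (simp_all add: power_add)
  moreover have "real (card (block n j)) = real (n div 2 ^ j) - real (n div 2 ^ Suc j)"
    using le by (simp add: block_def of_nat_diff)
  ultimately show ?thesis by linarith
qed

text \<open>A block has at least n / 2^(j+2) vertices, so it expects at least k / 2^(j+2) clique
  vertices and being spread asks for a quarter of this. The rest is a union bound over the
  \<open>L + 1\<close> blocks.\<close>

lemma card_not_spread:
  assumes n: "2 ^ (L + 2) \<le> n" "k \<le> n"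
  shows "card {K \<in> nsets {1..n} k. \<exists>j\<le>L. card (K \<inter> block n j) < real k / 2 ^ (j + 4)}
    \<le> (n choose k) * ((real L + 1) * ((real n + 1) * exp (- (real k / 2 ^ (L + 4)))))"
proof -
  let ?B = "\<lambda>j. {K \<in> nsets {1..n} k. card (K \<inter> block n j) < real k / 2 ^ (j + 4)}"
  have n0: "0 < n" using n(1) by (metis gr0I le_zero_eq power_eq_0_iff zero_neq_numeral)
  have B: "card (?B j) \<le> (n choose k) * ((real n + 1) * exp (- (real k / 2 ^ (L + 4))))" if j: "j \<le> L" for j
  proof -
    have "(2::nat) ^ (j + 2) \<le> 2 ^ (L + 2)" using j by (intro power_increasing) auto
    then have "real n / 2 ^ (j + 2) \<le> card (block n j)" using n(1) by (intro card_block_ge) (rule order_trans)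
    then have "real k / (4 * n) * (real n / 2 ^ (j + 2)) \<le> real k / (4 * n) * card (block n j)"
      by (intro mult_left_mono) auto
    then have m: "real k / 2 ^ (j + 4) \<le> real k * card (block n j) / (4 * n)"
      using n0 by (simp add: power_add field_simps)
    let ?C = "{K \<in> nsets {1..n} k. card (K \<inter> block n j) \<le> real k * card (block n j) / (4 * n)}"
    have "card (?B j) \<le> card ?C"
      using m by (intro card_mono) (auto simp: finite_imp_finite_nsets)
    also have "real (card ?C) \<le> (n choose k) * ((real n + 1) * exp (- (real k * card (block n j) / (4 * n))))"
    proof -
      have "block n j \<subseteq> {1..n}" by (auto simp: block_def dest: le_div_imp_le)
      from card_nsets_small_intersection[OF n(2) n0 this] show ?thesis by (simp add: add.commute)
    qed
    also have "\<dots> \<le> (n choose k) * ((real n + 1) * exp (- (real k / 2 ^ (L + 4))))"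
    proof -
      have "real k / 2 ^ (L + 4) \<le> real k / 2 ^ (j + 4)"
        using j by (intro divide_left_mono power_increasing) auto
      then show ?thesis using m by (intro mult_left_mono) auto
    qed
    finally show ?thesis by simp
  qed
  have "{K \<in> nsets {1..n} k. \<exists>j\<le>L. card (K \<inter> block n j) < real k / 2 ^ (j + 4)} = (\<Union>j\<le>L. ?B j)" by auto
  then have "real (card {K \<in> nsets {1..n} k. \<exists>j\<le>L. card (K \<inter> block n j) < real k / 2 ^ (j + 4)}) \<le> (\<Sum>j\<le>L. real (card (?B j)))"
    using card_UN_le[of "{..L}" ?B] by (simp flip: of_nat_sum)
  also have "\<dots> \<le> (\<Sum>j\<le>L. (n choose k) * ((real n + 1) * exp (- (real k / 2 ^ (L + 4)))))"
    by (intro sum_mono B) simp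
  finally show ?thesis by (simp add: algebra_simps)
qed

lemma sum_of_bool_subset:
  assumes "finite N" "B \<subseteq> N"
  shows "(\<Sum>x\<in>N. of_bool (x \<in> B) :: real) = card B"
  using assms by (simp add: of_bool_def sum.If_cases Int_absorb1)

text \<open>The 7 is 5 + 2: at most 5 n^2 exp (- m) for failing on a spread clique, and 2 n^2 exp (-
  m) for the cliques that are not spread, which are given up.\<close>

lemma recovery_prob_ge:
  fixes n k :: nat
  defines "L \<equiv> cutoff n k + 2"
  defines "m \<equiv> real k / 2 ^ (2 * L + 16)"
  assumes k: "2 ^ 20 * sqrt n \<le> k" "k \<le> n" and n: "64 \<le> n" "2 ^ (L + 2) \<le> n"
    and m: "2 * n * exp (- m) \<le> 1" "2 \<le> m" and s: "program_space n k \<le> s"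
  shows "1 - 7 * (real n)\<^sup>2 * exp (- m) \<le> recovery_prob clique_prog n k s"
proof -
  let ?N = "nsets {1..n} k"
  let ?S = "{(K, E). \<exists>w. outputs clique_prog n E k s w \<and> distinct w \<and> set w = K}"
  let ?D = "\<lambda>K. nsets {1..n} 2 - nsets K 2"
  let ?bad = "{K \<in> ?N. \<exists>j\<le>L. card (K \<inter> block n j) < real k / 2 ^ (j + 4)}"
  define \<delta> where "\<delta> = (2 * Suc (cutoff n k) + 3 * n) * exp (- m)"
  have "0 < sqrt n" using n by simp
  then have k0: "0 < k" using k(1) by (smt (verit) mult_pos_pos of_nat_0_less_iff zero_less_power)
  have finN: "finite ?N" by (simp add: finite_imp_finite_nsets)
  have C0: "0 < n choose k" using k by simp
  have nL: "2 ^ L \<le> n" using n(2) by simp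
  have "L < 2 ^ L" by (rule less_exp)
  then have Ln: "L < n" using nL by linarith
  have succ: "1 - \<delta> - of_bool (K \<in> ?bad) \<le> subset_prob (?D K) (\<lambda>X. (K, nsets K 2 \<union> X) \<in> ?S)" if K: "K \<in> ?N" for K
  proof (cases "K \<in> ?bad")
    case True
    have "0 \<le> \<delta>" by (simp add: \<delta>_def)
    then show ?thesis using True subset_prob_nonneg[of "?D K" "\<lambda>X. (K, nsets K 2 \<union> X) \<in> ?S"] by simp
  next
    case False
    interpret planted_filter n k L K
      by unfold_locales (use K False k k0 n in \<open>auto simp: nsets_def L_def not_less\<close>)
    have D: "?D K = free_pairs" by (simp add: free_pairs_def)
    have mm: "margin = m" by (simp add: margin_def m_def)
    have acc: "accepted_set n k (nsets K 2 \<union> X) =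
       {u \<in> {1..n}. int k \<le> 64 * 2 ^ L * advantage (adj X) (survivors X L) u}" for X
      by (simp add: accepted_set_def Let_def adj_def survivors_def L_def)
    have "subset_prob free_pairs (\<lambda>X. \<not> (K, nsets K 2 \<union> X) \<in> ?S)
      \<le> subset_prob free_pairs (\<lambda>X. accepted_set n k (nsets K 2 \<union> X) \<noteq> K)"
    proof (rule subset_prob_mono)
      fix X assume "\<not> (K, nsets K 2 \<union> X) \<in> ?S"
      moreover obtain w where "outputs clique_prog n (nsets K 2 \<union> X) k (program_space n k) w"
        "distinct w" "set w = accepted_set n k (nsets K 2 \<union> X)"
        using clique_prog_outputs[of n k "nsets K 2 \<union> X"] nL k n k0 unfolding L_def by blast
      ultimately show "accepted_set n k (nsets K 2 \<union> X) \<noteq> K"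
        using outputs_mono[OF _ s] by blast
    qed
    also have "\<dots> \<le> \<delta>"
      unfolding acc using recovery_fails_margin m unfolding mm \<delta>_def by simp
    finally show ?thesis
      unfolding D using False subset_prob_not[OF finite_free_pairs, of "\<lambda>X. (K, nsets K 2 \<union> X) \<in> ?S"] by simp
  qed
  have "(n choose k) * (1 - \<delta>) - card ?bad = (\<Sum>K\<in>?N. 1 - \<delta> - of_bool (K \<in> ?bad))"
    using sum_of_bool_subset[OF finN, of ?bad] by (simp add: sum_subtractf)
  also have "\<dots> \<le> (\<Sum>K\<in>?N. subset_prob (?D K) (\<lambda>X. (K, nsets K 2 \<union> X) \<in> ?S))"
    by (rule sum_mono) (rule succ)
  finally have "((n choose k) * (1 - \<delta>) - card ?bad) / (n choose k)
     \<le> (\<Sum>K\<in>?N. subset_prob (?D K) (\<lambda>X. (K, nsets K 2 \<union> X) \<in> ?S)) / (n choose k)"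
    by (rule divide_right_mono) simp
  also have "\<dots> = recovery_prob clique_prog n k s"
    unfolding recovery_prob_def by (rule prob_planted_clique[OF k(2), symmetric])
  finally have 1: "1 - \<delta> - card ?bad / (n choose k) \<le> recovery_prob clique_prog n k s"
    using C0 by (simp add: diff_divide_distrib)
  have "card ?bad \<le> (n choose k) * ((real L + 1) * ((real n + 1) * exp (- (real k / 2 ^ (L + 4)))))"
    by (rule card_not_spread[OF n(2) k(2)])
  then have "card ?bad / (n choose k) \<le> (real L + 1) * ((real n + 1) * exp (- (real k / 2 ^ (L + 4))))"
    using C0 by (simp add: divide_le_eq mult.commute)
  also have "\<dots> \<le> (real L + 1) * ((real n + 1) * exp (- m))"
  proof -
    have "m \<le> real k / 2 ^ (L + 4)"
      unfolding m_def by (intro divide_left_mono power_increasing) auto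
    then show ?thesis by (intro mult_left_mono) auto
  qed
  also have "\<dots> \<le> n * ((2 * n) * exp (- m))"
    using Ln n by (intro mult_mono mult_right_mono) auto
  finally have 2: "card ?bad / (n choose k) \<le> 2 * (real n)\<^sup>2 * exp (- m)"
    by (simp add: power2_eq_square)
  have "2 * Suc (cutoff n k) + 3 * n \<le> 5 * (n * n)"
  proof -
    have "Suc (cutoff n k) \<le> n" using Ln by (simp add: L_def)
    moreover have "n \<le> n * n" by simp
    moreover have "2 * x + 3 * n \<le> 5 * y" if "x \<le> n" "n \<le> y" for x y :: nat
      using that by linarith
    ultimately show ?thesis by blast
  qed
  then have "real (2 * Suc (cutoff n k) + 3 * n) \<le> real (5 * (n * n))" by (simp only: of_nat_le_iff)
  then have "\<delta> \<le> 5 * (real n)\<^sup>2 * exp (- m)"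
    unfolding \<delta>_def by (intro mult_right_mono) (auto simp: power2_eq_square)
  with 1 2 show ?thesis by linarith
qed

section \<open>Space and failure probability for large inputs\<close>

lemma floorlog_le_log: "0 < x \<Longrightarrow> real (floorlog 2 x) \<le> log 2 (real x) + 1"
  by (auto simp: floorlog_def)

lemma rounds_ge:
  assumes "64 \<le> n" "2 ^ 20 * sqrt n \<le> k" "k \<le> n"
  shows "2 * real (cutoff n k) + 1 \<le> rounds n k" "3 \<le> rounds n k"
proof -
  have n0: "0 < n" using assms(1) by simp
  have "2 * sqrt n \<le> 2 ^ 20 * sqrt n" by (intro mult_right_mono) auto
  then have k2: "2 * sqrt n \<le> k" using assms(2) by linarith
  have "cutoff n k + log_star (real k / sqrt n) \<le> log_star n + 1"
    by (rule cutoff_log_star[OF n0 k2 assms(3)])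
  then have "real (cutoff n k + log_star (real k / sqrt n)) \<le> real (log_star n + 1)"
    by (simp only: of_nat_le_iff)
  then show 1: "2 * real (cutoff n k) + 1 \<le> rounds n k" by (simp add: rounds_def)
  have "1 \<le> cutoff n k" using cutoff_pos[OF n0 k2 assms(3)] assms(1) by simp
  then show "3 \<le> rounds n k" using 1 by linarith
qed

text \<open>The 120 is 10 * 12: there are \<open>28 + 2 * cutoff n k\<close> registers, at most
  \<open>10 * rounds n k\<close> because \<open>rounds n k\<close> is at least 3 and at least
  \<open>2 * cutoff n k + 1\<close>, and each takes at most 12 log n bits for address and
  content.\<close>

lemma program_space_le:
  assumes n: "64 \<le> n" and k: "2 ^ 20 * sqrt n \<le> k" "k \<le> n"
    and L: "2 ^ (cutoff n k + 2) \<le> n" "24 + 2 * log 2 n \<le> n"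
  shows "program_space n k \<le> 120 * (rounds n k * log 2 n)"
proof -
  define R where "R = cutoff n k"
  define B where "B = 24 + 2 * (R + 2)"
  have n0: "0 < n" using n by simp
  have "log 2 64 \<le> log 2 n" using n by (subst log_le_cancel_iff) auto
  moreover have "log 2 64 = (6::real)"
    using log_pow_cancel[of "2::real" 6] by simp
  ultimately have lg: "6 \<le> log 2 n" by simp
  have "real (2 ^ (R + 2)) \<le> real n" using L(1) unfolding R_def by (simp only: of_nat_le_iff)
  then have "real (R + 2) \<le> log 2 n"
    using n0 by (simp add: le_log_iff powr_realpow[symmetric] powr_add)
  then have "real B \<le> n" using L(2) by (simp add: B_def)
  then have "log 2 B \<le> log 2 n" by (subst log_le_cancel_iff) (auto simp: B_def n0)
  then have fB: "real (floorlog 2 B) \<le> 2 * log 2 n"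
    using floorlog_le_log[of B] lg by (simp add: B_def)
  have "log 2 (64 * real n ^ 3) = 6 + 3 * log 2 n"
    using n0 \<open>log 2 64 = 6\<close> by (simp add: log_mult log_nat_power)
  then have fM: "real (floorlog 2 (64 * n ^ 3)) \<le> 10 * log 2 n"
    using floorlog_le_log[of "64 * n ^ 3"] n0 lg by simp
  have "real (program_space n k) = B * (real (floorlog 2 B) + real (floorlog 2 (64 * n ^ 3)))"
    by (simp add: program_space_def space_def B_def R_def)
  also have "\<dots> \<le> (10 * rounds n k) * (2 * log 2 n + 10 * log 2 n)"
  proof (intro mult_mono add_mono fB fM)
    show "real B \<le> 10 * rounds n k"
      using rounds_ge[OF n k] by (simp add: B_def R_def)
    show "0 \<le> 10 * rounds n k" using rounds_ge(2)[OF n k] by simp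
  qed auto
  finally show ?thesis by (simp add: algebra_simps)
qed

lemma eventually_large:
  "\<forall>\<^sub>F n in sequentially. 64 \<le> n \<and> 32 * log 2 (real n) \<le> n \<and> 24 + 2 * log 2 (real n) \<le> n \<and>
     2 * ln (real n) + ln (real n) * log 2 (real n) \<le> sqrt n / (4 * (log 2 (real n))\<^sup>2) \<and>
     2 ^ 20 * sqrt n + 1 \<le> n \<and> 1 \<le> log_star n"
proof -
  have "\<forall>\<^sub>F n in sequentially. 32 * log 2 (real n) \<le> n"
    "\<forall>\<^sub>F n in sequentially. 24 + 2 * log 2 (real n) \<le> n"
    "\<forall>\<^sub>F n in sequentially. 2 * ln (real n) + ln (real n) * log 2 (real n) \<le> sqrt n / (4 * (log 2 (real n))\<^sup>2)"
    "\<forall>\<^sub>F n in sequentially. 2 ^ 20 * sqrt (real n) + 1 \<le> n"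
    unfolding log_def by real_asymp+
  moreover have "\<forall>\<^sub>F n in sequentially. (64::nat) \<le> n" by (rule eventually_ge_at_top)
  moreover have "\<forall>\<^sub>F n in sequentially. 1 \<le> log_star (real n)"
    using eventually_ge_at_top[of "2::nat"]
    by eventually_elim (subst log_star.simps, simp)
  ultimately show ?thesis by eventually_elim simp
qed

lemma clique_prog_correct:
  assumes n: "64 \<le> n" "32 * log 2 n \<le> n" "24 + 2 * log 2 n \<le> n"
    and margin: "2 * ln n + ln n * log 2 n \<le> sqrt n / (4 * (log 2 n)\<^sup>2)"
    and k: "2 ^ 20 * sqrt n \<le> k" "k \<le> n"
  defines "s \<equiv> nat \<lfloor>120 * (rounds n k * log 2 n)\<rfloor>"
  shows "runs_in_space clique_prog n k s"
    and "1 - 7 * (1 / real n) powr log 2 k \<le> recovery_prob clique_prog n k s"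
proof -
  have n0: "0 < n" "1 < n" using n by auto
  have "2 * sqrt n \<le> 2 ^ 20 * sqrt n" by (intro mult_right_mono) auto
  then have k2: "2 * sqrt n \<le> k" using k(1) by linarith
  have "0 < sqrt n" using n0 by simp
  then have k0: "0 < k" using k2 by linarith
  define L where "L = cutoff n k + 2"
  have pc: "2 ^ cutoff n k \<le> 2 * log 2 n" by (rule pow_cutoff_le[OF n0(1) k2 k(2) n0(2)])
  then have L8: "2 ^ L \<le> 8 * log 2 n" by (simp add: L_def)
  then have "real (2 ^ (L + 2)) \<le> real n" using n(2) by simp
  then have nL2: "2 ^ (L + 2) \<le> n" by (simp only: of_nat_le_iff)
  have lg1: "1 \<le> log 2 n" using n0 by (simp add: le_log_iff)
  have nL: "2 ^ L \<le> n" using nL2 by simp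
  have "program_space n k \<le> 120 * (rounds n k * log 2 n)"
    using n k nL unfolding L_def by (intro program_space_le) auto
  then have s: "program_space n k \<le> s" unfolding s_def by (rule le_nat_floor)
  show "runs_in_space clique_prog n k s"
    unfolding runs_in_space_def
    using clique_prog_outputs[of n k] outputs_mono[OF _ s] nL k n k0 unfolding L_def by meson
  define m where "m = real k / 2 ^ (2 * L + 16)"
  \<comment> \<open>The squared bound 2^L \<le> 8 log n turns the denominator into
    \<open>2 ^ 22\<close> times a squared logarithm, and \<open>k\<close> contributes
    \<open>2 ^ 20 * sqrt n\<close>.\<close>
  have mm: "sqrt n / (4 * (log 2 n)\<^sup>2) \<le> m"
  proof -
    have "(2 ^ L)\<^sup>2 \<le> (8 * log 2 n)\<^sup>2" using L8 by (intro power_mono) auto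
    then have "2 ^ (2 * L + 16) \<le> 2 ^ 22 * (log 2 n)\<^sup>2"
      by (simp add: power_add power_mult power2_eq_square power_mult_distrib[symmetric])
    then have "(2 ^ 20 * sqrt n) / (2 ^ 22 * (log 2 n)\<^sup>2) \<le> real k / 2 ^ (2 * L + 16)"
      using k(1) by (intro frac_le) auto
    then show ?thesis by (simp add: m_def)
  qed
  have ln: "1 \<le> ln n"
  proof -
    have "exp 1 \<le> (3::real)" using exp_bound[of 1] by simp
    then show ?thesis using n(1) by (subst ln_ge_iff) auto
  qed
  have lnlg: "0 \<le> ln n * log 2 n" using ln lg1 by simp
  \<comment> \<open>The first summand absorbs the prefactor n^2. The second gives n^(- log n), which
    is at most n^(- log k) since \<open>k \<le> n\<close>.\<close>
  have m2: "2 * ln n + ln n * log 2 n \<le> m" using margin mm by linarith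
  have e2: "exp (- (2 * ln n)) = 1 / (real n)\<^sup>2"
    using n0 by (simp add: exp_minus exp_double field_simps power2_eq_square)
  have "2 * n * exp (- m) \<le> 2 * n * exp (- (2 * ln n))"
    using m2 lnlg by (intro mult_left_mono) auto
  also have "\<dots> \<le> 1" using n0 by (simp add: e2 power2_eq_square field_simps)
  finally have m_exp: "2 * n * exp (- m) \<le> 1" .
  have m_ge: "2 \<le> m" using m2 lnlg ln by linarith
  have "1 - 7 * (real n)\<^sup>2 * exp (- m) \<le> recovery_prob clique_prog n k s"
    unfolding m_def L_def
    by (rule recovery_prob_ge) (use n(1) k s nL2 m_exp m_ge in \<open>simp_all only: m_def L_def\<close>)
  moreover have "(real n)\<^sup>2 * exp (- m) \<le> (1 / real n) powr log 2 k"
  proof -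
    have "exp (- m) \<le> exp (- (2 * ln n) + - (ln n * log 2 n))" using m2 by simp
    also have "\<dots> = 1 / (real n)\<^sup>2 * exp (- (ln n * log 2 n))" by (simp only: exp_add e2)
    finally have "(real n)\<^sup>2 * exp (- m) \<le> exp (- (ln n * log 2 n))"
      using n0 by (simp add: field_simps)
    also have "\<dots> \<le> exp (- (ln n * log 2 k))"
      using k0 k(2) ln n0 by (simp add: mult_left_mono)
    also have "\<dots> = (1 / real n) powr log 2 k"
      using n0 by (simp add: powr_def ln_div mult.commute)
    finally show ?thesis .
  qed
  ultimately show "1 - 7 * (1 / real n) powr log 2 k \<le> recovery_prob clique_prog n k s"
    by linarith
qed

theorem theorem1:
  shows "\<exists>C::real. C > 0 \<and> (\<exists>P::prog.
    (\<exists>(c::real) (c'::real) (N::nat). \<forall>n\<ge>N. \<forall>k::nat. C * sqrt (real n) \<le> real k \<and> k \<le> n \<longrightarrow>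
       (let s = nat \<lfloor>c * (rounds n k * log 2 (real n))\<rfloor> in
          runs_in_space P n k s \<and>
          recovery_prob P n k s \<ge> 1 - c' * (1 / real n) powr (log 2 (real k)))) \<and>
    (\<exists>(c::real) (N::nat). \<forall>n\<ge>N.
       runs_in_space P n (nat \<lceil>C * sqrt (real n)\<rceil>)
         (nat \<lfloor>c * (real (log_star (real n)) * log 2 (real n))\<rfloor>)) \<and>
    (\<forall>(l::nat) (\<kappa>::nat \<Rightarrow> nat).
       l > 0 \<and> (\<forall>n. \<kappa> n \<le> n) \<and>
       (\<lambda>n. real (\<kappa> n)) \<in> \<omega>(\<lambda>n. sqrt (real n) * ((log 2 ^^ l) (real n))) \<longrightarrow>
       (\<exists>(c::real) (N::nat). \<forall>n\<ge>N.
          runs_in_space P n (\<kappa> n) (nat \<lfloor>c * log 2 (real n)\<rfloor>))))"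
proof -
  let ?C = "2 ^ 20 :: real"
  let ?s = "\<lambda>n k. nat \<lfloor>120 * (rounds n k * log 2 n)\<rfloor>"
  let ?large = "\<lambda>n::nat. 64 \<le> n \<and> 32 * log 2 (real n) \<le> n \<and> 24 + 2 * log 2 (real n) \<le> n \<and>
     2 * ln (real n) + ln (real n) * log 2 (real n) \<le> sqrt n / (4 * (log 2 (real n))\<^sup>2) \<and>
     2 ^ 20 * sqrt n + 1 \<le> n \<and> 1 \<le> log_star n"
  obtain N where N: "\<And>n. N \<le> n \<Longrightarrow> ?large n"
    using eventually_large unfolding eventually_sequentially by blast
  have main: "runs_in_space clique_prog n k (?s n k)"
      "1 - 7 * (1 / real n) powr log 2 k \<le> recovery_prob clique_prog n k (?s n k)"
    if "N \<le> n" "?C * sqrt n \<le> k" "k \<le> n" for n k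
    using N[OF that(1)] that(2,3) by (intro clique_prog_correct; blast)+
  have run: "runs_in_space clique_prog n k (nat \<lfloor>120 * (q * log 2 n)\<rfloor>)"
    if "N \<le> n" "?C * sqrt n \<le> k" "k \<le> n" "rounds n k \<le> q" for n k and q :: real
  proof (rule runs_in_space_mono[OF main(1)[OF that(1-3)]])
    have "64 \<le> n" using N[OF that(1)] by blast
    then have "0 \<le> log 2 n" by simp
    with that(4) have "rounds n k * log 2 n \<le> q * log 2 n" by (rule mult_right_mono)
    then have "120 * (rounds n k * log 2 n) \<le> 120 * (q * log 2 n)" by (rule mult_left_mono) simp
    then show "?s n k \<le> nat \<lfloor>120 * (q * log 2 n)\<rfloor>" by (intro nat_mono floor_mono)
  qed
  have part1: "\<exists>(c::real) (c'::real) (N::nat). \<forall>n\<ge>N. \<forall>k::nat. ?C * sqrt (real n) \<le> real k \<and> k \<le> n \<longrightarrow>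
       (let s = nat \<lfloor>c * (rounds n k * log 2 (real n))\<rfloor> in
          runs_in_space clique_prog n k s \<and>
          recovery_prob clique_prog n k s \<ge> 1 - c' * (1 / real n) powr (log 2 (real k)))"
    unfolding Let_def
  proof (rule exI[of _ 120], rule exI[of _ 7], rule exI[of _ N], intro allI impI)
    fix n k assume "N \<le> n" "?C * sqrt (real n) \<le> real k \<and> k \<le> n"
    then show "runs_in_space clique_prog n k (?s n k) \<and>
        1 - 7 * (1 / real n) powr log 2 (real k) \<le> recovery_prob clique_prog n k (?s n k)"
      using main[of n k] by simp
  qed
  have part2: "\<exists>(c::real) (N::nat). \<forall>n\<ge>N.
       runs_in_space clique_prog n (nat \<lceil>?C * sqrt (real n)\<rceil>)
         (nat \<lfloor>c * (real (log_star (real n)) * log 2 (real n))\<rfloor>)"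
  \<comment> \<open>The 600 is 120 * 5: as \<open>log_star n\<close> is at least 1, the additive 3
    in \<open>rounds\<close> is at most three times it.\<close>
  proof (rule exI[of _ 600], rule exI[of _ N], intro allI impI)
    fix n assume n: "N \<le> n"
    let ?k = "nat \<lceil>?C * sqrt (real n)\<rceil>"
    have nn: "0 \<le> ?C * sqrt n" by simp
    have k: "?C * sqrt n \<le> ?k" by linarith
    have "real ?k \<le> ?C * sqrt n + 1" using nn by linarith
    moreover have "?C * sqrt n + 1 \<le> n" using N[OF n] by blast
    ultimately have "real ?k \<le> real n" by linarith
    then have kn: "?k \<le> n" by (simp only: of_nat_le_iff)
    have "1 \<le> log_star n" using N[OF n] by blast
    moreover have "2 * (real a - real b) + 3 \<le> 5 * real a" if "1 \<le> a" for a b :: nat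
    proof -
      have "1 \<le> real a" "0 \<le> real b" using that by simp_all
      then show ?thesis by argo
    qed
    ultimately have "rounds n ?k \<le> 5 * real (log_star n)" unfolding rounds_def by blast
    from run[OF n k kn this] show "runs_in_space clique_prog n ?k (nat \<lfloor>600 * (real (log_star (real n)) * log 2 (real n))\<rfloor>)"
      by (simp only: mult.assoc[symmetric]) simp
  qed
  have part3: "\<exists>(c::real) (N::nat). \<forall>n\<ge>N. runs_in_space clique_prog n (\<kappa> n) (nat \<lfloor>c * log 2 (real n)\<rfloor>)"
    if \<kappa>: "\<And>n. \<kappa> n \<le> n"
      and w: "(\<lambda>n. real (\<kappa> n)) \<in> \<omega>(\<lambda>n. sqrt (real n) * ((log 2 ^^ l) (real n)))" for l \<kappa>
  proof -
    have tends: "filterlim (\<lambda>n. (log 2 ^^ l) (real n)) at_top sequentially"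
    proof (induction l)
      case 0
      show ?case by (simp add: filterlim_real_sequentially)
    next
      case (Suc l)
      have "filterlim (\<lambda>x. log 2 x) at_top at_top" unfolding log_def by real_asymp
      from filterlim_compose[OF this Suc] show ?case by simp
    qed
    \<comment> \<open>Small omega is used with the constant \<open>2 ^ 20\<close>, so that one
      inequality puts \<open>\<kappa> n\<close> into the admissible range and makes the ratio at
      least the \<open>l\<close>-fold logarithm.\<close>
    have "\<forall>\<^sub>F n in sequentially. ?C * norm (sqrt (real n) * ((log 2 ^^ l) (real n))) \<le> norm (real (\<kappa> n))"
      using landau_omega.smallD[OF w, of ?C] by simp
    moreover have "\<forall>\<^sub>F n in sequentially. 1 \<le> (log 2 ^^ l) (real n)"
      using tends by (simp add: filterlim_at_top)
    moreover have "\<forall>\<^sub>F n in sequentially. N \<le> n" by (rule eventually_ge_at_top)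
    ultimately have "\<forall>\<^sub>F n in sequentially. runs_in_space clique_prog n (\<kappa> n) (nat \<lfloor>120 * (2 * real l + 3) * log 2 (real n)\<rfloor>)"
    proof eventually_elim
      case (elim n)
      let ?x = "(log 2 ^^ l) (real n)"
      have n: "64 \<le> n" using N[OF elim(3)] by blast
      have big: "?C * (sqrt n * ?x) \<le> \<kappa> n" using elim(1,2) by (simp add: abs_mult)
      have "?C * (sqrt n * 1) \<le> ?C * (sqrt n * ?x)" using elim(2) by (intro mult_left_mono) auto
      then have k: "?C * sqrt n \<le> \<kappa> n" using big by simp
      have "1 * (sqrt n * ?x) \<le> ?C * (sqrt n * ?x)" using elim(2) by (intro mult_right_mono) auto
      then have "sqrt n * ?x \<le> \<kappa> n" using big by linarith
      then have "?x \<le> real (\<kappa> n) / sqrt n" using n by (simp add: pos_le_divide_eq mult.commute)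
      then have "log_star ?x \<le> log_star (real (\<kappa> n) / sqrt n)" by (rule log_star_mono)
      then have "log_star n \<le> l + log_star (real (\<kappa> n) / sqrt n)"
        using log_star_le_funpow[of "real n" l] by linarith
      then have "real (log_star n) \<le> real (l + log_star (real (\<kappa> n) / sqrt n))"
        by (simp only: of_nat_le_iff)
      then have "rounds n (\<kappa> n) \<le> 2 * real l + 3" by (simp add: rounds_def)
      from run[OF elim(3) k \<kappa> this] show ?case by (simp only: mult.assoc)
    qed
    then show ?thesis unfolding eventually_sequentially by blast
  qed
  show ?thesis
  proof (rule exI[of _ ?C], rule conjI, simp, rule exI[of _ clique_prog], intro conjI)
    show "\<forall>(l::nat) (\<kappa>::nat \<Rightarrow> nat).
       l > 0 \<and> (\<forall>n. \<kappa> n \<le> n) \<and>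
       (\<lambda>n. real (\<kappa> n)) \<in> \<omega>(\<lambda>n. sqrt (real n) * ((log 2 ^^ l) (real n))) \<longrightarrow>
       (\<exists>(c::real) (N::nat). \<forall>n\<ge>N.
          runs_in_space clique_prog n (\<kappa> n) (nat \<lfloor>c * log 2 (real n)\<rfloor>))"
    proof (intro allI impI)
    fix l :: nat and \<kappa> :: "nat \<Rightarrow> nat"
    assume "l > 0 \<and> (\<forall>n. \<kappa> n \<le> n) \<and>
       (\<lambda>n. real (\<kappa> n)) \<in> \<omega>(\<lambda>n. sqrt (real n) * ((log 2 ^^ l) (real n)))"
    then show "\<exists>(c::real) (N::nat). \<forall>n\<ge>N. runs_in_space clique_prog n (\<kappa> n) (nat \<lfloor>c * log 2 (real n)\<rfloor>)"
      by (intro part3[of \<kappa> l]) blast+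
    qed
  qed (rule part1, rule part2)
qed

end
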